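(* Let $\gamma\ge 0$, let $T>0$ be a fixed time, and let $u_0\in H^{\gamma+4}(\mathbb{T})$ be real-valued with $\widehat{(u_0)}_0=0$. Let $u$ be the solution on $[0,T]$ of the KdV equation $$\partial_t u+\partial_x^3u=\tfrac12\partial_x(u^2),\quad t>0,\ x\in\mathbb{T},\qquad u(0,x)=u_0(x),$$ and, for a time step $\tau>0$ and $t_n=n\tau$, let $u^n$ be the numerical solution produced by the LRI scheme $$u^0=u_0,\qquad u^{n+1}=\mathrm{e}^{-\tau\partial_x^3}u^n+\tfrac12 I_1^n+I_2^n,\quad n=0,1,\ldots,$$ with $I_1^n,I_2^n$ as defined in the context. Then there exist constants $\tau_0,C>0$ such that for any $0<\tau\le\tau_0$, $$\|u(t_n,\cdot)-u^n\|_{H^\gamma}\le C\tau^2,\qquad n=0,1,\ldots,\tfrac{T}{\tau},$$ where $\tau_0$ and $C$ depend only on $T$ and $\|u\|_{L^\infty((0,T);H^{\gamma+4})}$ (for the given $\gamma$).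
   Context: $\mathbb{T}=(0,2\pi)$ is the torus (periodic boundary conditions). For a function $f$ on $\mathbb{T}$, its Fourier coefficients are $\widehat f_l=\frac1{2\pi}\int_{\mathbb{T}}\mathrm{e}^{-ilx}f(x)\,dx$, $l\in\mathbb{Z}$. The norm is $\|f\|_{H^s}=\|\langle l\rangle^s\widehat f_l\|_{\ell^2(l\in\mathbb{Z})}$ with $\langle l\rangle=(1+l^2)^{1/2}$. The operator $\mathrm{e}^{t\partial_x^3}$ is the Fourier multiplier with symbol $\mathrm{e}^{-itl^3}$. For $m\in\mathbb{N}$, $m\geq1$, $\partial_x^{-m}f(x)=\sum_{l\ne0}(il)^{-m}\widehat f_l\,\mathrm{e}^{ilx}$. The KdV equation is globally well-posed in $H^{s_0}(\mathbb{T})$ for $s_0\ge -1/2$, and $u$ denotes its unique solution. Scheme: $I_1^n=\sum_{l\ne0}\widehat{(J_1^n)}_l\,\mathrm{e}^{ilx}$ and $I_2^n=\sum_{l\ne0}\widehat{(J_2^n)}_l\,\mathrm{e}^{ilx}$, where $$J_1^n=\tfrac13\big(\mathrm{e}^{-\tau\partial_x^3}\partial_x^{-1}u^n\big)^2-\tfrac13\mathrm{e}^{-\tau\partial_x^3}\big(\partial_x^{-1}u^n\big)^2,$$ $$J_2^n=\tfrac{\tau}{6}\big(\mathrm{e}^{-\tau\partial_x^3}\partial_x^{-1}u^n\big)\Big(\mathrm{e}^{-\tau\partial_x^3}(u^n)^2-\widehat{((u^n)^2)}_0\Big)-\tfrac1{18}\partial_x^{-1}\Big[\big(\mathrm{e}^{-\tau\partial_x^3}\partial_x^{-2}u^n\big)\big(\mathrm{e}^{-\tau\partial_x^3}\partial_x^{-1}(u^n)^2\big)\Big]+\tfrac1{18}\mathrm{e}^{-\tau\partial_x^3}\partial_x^{-1}\Big[\big(\partial_x^{-2}u^n\big)\big(\partial_x^{-1}(u^n)^2\big)\Big].$$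 In $J_1^n$ the operator $\mathrm{e}^{-\tau\partial_x^3}$ in the second term acts on the square $(\partial_x^{-1}u^n)^2$. *)

theory Defs
  imports "HOL-Analysis.Analysis" "HOL-Probability.Essential_Supremum"
begin

text \<open>
  Functions on the torus are \<open>2 * pi\<close>-periodic functions on the real line.  They are complex
  valued here, because Fourier multipliers are applied to them; real-valued functions are embedded
  by \<^const>\<open>complex_of_real\<close>.
\<close>

definition fourier_coeff :: "(real \<Rightarrow> complex) \<Rightarrow> int \<Rightarrow> complex" where
  "fourier_coeff f l =
     1 / (2 * pi) * (LINT x|lebesgue_on {0..2*pi}. cis (- (of_int l * x)) * f x)"

definition japanese_bracket :: "int \<Rightarrow> real" where
  "japanese_bracket l = sqrt (1 + (of_int l)\<^sup>2)"

text \<open>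
  The space \<open>H\<^sup>s\<close> for \<open>s \<ge> 0\<close>, as a subspace of \<open>L\<^sup>2\<close>.
  Its elements are functions, not classes modulo null sets.
\<close>

definition sobolev :: "real \<Rightarrow> (real \<Rightarrow> complex) set" where
  "sobolev s = {f. (\<forall>x. f (x + 2*pi) = f x)
     \<and> f \<in> borel_measurable (lebesgue_on {0..2*pi})
     \<and> integrable (lebesgue_on {0..2*pi}) (\<lambda>x. (cmod (f x))\<^sup>2)
     \<and> (\<lambda>l. (japanese_bracket l powr s * cmod (fourier_coeff f l))\<^sup>2) summable_on UNIV}"

text \<open>Meaningful only for members of \<^term>\<open>sobolev s\<close>: a divergent \<^const>\<open>infsum\<close> is \<open>0\<close>.\<close>

definition sobolev_norm :: "real \<Rightarrow> (real \<Rightarrow> complex) \<Rightarrow> real" where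
  "sobolev_norm s f =
     sqrt (\<Sum>\<^sub>\<infinity>l. (japanese_bracket l powr s * cmod (fourier_coeff f l))\<^sup>2)"

text \<open>\<open>airy t\<close> is the operator \<open>exp (t \<partial>\<^sub>x\<^sup>3)\<close>, whose symbol is \<open>exp (t (i l)\<^sup>3) = exp (- i t l\<^sup>3)\<close>.\<close>

definition airy :: "real \<Rightarrow> (real \<Rightarrow> complex) \<Rightarrow> real \<Rightarrow> complex" where
  "airy t f x =
     (\<Sum>\<^sub>\<infinity>l. cis (- (t * of_int l ^ 3)) * fourier_coeff f l * cis (of_int l * x))"

text \<open>\<open>antideriv m\<close> is \<open>\<partial>\<^sub>x\<^sup>-\<^sup>m\<close> for \<open>m \<ge> 1\<close>.\<close>

definition antideriv :: "nat \<Rightarrow> (real \<Rightarrow> complex) \<Rightarrow> real \<Rightarrow> complex" where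
  "antideriv m f x =
     (\<Sum>\<^sub>\<infinity>l\<in>-{0}. inverse ((\<i> * of_int l) ^ m) * fourier_coeff f l * cis (of_int l * x))"

definition nonzero_modes :: "(real \<Rightarrow> complex) \<Rightarrow> real \<Rightarrow> complex" where
  "nonzero_modes f x = (\<Sum>\<^sub>\<infinity>l\<in>-{0}. fourier_coeff f l * cis (of_int l * x))"

definition J1 :: "real \<Rightarrow> (real \<Rightarrow> complex) \<Rightarrow> real \<Rightarrow> complex" where
  "J1 \<tau> v x =
     1/3 * (airy (-\<tau>) (antideriv 1 v) x)\<^sup>2
   - 1/3 * airy (-\<tau>) (\<lambda>y. (antideriv 1 v y)\<^sup>2) x"

definition J2 :: "real \<Rightarrow> (real \<Rightarrow> complex) \<Rightarrow> real \<Rightarrow> complex" where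
  "J2 \<tau> v x =
     \<tau>/6 * airy (-\<tau>) (antideriv 1 v) x
         * (airy (-\<tau>) (\<lambda>y. (v y)\<^sup>2) x - fourier_coeff (\<lambda>y. (v y)\<^sup>2) 0)
   - 1/18 * antideriv 1 (\<lambda>y. airy (-\<tau>) (antideriv 2 v) y
                           * airy (-\<tau>) (antideriv 1 (\<lambda>z. (v z)\<^sup>2)) y) x
   + 1/18 * airy (-\<tau>) (antideriv 1 (\<lambda>y. antideriv 2 v y * antideriv 1 (\<lambda>z. (v z)\<^sup>2) y)) x"

definition lri_step :: "real \<Rightarrow> (real \<Rightarrow> complex) \<Rightarrow> real \<Rightarrow> complex" where
  "lri_step \<tau> v x =
     airy (-\<tau>) v x + 1/2 * nonzero_modes (J1 \<tau> v) x + nonzero_modes (J2 \<tau> v) x"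

primrec lri :: "real \<Rightarrow> (real \<Rightarrow> complex) \<Rightarrow> nat \<Rightarrow> real \<Rightarrow> complex" where
  "lri \<tau> v 0 = v"
| "lri \<tau> v (Suc n) = lri_step \<tau> (lri \<tau> v n)"

text \<open>
  \<open>u \<in> C([0,T]; H\<^sup>s)\<close> solves the KdV equation with initial value \<open>u\<^sub>0\<close>.  The equation is required
  pointwise.  This is meant for \<open>s \<ge> 4\<close>, where it is no restriction: the well-posedness solution
  in \<open>H\<^sup>s\<close> is then in \<open>C([0,T]; C\<^sup>3)\<close> with continuous time derivative, once each \<open>u t\<close> with
  \<open>t > 0\<close> is taken to be the continuous representative of its class.  At \<open>t = 0\<close> any
  representative of \<open>u\<^sub>0\<close> is allowed.
\<close>

definition kdv_solution ::
    "real \<Rightarrow> real \<Rightarrow> (real \<Rightarrow> real) \<Rightarrow> (real \<Rightarrow> real \<Rightarrow> real) \<Rightarrow> bool" where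
  "kdv_solution s T u0 u \<longleftrightarrow>
     u 0 = u0
   \<and> (\<forall>t\<in>{0..T}. (\<lambda>x. complex_of_real (u t x)) \<in> sobolev s)
   \<and> (\<forall>t\<in>{0..T}. ((\<lambda>r. sobolev_norm s (\<lambda>x. complex_of_real (u r x - u t x))) \<longlongrightarrow> 0)
                     (at t within {0..T}))
   \<and> (\<forall>t\<in>{0<..<T}. \<forall>x.
          (\<lambda>r. u r x) differentiable (at t)
        \<and> (\<forall>k<3. (deriv ^^ k) (u t) differentiable (at x))
        \<and> deriv (\<lambda>r. u r x) t + (deriv ^^ 3) (u t) x = 1/2 * deriv (\<lambda>y. (u t y)\<^sup>2) x)"

text \<open>The norm of \<open>L\<^sup>\<infinity>((0,T); H\<^sup>s)\<close>.\<close>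

definition Linf_sobolev_norm :: "real \<Rightarrow> real \<Rightarrow> (real \<Rightarrow> real \<Rightarrow> real) \<Rightarrow> ereal" where
  "Linf_sobolev_norm T s u =
     esssup (lebesgue_on {0<..<T})
       (\<lambda>t. ereal (sobolev_norm s (\<lambda>x. complex_of_real (u t x))))"

end

theory Submission
  imports Defs "HOL-Library.Periodic_Fun"
begin

text \<open>
  On the Fourier side, and in the variable \<open>w = exp (s \<partial>\<^sub>x\<^sup>3) u\<close>, the equation reads
  \<open>w' = N s w w\<close>, where \<open>N s x y\<close> has the coefficients
  \<open>i l / 2 * (\<Sum>k. exp (- 3 i s l k (l - k)) x\<^sub>k y\<^sub>l\<^sub>-\<^sub>k)\<close>.  One step of the scheme from \<open>a\<close> is the value at
  \<open>s = \<tau>\<close> of a path \<open>P\<close> with \<open>P 0 = a\<close> and \<open>P' s = N s a a + 2 s N s a G\<close>, \<open>G = N 0 a a\<close>.  Comparing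
  the two derivatives shows that the local error is \<open>O(\<tau>\<^sup>3)\<close> in \<open>H\<^sup>\<gamma>\<close>, at the price of four
  derivatives of \<open>u\<close>, and \<open>O(\<tau>\<^sup>2)\<close> in \<open>H\<^sup>\<gamma>\<^sup>+\<^sup>1\<close>.

  For stability let \<open>c\<close> be the exact solution, \<open>e\<close> the error and \<open>B\<close> the integral of \<open>N\<close> over
  \<open>[0, \<tau>]\<close>.  As \<open>c\<close> is real, the form \<open>Re \<langle>e, B c e\<rangle>\<close> is a commutator: the derivative falls on \<open>c\<close>,
  so the form is \<open>O(\<tau> |e|\<^sup>2)\<close>.  The symbol of \<open>B\<close> is at most \<open>\<tau>\<^sup>1\<^sup>/\<^sup>2\<close>, hence \<open>|B c e|\<^sup>2\<close> is
  \<open>O(\<tau> |e|\<^sup>2)\<close> as well.  Terms of higher order in \<open>e\<close> are harmless once \<open>e\<close> is at most \<open>\<tau>\<^sup>1\<^sup>/\<^sup>2\<close> in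
  the algebra \<open>H\<^sup>\<gamma>\<^sup>+\<^sup>1\<close>; so the induction over the time steps carries a first-order bound in
  \<open>H\<^sup>\<gamma>\<^sup>+\<^sup>1\<close> along with the second-order bound in \<open>H\<^sup>\<gamma>\<close>.
\<close>

section \<open>Sobolev bounds for sequences\<close>

text \<open>The phase comes from the factorisation
  \<open>l^3 - k^3 - (l - k)^3 = 3 l k (l - k)\<close>. It makes the time integrals of the
  oscillating symbols elementary, with denominators that are products of functions of
  \<open>k\<close>, of \<open>l - k\<close> and of \<open>l\<close> alone. This is why one step can
  be written with products, antiderivatives and Airy multipliers of whole functions. The modes
  \<open>k = 0\<close> and \<open>k = l\<close>, where these denominators vanish, drop out because
  the mean of the solution is zero. The obstacle to stability is that the symbol of \<open>B\<close>
  has no bound of order \<tau> without a factor \<open>l\<close>, that is, without losing a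
  derivative of the error. Without loss it is only of order \<open>sqrt \<tau>\<close>, which cannot
  be summed over \<open>T / \<tau>\<close> steps. So the term linear in \<open>e\<close> has to be
  handled through the square of its norm, and the term quadratic in \<open>e\<close> has to get its
  second factor \<open>sqrt \<tau>\<close> from \<open>e\<close> itself. The auxiliary space is one
  derivative above the final one because \<gamma> may be 0 and the product estimate wants one factor
  in \<open>H^1\<close> or better. An error of first order there falls below
  \<open>sqrt \<tau>\<close> once \<tau> is small, and this decides the size of the admissible
  steps.\<close>

type_synonym seq = "int \<Rightarrow> complex"

abbreviation J :: "int \<Rightarrow> real" where "J \<equiv> japanese_bracket"

lemma J_ge_1: "1 \<le> J l"
  by (simp add: japanese_bracket_def)

lemma J_pos [simp]: "0 < J l"
  using J_ge_1[of l] by linarith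

lemma J_nonneg [simp]: "0 \<le> J l"
  using J_pos[of l] by linarith

lemma J_neq_0 [simp]: "J l \<noteq> 0"
  using J_pos[of l] by linarith

lemma J_minus [simp]: "J (- l) = J l"
  by (simp add: japanese_bracket_def)

lemma abs_le_J: "\<bar>of_int l\<bar> \<le> J l"
  unfolding japanese_bracket_def by (rule real_le_rsqrt) simp

text \<open>\<open>J l\<close> is the modulus of \<open>1 + i l\<close>, so this is the triangle
  inequality in the complex plane for \<open>1 + i k\<close> and \<open>i (l - k)\<close>.\<close>

lemma J_triangle: "J l \<le> J k + J (l - k)"
proof -
  define w z where "w = Complex 1 (of_int k)" and "z = Complex 1 (of_int (l - k))"
  have "J l = cmod (Complex 1 (of_int l))"
    by (simp add: japanese_bracket_def cmod_def)
  also have "Complex 1 (of_int l) = w + Complex 0 (of_int (l - k))"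
    by (simp add: w_def complex_eq_iff)
  also have "cmod \<dots> \<le> cmod w + cmod (Complex 0 (of_int (l - k)))"
    by (rule norm_triangle_ineq)
  also have "\<dots> \<le> J k + J (l - k)"
    using abs_le_J[of "l - k"] by (simp add: w_def japanese_bracket_def cmod_def)
  finally show ?thesis .
qed

lemma J_le_mult: "J l \<le> 2 * J k * J (l - k)"
proof -
  have "J k \<le> J k * J (l - k)" "J (l - k) \<le> J k * J (l - k)"
    using J_ge_1[of k] J_ge_1[of "l - k"] by (auto simp: mult_le_cancel_left1 mult_le_cancel_right1)
  then show ?thesis using J_triangle[of l k] by linarith
qed

lemma J_powr_mono: "s \<le> t \<Longrightarrow> J l powr s \<le> J l powr t"
  using J_ge_1[of l] by (intro powr_mono) auto

lemma J_powr_ge_1: "0 \<le> s \<Longrightarrow> 1 \<le> J l powr s"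
  using J_ge_1[of l] by (simp add: ge_one_powr_ge_zero)

lemma summable_inverse_J_square: "(\<lambda>l. 1 / (J l)\<^sup>2) summable_on UNIV"
proof -
  have nat: "(\<lambda>n::nat. 1 / (J (int n))\<^sup>2) summable_on A" for A
  proof -
    have "summable (\<lambda>n::nat. 1 / (J (int n))\<^sup>2)"
    proof (rule summable_comparison_test')
      show "summable (\<lambda>n. 1 / (of_nat n ^ 2) :: real)"
        using inverse_power_summable[of 2, where ?'a = real] by (simp add: field_simps)
      show "norm (1 / (J (int n))\<^sup>2) \<le> 1 / real n ^ 2" if "1 \<le> n" for n
      proof -
        have "0 < (real n)\<^sup>2" using that by simp
        then show ?thesis by (simp add: japanese_bracket_def frac_le)
      qed
    qed
    then have "(\<lambda>n::nat. 1 / (J (int n))\<^sup>2) summable_on UNIV"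
      by (intro norm_summable_imp_summable_on) simp
    then show ?thesis by (rule summable_on_subset_banach) auto
  qed
  have "(\<lambda>l. 1 / (J l)\<^sup>2) summable_on {0..}"
    using summable_on_reindex_bij_betw[of int UNIV "{0..}" "\<lambda>l. 1 / (J l)\<^sup>2"] nat
    by (force simp: bij_betw_def image_def intro!: exI[of _ "nat _"])
  moreover have "(\<lambda>l. 1 / (J l)\<^sup>2) summable_on {..<0}"
  proof -
    have "bij_betw (\<lambda>n. - int n) {1..} {..<0}"
      by (rule bij_betwI[where g = "\<lambda>l. nat (- l)"]) auto
    from summable_on_reindex_bij_betw[OF this, of "\<lambda>l. 1 / (J l)\<^sup>2"] nat[of "{1..}"]
    show ?thesis by simp
  qed
  moreover have "UNIV = {0..} \<union> {..<0::int}" by auto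
  ultimately show ?thesis
    by (metis summable_on_Un_disjoint ivl_disj_int_one(8) summable_on_union)
qed

definition bracket_sum :: real where "bracket_sum = (\<Sum>\<^sub>\<infinity>l. 1 / (J l)\<^sup>2)"

lemma sum_inverse_J_square_le: "finite K \<Longrightarrow> (\<Sum>k\<in>K. 1 / (J k)\<^sup>2) \<le> bracket_sum"
  unfolding bracket_sum_def by (rule finite_sum_le_infsum[OF summable_inverse_J_square]) auto

lemma sum_inverse_J_square_shift_le: "finite K \<Longrightarrow> (\<Sum>k\<in>K. 1 / (J (l - k))\<^sup>2) \<le> bracket_sum"
  using sum_inverse_J_square_le[of "(\<lambda>k. l - k) ` K"]
  by (simp add: sum.reindex inj_on_def)

lemma bracket_sum_ge_1: "1 \<le> bracket_sum"
  using sum_inverse_J_square_le[of "{0}"] by (simp add: japanese_bracket_def)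

lemma dominated_summable:
  fixes f :: "'a \<Rightarrow> complex"
  assumes "g summable_on A" "\<And>x. x \<in> A \<Longrightarrow> cmod (f x) \<le> g x"
  shows "(\<lambda>x. cmod (f x)) summable_on A" "f summable_on A" "cmod (infsum f A) \<le> infsum g A"
proof -
  show *: "(\<lambda>x. cmod (f x)) summable_on A"
    by (rule summable_on_comparison_test[OF assms(1)]) (use assms(2) in auto)
  then show f: "f summable_on A" by (rule Infinite_Sum.abs_summable_summable)
  show "cmod (infsum f A) \<le> infsum g A"
    using norm_infsum_le[OF has_sum_infsum[OF f] has_sum_infsum[OF assms(1)]] assms(2) by blast
qed

abbreviation wnorm :: "real \<Rightarrow> seq \<Rightarrow> int set \<Rightarrow> real" where
  "wnorm s a L \<equiv> L2_set (\<lambda>l. J l powr s * cmod (a l)) L"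

text \<open>
  \<open>Hs_le s K a\<close> says that \<open>a\<close> is in \<open>H\<^sup>s\<close> with norm at most \<open>K\<close>; finite partial sums make this
  meaningful without a side condition on summability.
\<close>

definition Hs_le :: "real \<Rightarrow> real \<Rightarrow> seq \<Rightarrow> bool" where
  "Hs_le s K a \<longleftrightarrow> (\<forall>L. finite L \<longrightarrow> wnorm s a L \<le> K)"

lemma Hs_leI: "(\<And>L. finite L \<Longrightarrow> wnorm s a L \<le> K) \<Longrightarrow> Hs_le s K a"
  by (simp add: Hs_le_def)

lemma Hs_leD: "Hs_le s K a \<Longrightarrow> wnorm s a L \<le> K"
  by (cases "finite L") (auto simp: Hs_le_def dest: spec[of _ "{}"])

lemma Hs_le_nonneg: "Hs_le s K a \<Longrightarrow> 0 \<le> K"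
  using Hs_leD[of s K a "{}"] by simp

lemma Hs_le_le:
  assumes "Hs_le s A y" "\<And>l. cmod (x l) \<le> K * cmod (y l)" "0 \<le> K" "K * A \<le> B"
  shows "Hs_le s B x"
proof (rule Hs_leI)
  fix L :: "int set" assume "finite L"
  have "wnorm s x L \<le> L2_set (\<lambda>l. K * (J l powr s * cmod (y l))) L"
    using assms by (intro L2_set_mono) (auto simp: mult.left_commute intro: mult_left_mono)
  also have "\<dots> = K * wnorm s y L"
    using assms(3) by (simp add: L2_set_right_distrib)
  also have "\<dots> \<le> K * A"
    using assms(3) Hs_leD[OF assms(1)] by (simp add: mult_left_mono)
  finally show "wnorm s x L \<le> B" using assms(4) by linarith
qed

lemma Hs_le_weaken:
  assumes "Hs_le s A x" "t \<le> s" "A \<le> B"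
  shows "Hs_le t B x"
proof (rule Hs_leI)
  fix L :: "int set" assume "finite L"
  have "wnorm t x L \<le> wnorm s x L"
    using J_powr_mono[OF assms(2)] by (intro L2_set_mono) (auto intro: mult_right_mono)
  also have "\<dots> \<le> A" by (rule Hs_leD[OF assms(1)])
  finally show "wnorm t x L \<le> B" using assms(3) by linarith
qed

lemma Hs_le_add:
  assumes "Hs_le s A x" "Hs_le s B y"
  shows "Hs_le s (A + B) (\<lambda>l. x l + y l)"
proof (rule Hs_leI)
  fix L :: "int set" assume "finite L"
  have "L2_set (\<lambda>l. J l powr s * cmod (x l + y l)) L
      \<le> L2_set (\<lambda>l. J l powr s * cmod (x l) + J l powr s * cmod (y l)) L"
    by (intro L2_set_mono) (auto simp flip: distrib_left intro!: mult_left_mono norm_triangle_ineq)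
  also have "\<dots> \<le> wnorm s x L + wnorm s y L"
    by (rule L2_set_triangle_ineq)
  also have "\<dots> \<le> A + B"
    by (intro add_mono Hs_leD assms)
  finally show "L2_set (\<lambda>l. J l powr s * cmod (x l + y l)) L \<le> A + B" .
qed

lemma Hs_le_diff:
  assumes "Hs_le s A x" "Hs_le s B y"
  shows "Hs_le s (A + B) (\<lambda>l. x l - y l)"
proof -
  have "Hs_le s B (\<lambda>l. - y l)"
    by (rule Hs_le_le[OF assms(2), where K = 1]) auto
  from Hs_le_add[OF assms(1) this] show ?thesis by simp
qed

lemma Hs_le_zero: "0 \<le> K \<Longrightarrow> Hs_le s K (\<lambda>_. 0)"
  by (simp add: Hs_le_def L2_set_def)

text \<open>A power of the weight can be moved from the norm into the sequence. This reduces
  estimates with a loss of derivatives to estimates without one.\<close>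

lemma Hs_le_shift:
  assumes "Hs_le (s + p) A x"
  shows "Hs_le s A (\<lambda>l. of_real (J l powr p) * x l)"
proof -
  have "J l powr s * (J l powr p * y) = J l powr (s + p) * y" for l y
    by (simp add: powr_add)
  then show ?thesis
    using assms unfolding Hs_le_def by (simp only: norm_mult norm_of_real abs_of_nonneg powr_ge_zero)
qed

lemma Hs_le_shift':
  assumes "Hs_le s A x"
  shows "Hs_le (s - p) A (\<lambda>l. of_real (J l powr p) * x l)"
  using Hs_le_shift[of "s - p" p A x] assms by simp

lemma Hs_le_single: "Hs_le s A x \<Longrightarrow> J l powr s * cmod (x l) \<le> A"
  using Hs_leD[of s A x "{l}"] by simp

text \<open>Cauchy-Schwarz against the square summable sequence \<open>1 / J l\<close>: functions in
  \<open>H^1\<close> have absolutely convergent Fourier series.\<close>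

lemma Hs_le_l1:
  assumes "Hs_le 1 A x"
  shows "(\<lambda>l. cmod (x l)) summable_on UNIV" "(\<Sum>\<^sub>\<infinity>l. cmod (x l)) \<le> sqrt bracket_sum * A"
proof -
  have fin: "(\<Sum>l\<in>L. cmod (x l)) \<le> sqrt bracket_sum * A" if "finite L" for L
  proof -
    have "(\<Sum>l\<in>L. cmod (x l)) = (\<Sum>l\<in>L. \<bar>1 / J l\<bar> * \<bar>J l powr 1 * cmod (x l)\<bar>)"
      by (intro sum.cong) auto
    also have "\<dots> \<le> L2_set (\<lambda>l. 1 / J l) L * wnorm 1 x L"
      by (rule L2_set_mult_ineq)
    also have "\<dots> \<le> sqrt bracket_sum * A"
    proof (rule mult_mono)
      show "L2_set (\<lambda>l. 1 / J l) L \<le> sqrt bracket_sum"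
        using sum_inverse_J_square_le[OF that] by (simp add: L2_set_def power_divide)
    qed (use bracket_sum_ge_1 Hs_leD[OF assms] in auto)
    finally show ?thesis .
  qed
  show *: "(\<lambda>l. cmod (x l)) summable_on UNIV"
    by (rule nonneg_bounded_partial_sums_imp_summable_on[where C = "sqrt bracket_sum * A"])
       (auto simp: fin eventually_finite_subsets_at_top)
  show "(\<Sum>\<^sub>\<infinity>l. cmod (x l)) \<le> sqrt bracket_sum * A"
    using * by (rule infsum_le_finite_sums) (auto intro: fin)
qed

lemma Hs_le_iff_infsum:
  assumes "0 \<le> K"
  shows "Hs_le s K a \<longleftrightarrow> (\<lambda>l. (J l powr s * cmod (a l))\<^sup>2) summable_on UNIV
           \<and> (\<Sum>\<^sub>\<infinity>l. (J l powr s * cmod (a l))\<^sup>2) \<le> K\<^sup>2"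
proof
  assume "Hs_le s K a"
  then have fin: "(\<Sum>l\<in>L. (J l powr s * cmod (a l))\<^sup>2) \<le> K\<^sup>2" for L
    using Hs_leD[of s K a L] by (simp add: L2_set_def sqrt_le_D)
  have *: "(\<lambda>l. (J l powr s * cmod (a l))\<^sup>2) summable_on UNIV"
    by (rule nonneg_bounded_partial_sums_imp_summable_on[where C = "K\<^sup>2"])
       (auto simp: fin eventually_finite_subsets_at_top)
  then show "(\<lambda>l. (J l powr s * cmod (a l))\<^sup>2) summable_on UNIV
           \<and> (\<Sum>\<^sub>\<infinity>l. (J l powr s * cmod (a l))\<^sup>2) \<le> K\<^sup>2"
    using infsum_le_finite_sums[OF *] fin by blast
next
  assume *: "(\<lambda>l. (J l powr s * cmod (a l))\<^sup>2) summable_on UNIV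
           \<and> (\<Sum>\<^sub>\<infinity>l. (J l powr s * cmod (a l))\<^sup>2) \<le> K\<^sup>2"
  show "Hs_le s K a"
  proof (rule Hs_leI)
    fix L :: "int set" assume "finite L"
    then have "(\<Sum>l\<in>L. (J l powr s * cmod (a l))\<^sup>2) \<le> K\<^sup>2"
      using finite_sum_le_infsum[of "\<lambda>l. (J l powr s * cmod (a l))\<^sup>2" UNIV L] * by force
    then show "wnorm s a L \<le> K"
      using assms by (simp add: L2_set_def real_le_lsqrt)
  qed
qed

section \<open>Bilinear Fourier multipliers and the product estimate\<close>

definition bil :: "(int \<Rightarrow> int \<Rightarrow> complex) \<Rightarrow> seq \<Rightarrow> seq \<Rightarrow> int \<Rightarrow> complex" where
  "bil b x y l = (\<Sum>\<^sub>\<infinity>k. b l k * x k * y (l - k))"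

definition conv :: "seq \<Rightarrow> seq \<Rightarrow> int \<Rightarrow> complex" where
  "conv = bil (\<lambda>_ _. 1)"

text \<open>The factor \<open>2 powr s\<close> comes from
  \<open>J l \<le> 2 * max (J k) (J (l - k))\<close>, and the root from summing
  \<open>1 / (J k)^2 + 1 / (J (l - k))^2\<close> over \<open>k\<close>.\<close>

definition KC :: "real \<Rightarrow> real" where "KC s = 2 powr s * sqrt (2 * bracket_sum)"

lemma KC_nonneg [simp]: "0 \<le> KC s"
  using bracket_sum_ge_1 by (simp add: KC_def)

text \<open>
  The product estimate is the Cauchy-Schwarz inequality with this weight, whose square has a sum
  over \<open>k\<close> that is bounded uniformly in \<open>l\<close>.
\<close>

lemma weight_bound:
  assumes "0 \<le> r" "r \<le> s" "1 \<le> s" and that: "m = l - k"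
  shows "(J l powr r / (J k powr r * J m powr s))\<^sup>2 \<le> 4 powr r * (1 / (J k)\<^sup>2 + 1 / (J m)\<^sup>2)"
proof -
  have main: "J l powr r / (J k powr r * J m powr s) \<le> 2 powr r / J (if J m \<le> J k then m else k)"
  proof (cases "J m \<le> J k")
    case True
    then have "J l \<le> 2 * J k" using J_triangle[of l k] that by simp
    then have "J l powr r \<le> 2 powr r * J k powr r"
      using powr_mono2[of r "J l" "2 * J k"] assms by (simp add: powr_mult)
    moreover have "J m powr 1 \<le> J m powr s" using assms by (intro J_powr_mono)
    ultimately have "J l powr r * J m \<le> 2 powr r * J k powr r * J m powr s"
      by (intro mult_mono) auto
    then show ?thesis using True by (simp add: divide_simps mult_ac)
  next
    case False
    then have "J l \<le> 2 * J m" using J_triangle[of l k] that by simp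
    then have "J l powr r \<le> 2 powr r * J m powr r"
      using powr_mono2[of r "J l" "2 * J m"] assms by (simp add: powr_mult)
    moreover have "J k powr 1 \<le> J k powr s" using assms by (intro J_powr_mono)
    ultimately have "J l powr r * J k \<le> 2 powr r * J m powr r * J k powr s"
      by (intro mult_mono) auto
    \<comment> \<open>Only \<open>r\<close> powers of \<open>J k\<close> are available. The
      remaining \<open>s - r\<close> are traded for powers of the larger weight
      \<open>J m\<close>.\<close>
    also have "J k powr s = J k powr r * J k powr (s - r)" by (simp flip: powr_add)
    also have "J k powr (s - r) \<le> J m powr (s - r)"
      using False assms by (intro powr_mono2) auto
    also have "2 powr r * J m powr r * (J k powr r * J m powr (s - r)) = 2 powr r * J k powr r * J m powr s"
      by (simp add: mult_ac flip: powr_add)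
    finally have "J l powr r * J k \<le> 2 powr r * J k powr r * J m powr s" by (simp add: mult_ac)
    then show ?thesis using False by (simp add: divide_simps mult_ac)
  qed
  have "(J l powr r / (J k powr r * J m powr s))\<^sup>2 \<le> (2 powr r / J (if J m \<le> J k then m else k))\<^sup>2"
    by (rule power_mono[OF main]) simp
  also have "\<dots> = (2 powr r)\<^sup>2 * (1 / (J (if J m \<le> J k then m else k))\<^sup>2)"
    by (simp add: power_divide)
  also have "((2::real) powr r)\<^sup>2 = 4 powr r"
    using powr_mult[of 2 2 r] by (simp add: power2_eq_square)
  also have "1 / (J (if J m \<le> J k then m else k))\<^sup>2 \<le> 1 / (J k)\<^sup>2 + 1 / (J m)\<^sup>2" by auto
  finally show ?thesis by (simp add: mult_left_mono)
qed

text \<open>After Cauchy-Schwarz in \<open>k\<close> against the weight, the sums over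
  \<open>l\<close> and \<open>k\<close> are exchanged: for every fixed \<open>k\<close> the shifted
  sum of the squares of \<open>Y\<close> is at most \<open>B^2\<close>. Finite sums avoid all
  questions of convergence, which the bound itself answers afterwards.\<close>

lemma product_finite:
  assumes "0 \<le> r" "r \<le> s" "1 \<le> s" and x: "Hs_le r A x" and y: "Hs_le s B y"
    and fin: "finite L" "finite K"
  shows "L2_set (\<lambda>l. J l powr r * (\<Sum>k\<in>K. cmod (x k) * cmod (y (l - k)))) L \<le> KC r * A * B"
    (is "?N \<le> _")
proof -
  define X Y where "X k = J k powr r * cmod (x k)" and "Y k = J k powr s * cmod (y k)" for k
  have A: "0 \<le> A" and B: "0 \<le> B" using x y Hs_le_nonneg by auto
  have X2: "(\<Sum>k\<in>K. (X k)\<^sup>2) \<le> A\<^sup>2"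
    using Hs_leD[OF x, of K] by (simp add: L2_set_def X_def sqrt_le_D)
  have Y2: "(\<Sum>l\<in>L. (Y (l - k))\<^sup>2) \<le> B\<^sup>2" for k
  proof -
    have "(\<Sum>l\<in>L. (Y (l - k))\<^sup>2) = (\<Sum>l\<in>(\<lambda>l. l - k) ` L. (Y l)\<^sup>2)"
      by (simp add: sum.reindex inj_on_def)
    then show ?thesis
      using Hs_leD[OF y, of "(\<lambda>l. l - k) ` L"] by (simp add: L2_set_def Y_def sqrt_le_D)
  qed
  have one: "J l powr r * (\<Sum>k\<in>K. cmod (x k) * cmod (y (l - k)))
      \<le> KC r * L2_set (\<lambda>k. X k * Y (l - k)) K" for l
  proof -
    have "J l powr r * (\<Sum>k\<in>K. cmod (x k) * cmod (y (l - k)))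
        = (\<Sum>k\<in>K. \<bar>J l powr r / (J k powr r * J (l - k) powr s)\<bar> * \<bar>X k * Y (l - k)\<bar>)"
      unfolding sum_distrib_left X_def Y_def by (intro sum.cong refl) (simp add: divide_simps)
    also have "\<dots> \<le> L2_set (\<lambda>k. J l powr r / (J k powr r * J (l - k) powr s)) K
        * L2_set (\<lambda>k. X k * Y (l - k)) K"
      by (rule L2_set_mult_ineq)
    also have "\<dots> \<le> KC r * L2_set (\<lambda>k. X k * Y (l - k)) K"
    proof (rule mult_right_mono)
      have "(\<Sum>k\<in>K. (J l powr r / (J k powr r * J (l - k) powr s))\<^sup>2)
          \<le> (\<Sum>k\<in>K. 4 powr r * (1 / (J k)\<^sup>2 + 1 / (J (l - k))\<^sup>2))"
        by (intro sum_mono weight_bound assms) simp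
      also have "\<dots> \<le> 4 powr r * (2 * bracket_sum)"
        using sum_inverse_J_square_le[OF fin(2)] sum_inverse_J_square_shift_le[OF fin(2), of l]
        by (simp add: sum.distrib flip: sum_distrib_left)
      also have "\<dots> = (KC r)\<^sup>2"
        using bracket_sum_ge_1 by (simp add: KC_def power_mult_distrib power2_eq_square[of "2 powr _"] flip: powr_mult)
      finally show "L2_set (\<lambda>k. J l powr r / (J k powr r * J (l - k) powr s)) K \<le> KC r"
        unfolding L2_set_def by (simp add: real_le_lsqrt)
    qed simp
    finally show ?thesis .
  qed
  have "?N
      \<le> L2_set (\<lambda>l. KC r * L2_set (\<lambda>k. X k * Y (l - k)) K) L"
    by (intro L2_set_mono one mult_nonneg_nonneg sum_nonneg) auto
  also have "\<dots> = KC r * sqrt (\<Sum>l\<in>L. \<Sum>k\<in>K. (X k * Y (l - k))\<^sup>2)"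
    by (subst L2_set_right_distrib[symmetric]) (simp_all add: L2_set_def sum_nonneg)
  finally have 1: "?N
      \<le> KC r * sqrt (\<Sum>l\<in>L. \<Sum>k\<in>K. (X k * Y (l - k))\<^sup>2)" .
  have "(\<Sum>l\<in>L. \<Sum>k\<in>K. (X k * Y (l - k))\<^sup>2) = (\<Sum>k\<in>K. (X k)\<^sup>2 * (\<Sum>l\<in>L. (Y (l - k))\<^sup>2))"
    by (subst sum.swap) (simp add: sum_distrib_left power_mult_distrib)
  also have "\<dots> \<le> (\<Sum>k\<in>K. (X k)\<^sup>2 * B\<^sup>2)"
    by (intro sum_mono mult_left_mono Y2) simp
  also have "\<dots> = (\<Sum>k\<in>K. (X k)\<^sup>2) * B\<^sup>2"
    by (simp add: sum_distrib_right)
  also have "\<dots> \<le> (A * B)\<^sup>2"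
    unfolding power_mult_distrib by (intro mult_right_mono X2) simp
  finally have "KC r * sqrt (\<Sum>l\<in>L. \<Sum>k\<in>K. (X k * Y (l - k))\<^sup>2) \<le> KC r * sqrt ((A * B)\<^sup>2)"
    by (intro mult_left_mono real_sqrt_le_mono) simp_all
  then show ?thesis using 1 A B by (simp add: mult.assoc)
qed

lemma product_summable:
  assumes x: "Hs_le 0 A x" and y: "Hs_le 1 B y"
  shows "(\<lambda>k. cmod (x k) * cmod (y (l - k))) summable_on UNIV"
proof (rule nonneg_bounded_partial_sums_imp_summable_on[where C = "KC 0 * A * B"])
  have "(\<Sum>k\<in>K. cmod (x k) * cmod (y (l - k))) \<le> KC 0 * A * B" if "finite K" for K
    using product_finite[OF _ _ _ x y _ that, of "{l}"] by (simp add: abs_of_nonneg sum_nonneg)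
  then show "\<forall>\<^sub>F K in finite_subsets_at_top UNIV. (\<Sum>k\<in>K. cmod (x k) * cmod (y (l - k))) \<le> KC 0 * A * B"
    by (auto intro: eventually_finite_subsets_at_top_weakI)
qed auto

lemma bil_summable:
  assumes x: "Hs_le 0 A x" and y: "Hs_le 1 B y" and b: "\<And>k. cmod (b k) \<le> K"
  shows "(\<lambda>k. cmod (b k * x k * y (l - k))) summable_on UNIV"
proof (rule dominated_summable(1))
  show "(\<lambda>k. K * (cmod (x k) * cmod (y (l - k)))) summable_on UNIV"
    by (intro summable_on_cmult_right product_summable[OF x y])
  show "cmod (b k * x k * y (l - k)) \<le> K * (cmod (x k) * cmod (y (l - k)))" for k
    using b[of k] by (simp add: norm_mult mult.assoc mult_right_mono)
qed

text \<open>The exponents \<open>p\<close> and \<open>q\<close> are the derivatives that the symbol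
  takes from \<open>x\<close> and \<open>y\<close>, and \<open>d\<close> those that it takes from
  the result. Absorbing the powers into \<open>x\<close> and \<open>y\<close> leaves the product
  estimate \<open>H^r * H^s \<rightarrow> H^r\<close>.\<close>

lemma Hs_le_bil:
  assumes "0 \<le> r" "r \<le> s" "1 \<le> s"
    and x: "Hs_le (r + p) A x" and y: "Hs_le (s + q) B y"
    and b: "\<And>l k. cmod (b l k) \<le> K * J l powr d * J k powr p * J (l - k) powr q" and K: "0 \<le> K"
    and C: "KC r * K * A * B \<le> C"
  shows "Hs_le (r - d) C (bil b x y)"
proof (rule Hs_leI)
  define x' where "x' = (\<lambda>l. of_real (J l powr p) * x l)"
  define y' where "y' = (\<lambda>l. of_real (J l powr q) * y l)"
  have x': "Hs_le r A x'" unfolding x'_def by (rule Hs_le_shift[OF x])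
  have y': "Hs_le s B y'" unfolding y'_def by (rule Hs_le_shift[OF y])
  have sm: "(\<lambda>k. cmod (x' k) * cmod (y' (l - k))) summable_on UNIV" for l
    using assms by (intro product_summable Hs_le_weaken[OF x'] Hs_le_weaken[OF y']) auto
  let ?S = "\<lambda>l. \<Sum>\<^sub>\<infinity>k. cmod (x' k) * cmod (y' (l - k))"
  fix L :: "int set" assume L: "finite L"
  have pt: "cmod (b l k * x k * y (l - k)) \<le> K * J l powr d * (cmod (x' k) * cmod (y' (l - k)))" for l k
  proof -
    have "cmod (b l k * x k * y (l - k)) = cmod (b l k) * (cmod (x k) * cmod (y (l - k)))"
      by (simp add: norm_mult)
    also have "\<dots> \<le> (K * J l powr d * J k powr p * J (l - k) powr q) * (cmod (x k) * cmod (y (l - k)))"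
      by (intro mult_right_mono b) simp
    finally show ?thesis by (simp add: x'_def y'_def norm_mult mult_ac)
  qed
  have le: "cmod (bil b x y l) \<le> K * J l powr d * ?S l" for l
  proof -
    have s2: "(\<lambda>k. K * J l powr d * (cmod (x' k) * cmod (y' (l - k)))) summable_on UNIV"
      by (intro summable_on_cmult_right sm)
    have "cmod (bil b x y l) \<le> (\<Sum>\<^sub>\<infinity>k. K * J l powr d * (cmod (x' k) * cmod (y' (l - k))))"
      unfolding bil_def by (rule dominated_summable(3)[OF s2 pt])
    also have "\<dots> = K * J l powr d * ?S l"
      by (rule infsum_cmult_right'; simp)
    finally show ?thesis .
  qed
  have "wnorm (r - d) (bil b x y) L
     \<le> L2_set (\<lambda>l. K * (J l powr r * ?S l)) L"
  proof (rule L2_set_mono)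
    fix l
    have "J l powr (r - d) * cmod (bil b x y l)
      \<le> J l powr (r - d) * (K * J l powr d * ?S l)"
      by (intro mult_left_mono le) simp
    also have "\<dots> = K * ((J l powr (r - d) * J l powr d) * ?S l)"
      by simp
    also have "J l powr (r - d) * J l powr d = J l powr r" by (simp flip: powr_add)
    finally show "J l powr (r - d) * cmod (bil b x y l)
      \<le> K * (J l powr r * ?S l)" .
  qed simp
  also have "\<dots> = K * L2_set (\<lambda>l. J l powr r * ?S l) L"
    using K by (simp add: L2_set_right_distrib)
  finally have 1: "wnorm (r - d) (bil b x y) L
     \<le> K * L2_set (\<lambda>l. J l powr r * ?S l) L" .
  \<comment> \<open>As \<open>L\<close> is finite, only finitely many inner sums are involved, and
    the finite estimate passes to the limit.\<close>
  have 2: "L2_set (\<lambda>l. J l powr r * ?S l) L \<le> KC r * A * B"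
  proof (rule tendsto_upperbound)
    show "((\<lambda>K. L2_set (\<lambda>l. J l powr r * (\<Sum>k\<in>K. cmod (x' k) * cmod (y' (l - k)))) L) \<longlongrightarrow>
      L2_set (\<lambda>l. J l powr r * ?S l) L) (finite_subsets_at_top UNIV)"
      unfolding L2_set_def by (intro tendsto_intros infsum_tendsto sm)
    show "\<forall>\<^sub>F K in finite_subsets_at_top UNIV.
       L2_set (\<lambda>l. J l powr r * (\<Sum>k\<in>K. cmod (x' k) * cmod (y' (l - k)))) L \<le> KC r * A * B"
      by (intro eventually_finite_subsets_at_top_weakI product_finite[where s = s] assms x' y' L)
  qed simp
  show "wnorm (r - d) (bil b x y) L \<le> C"
    using order_trans[OF 1 mult_left_mono[OF 2 K]] C by (simp add: mult_ac)
qed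

section \<open>Calculus in Sobolev spaces of sequences\<close>

lemma norm_one_minus_cis_le: "cmod (1 - cis x) \<le> \<bar>x\<bar>"
proof -
  have "(cmod (1 - cis x))\<^sup>2 = (1 - cos x)\<^sup>2 + (sin x)\<^sup>2"
    by (simp add: cmod_power2)
  also have "\<dots> = 2 - 2 * cos x"
    using sin_cos_squared_add[of x] by (simp add: power2_diff)
  also have "\<dots> = (2 * sin (x / 2))\<^sup>2"
    using cos_double_sin[of "x / 2"] by (simp add: power_mult_distrib)
  also have "\<dots> \<le> \<bar>x\<bar>\<^sup>2"
    using abs_sin_x_le_abs_x[of "x / 2"] by (intro abs_le_square_iff[THEN iffD1]) (simp add: abs_mult)
  finally show ?thesis by (rule power2_le_imp_le) simp
qed

lemma norm_one_minus_cis_le_2: "cmod (1 - cis x) \<le> 2"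
  using norm_triangle_ineq4[of 1 "cis x"] by simp

lemma infsum_diff_complex:
  fixes f g :: "'a \<Rightarrow> complex"
  assumes "f summable_on A" "g summable_on A"
  shows "(\<Sum>\<^sub>\<infinity>x\<in>A. f x - g x) = infsum f A - infsum g A"
  using has_sum_add[OF has_sum_infsum[OF assms(1)] has_sum_uminusI[OF has_sum_infsum[OF assms(2)]]]
  by (simp add: infsumI)

text \<open>Differentiability is asked of single coefficients only. This suffices because
  \<open>Hs_le\<close> looks at finitely many modes at a time, so no derivative in a function space
  has to exist.\<close>

lemma Hs_le_mvt:
  fixes y y' :: "real \<Rightarrow> int \<Rightarrow> complex"
  assumes "0 \<le> h"
    and cont: "\<And>l. continuous_on {0..h} (\<lambda>s. y s l)"
    and deriv: "\<And>s l. 0 < s \<Longrightarrow> s < h \<Longrightarrow> ((\<lambda>s. y s l) has_vector_derivative y' s l) (at s)"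
    and zero: "\<And>l. y 0 l = 0"
    and bound: "\<And>s. 0 < s \<Longrightarrow> s < h \<Longrightarrow> Hs_le r K (y' s)" and K: "0 \<le> K"
  shows "Hs_le r (K * h) (y h)"
proof (cases "h = 0")
  case True
  then show ?thesis using zero by (simp add: Hs_le_def L2_set_def)
next
  case False
  then have h: "0 < h" using assms(1) by simp
  show ?thesis
  proof (rule Hs_leI)
    fix L :: "int set" assume L: "finite L"
    let ?A = "wnorm r (y h) L"
    \<comment> \<open>pairing with the end point reduces the vector-valued mean value inequality to a scalar one\<close>
    define \<phi> where "\<phi> s = (\<Sum>l\<in>L. (J l powr r)\<^sup>2 * (y h l \<bullet> y s l))" for s
    define \<phi>' where "\<phi>' s = (\<Sum>l\<in>L. (J l powr r)\<^sup>2 * (y h l \<bullet> y' s l))" for s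
    have "continuous_on {0..h} \<phi>"
      unfolding \<phi>_def by (intro continuous_intros cont)
    moreover have "(\<phi> has_real_derivative \<phi>' s) (at s)" if "0 < s" "s < h" for s
      unfolding \<phi>_def \<phi>'_def has_real_derivative_iff_has_vector_derivative
      by (intro has_vector_derivative_sum has_vector_derivative_mult_right
            bounded_linear.has_vector_derivative[OF bounded_linear_inner_right] deriv that)
    ultimately obtain \<xi> where \<xi>: "0 < \<xi>" "\<xi> < h" "\<phi> h - \<phi> 0 = h * \<phi>' \<xi>"
      using MVT[of 0 h \<phi>] h by (metis DERIV_unique diff_zero real_differentiable_def)
    have "?A * ?A = \<phi> h"
      by (simp add: L2_set_def sum_nonneg \<phi>_def power_mult_distrib flip: power2_norm_eq_inner)
    also have "\<dots> = h * \<phi>' \<xi>"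
      using \<xi>(3) zero by (simp add: \<phi>_def)
    also have "\<phi>' \<xi> \<le> (\<Sum>l\<in>L. \<bar>J l powr r * cmod (y h l)\<bar> * \<bar>J l powr r * cmod (y' \<xi> l)\<bar>)"
      unfolding \<phi>'_def
    proof (rule sum_mono)
      fix l
      have "(J l powr r)\<^sup>2 * (y h l \<bullet> y' \<xi> l) \<le> (J l powr r)\<^sup>2 * (cmod (y h l) * cmod (y' \<xi> l))"
        by (intro mult_left_mono norm_cauchy_schwarz) simp
      then show "(J l powr r)\<^sup>2 * (y h l \<bullet> y' \<xi> l)
          \<le> \<bar>J l powr r * cmod (y h l)\<bar> * \<bar>J l powr r * cmod (y' \<xi> l)\<bar>"
        by (simp add: abs_mult power2_eq_square mult_ac)
    qed
    also have "\<dots> \<le> ?A * wnorm r (y' \<xi>) L"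
      by (rule L2_set_mult_ineq)
    also have "\<dots> \<le> ?A * K"
      by (intro mult_left_mono Hs_leD bound \<xi>) simp
    finally have "?A * ?A \<le> ?A * (K * h)" using h by (simp add: mult_ac)
    then show "?A \<le> K * h"
      using K h L2_set_nonneg[of "\<lambda>l. J l powr r * cmod (y h l)" L]
      by (cases "?A = 0") (auto simp: mult_le_cancel_left)
  qed
qed

text \<open>A finite set of terms has a derivative for elementary reasons. On the rest the mean
  value inequality bounds the remainder of term \<open>k\<close> by
  \<open>2 * |y - s| * b k\<close>, which has a small sum independently of \<open>y\<close>.\<close>

lemma has_vector_derivative_infsum:
  fixes f :: "'a \<Rightarrow> real \<Rightarrow> complex"
  assumes S: "convex S" "s \<in> S"
    and deriv: "\<And>k s. s \<in> S \<Longrightarrow> (f k has_vector_derivative f' k s) (at s within S)"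
    and bound: "\<And>k s. s \<in> S \<Longrightarrow> cmod (f' k s) \<le> b k" and b: "b summable_on UNIV"
    and summable: "\<And>s. s \<in> S \<Longrightarrow> (\<lambda>k. f k s) summable_on UNIV"
  shows "((\<lambda>s. \<Sum>\<^sub>\<infinity>k. f k s) has_vector_derivative (\<Sum>\<^sub>\<infinity>k. f' k s)) (at s within S)"
  unfolding has_vector_derivative_def has_derivative_within_alt
proof (intro conjI allI impI)
  let ?R = "\<lambda>y. (\<Sum>\<^sub>\<infinity>k. f k y) - (\<Sum>\<^sub>\<infinity>k. f k s) - (y - s) *\<^sub>R (\<Sum>\<^sub>\<infinity>k. f' k s)"
  fix e :: real assume e: "0 < e"
  have b0: "0 \<le> b k" for k using bound[OF S(2), of k] norm_ge_zero order_trans by blast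
  \<comment> \<open>The bound \<open>b\<close> enters the tail twice, through the increment and
    through the derivative; hence a quarter of \<open>e\<close> here and a half for the finite
    part.\<close>
  obtain K where K: "finite K" "dist (sum b K) (infsum b UNIV) \<le> e / 4"
    using infsum_finite_approximation[OF b, of "e / 4"] e by auto
  let ?RK = "\<lambda>y. (\<Sum>k\<in>K. f k y) - (\<Sum>k\<in>K. f k s) - (y - s) *\<^sub>R (\<Sum>k\<in>K. f' k s)"
  have split: "infsum g UNIV = sum g K + infsum g (- K)" if "g summable_on UNIV" for g :: "'a \<Rightarrow> complex"
    using infsum_Un_disjoint[of g K "- K"] K(1) summable_on_subset_banach[OF that] by (simp add: Compl_partition)
  have bK: "b summable_on (- K)" by (rule summable_on_subset_banach[OF b]) auto
  have tail: "infsum b (- K) \<le> e / 4"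
    using infsum_Un_disjoint[of b K "- K"] K bK by (simp add: Compl_partition dist_real_def)
  have "((\<lambda>s. \<Sum>k\<in>K. f k s) has_vector_derivative (\<Sum>k\<in>K. f' k s)) (at s within S)"
    by (intro has_vector_derivative_sum deriv S)
  then have "\<exists>d>0. \<forall>y\<in>S. norm (y - s) < d \<longrightarrow>
      cmod (?RK y) \<le> e / 2 * norm (y - s)"
    using e half_gt_zero[OF e] unfolding has_vector_derivative_def has_derivative_within_alt by blast
  then obtain d where d: "0 < d" and head: "\<And>y. y \<in> S \<Longrightarrow> norm (y - s) < d \<Longrightarrow>
      cmod (?RK y) \<le> e / 2 * norm (y - s)"
    by blast
  have f's: "(\<lambda>k. f' k s) summable_on UNIV"
    by (rule dominated_summable(2)[OF b]) (rule bound[OF S(2)])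
  have "cmod (?R y) \<le> e * norm (y - s)"
    if y: "y \<in> S" "norm (y - s) < d" for y
  proof -
    define r where "r k = f k y - f k s - (y - s) *\<^sub>R f' k s" for k
    have r: "cmod (r k) \<le> 2 * norm (y - s) * b k" for k
    proof -
      have "norm (f k y - f k s) \<le> b k * norm (y - s)"
      proof (rule differentiable_bound[OF S(1) _ _ y(1) S(2)])
        show "(f k has_derivative (\<lambda>h. h *\<^sub>R f' k x)) (at x within S)" if "x \<in> S" for x
          using deriv[OF that] unfolding has_vector_derivative_def .
        show "onorm (\<lambda>h. h *\<^sub>R f' k x) \<le> b k" if "x \<in> S" for x
          using bound[OF that, of k] by (intro onorm_le) (auto simp: mult.commute[of "b k"] intro: mult_left_mono)
      qed
      moreover have "norm ((y - s) *\<^sub>R f' k s) \<le> norm (y - s) * b k"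
        using bound[OF S(2), of k] by (simp add: mult_left_mono)
      ultimately show ?thesis
        unfolding r_def using norm_triangle_ineq4[of "f k y - f k s" "(y - s) *\<^sub>R f' k s"]
        by (simp add: mult_ac)
    qed
    have rsum: "(\<lambda>k. 2 * norm (y - s) * b k) summable_on A" for A
      by (rule summable_on_subset_banach[OF summable_on_cmult_right[OF b]]) auto
    have "?R y = infsum r UNIV"
    proof -
      have "((\<lambda>k. f k y - f k s - (y - s) *\<^sub>R f' k s) has_sum
          (?R y)) UNIV"
        using has_sum_add[OF has_sum_add[OF has_sum_infsum[OF summable[OF y(1)]]
              has_sum_uminusI[OF has_sum_infsum[OF summable[OF S(2)]]]]
              has_sum_uminusI[OF has_sum_scaleR[OF has_sum_infsum[OF f's], of "y - s"]]]
        by simp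
      then show ?thesis unfolding r_def by (simp add: infsumI)
    qed
    also have "\<dots> = sum r K + infsum r (- K)"
      by (rule split, rule dominated_summable(2)[OF rsum r])
    also have "cmod \<dots> \<le> cmod (sum r K) + cmod (infsum r (- K))"
      by (rule norm_triangle_ineq)
    also have "cmod (infsum r (- K)) \<le> (\<Sum>\<^sub>\<infinity>k\<in>-K. 2 * norm (y - s) * b k)"
      by (rule dominated_summable(3)[OF rsum r])
    also have "\<dots> = 2 * norm (y - s) * infsum b (- K)"
      by (rule infsum_cmult_right'; simp)
    also have "\<dots> \<le> 2 * norm (y - s) * (e / 4)"
      by (intro mult_left_mono tail) simp
    also have "sum r K = ?RK y"
      by (simp add: r_def sum_subtractf scaleR_sum_right)
    finally show ?thesis using head[OF y] by simp
  qed
  then show "\<exists>d>0. \<forall>y\<in>S. norm (y - s) < d \<longrightarrow>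
      cmod (?R y) \<le> e * norm (y - s)"
    using d by blast
qed (rule bounded_linear_scaleR_left)

section \<open>The bilinear symbols of the scheme\<close>

text \<open>
  \<open>nsym s\<close> is the symbol of the nonlinearity at time \<open>s\<close>.  The others are its integrals over
  \<open>s \<in> [0, t]\<close>: \<open>bsym t\<close> with weight 1, and \<open>dsym t\<close> with weight \<open>2 s\<close> and the factor
  \<open>i (l - k) / 2\<close> that turns \<open>conv a a\<close> into \<open>G\<close>.  Division by zero gives 0 in \<open>bsym\<close> for \<open>k = 0\<close> and
  \<open>k = l\<close>, and in \<open>dsym\<close> for \<open>k = 0\<close>: these are the zero modes that \<open>antideriv\<close> leaves out.
\<close>

definition phase :: "real \<Rightarrow> int \<Rightarrow> int \<Rightarrow> complex" where
  "phase t l k = cis (- (3 * t * of_int (l * k * (l - k))))"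

definition bsym :: "real \<Rightarrow> int \<Rightarrow> int \<Rightarrow> complex" where
  "bsym t l k = (1 - phase t l k) / (6 * of_int (k * (l - k)))"

definition nsym :: "real \<Rightarrow> int \<Rightarrow> int \<Rightarrow> complex" where
  "nsym t l k = \<i> * of_int l / 2 * phase t l k"

text \<open>The guards are not cases of division by zero only: at \<open>l = 0\<close> and
  \<open>l = k\<close> the first summand would survive. The guard \<open>l = 0\<close> reflects the
  removal of the zero mode from the step, the guard \<open>l = k\<close> the subtraction of the mean
  of the square in \<open>J2\<close>.\<close>

definition dsym :: "real \<Rightarrow> int \<Rightarrow> int \<Rightarrow> complex" where
  "dsym t l k = (if l = 0 \<or> l = k then 0
     else of_real t / 6 * inverse (\<i> * of_int k) * phase t l k
        - 1 / 18 * (phase t l k - 1) / of_int (l * k\<^sup>2 * (l - k)))"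

lemma phase_0 [simp]: "phase 0 l k = 1"
  by (simp add: phase_def)

lemma norm_phase [simp]: "cmod (phase t l k) = 1"
  by (simp add: phase_def)

lemma phase_swap [simp]: "phase t l (l - k) = phase t l k"
  by (simp add: phase_def mult_ac)

lemma norm_one_minus_phase_le: "0 \<le> t \<Longrightarrow> cmod (1 - phase t l k) \<le> 3 * t * \<bar>of_int (l * k * (l - k))\<bar>"
  using norm_one_minus_cis_le[of "- (3 * t * of_int (l * k * (l - k)))"]
  by (simp add: phase_def abs_mult)

lemma bsym_swap [simp]: "bsym t l (l - k) = bsym t l k"
  by (simp add: bsym_def mult_ac)

lemma nsym_swap [simp]: "nsym t l (l - k) = nsym t l k"
  by (simp add: nsym_def)

lemma abs_le_two_mult_ints:
  fixes k l :: int
  assumes "k \<noteq> 0" "l - k \<noteq> 0"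
  shows "\<bar>l\<bar> \<le> 2 * \<bar>k * (l - k)\<bar>"
proof -
  have "1 \<le> \<bar>k\<bar>" "1 \<le> \<bar>l - k\<bar>" using assms by auto
  then have "\<bar>k\<bar> \<le> \<bar>k\<bar> * \<bar>l - k\<bar>" "\<bar>l - k\<bar> \<le> \<bar>k\<bar> * \<bar>l - k\<bar>"
    by (simp_all add: mult_le_cancel_left1 mult_le_cancel_right1)
  then show ?thesis unfolding abs_mult by linarith
qed

text \<open>The bound is the geometric mean of \<open>|bsym t l k| \<le> 1 / |3 k (l - k)|\<close> and \<open>|bsym t l k| \<le> t |l| / 2\<close>.\<close>

lemma bsym_bound:
  assumes "0 \<le> t"
  shows "cmod (bsym t l k) \<le> sqrt t"
proof (cases "k = 0 \<or> l - k = 0")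
  case False
  define q where "q = \<bar>real_of_int (k * (l - k))\<bar>"
  have q: "0 < q" using False by (auto simp: q_def)
  have ql: "\<bar>real_of_int l\<bar> \<le> 2 * q"
  proof -
    have "real_of_int \<bar>l\<bar> \<le> real_of_int (2 * \<bar>k * (l - k)\<bar>)"
      using abs_le_two_mult_ints[of k l] False by (intro of_int_le_iff[THEN iffD2]) auto
    then show ?thesis by (simp add: q_def abs_mult)
  qed
  have eq: "cmod (bsym t l k) = cmod (1 - phase t l k) / (6 * q)"
    unfolding bsym_def q_def by (simp add: norm_divide norm_mult del: of_int_diff of_int_mult)
  have "(cmod (bsym t l k))\<^sup>2 = (cmod (1 - phase t l k) * cmod (1 - phase t l k)) / (36 * q\<^sup>2)"
    by (simp add: eq power2_eq_square)
  also have "\<dots> \<le> (2 * (3 * t * \<bar>of_int (l * k * (l - k))\<bar>)) / (36 * q\<^sup>2)"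
    using norm_one_minus_phase_le[OF assms, of l k] norm_one_minus_cis_le_2
    by (intro divide_right_mono mult_mono) (auto simp: phase_def)
  also have "\<bar>real_of_int (l * k * (l - k))\<bar> = \<bar>of_int l\<bar> * q"
    by (simp add: q_def abs_mult)
  also have "2 * (3 * t * (\<bar>real_of_int l\<bar> * q)) / (36 * q\<^sup>2) = t * (\<bar>of_int l\<bar> / (6 * q))"
    using q by (simp add: power2_eq_square)
  also have "\<dots> \<le> t * 1"
    using ql q assms by (intro mult_left_mono) (auto simp: divide_simps)
  finally show ?thesis by (simp add: real_le_rsqrt)
qed (use assms in \<open>auto simp: bsym_def\<close>)

text \<open>Each of the two summands is at most \<open>t / (6 |k|)\<close>. In the second, the bound
  of \<open>phase - 1\<close> supplies the factor \<open>l k (l - k)\<close>, which cancels the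
  denominator up to one power of \<open>k\<close>.\<close>

lemma dsym_bound:
  assumes "0 \<le> t"
  shows "cmod (dsym t l k) \<le> t"
proof (cases "l = 0 \<or> l = k \<or> k = 0")
  case False
  define q where "q = \<bar>real_of_int k\<bar>"
  have "1 \<le> \<bar>k\<bar>" using False by auto
  then have q: "1 \<le> q" unfolding q_def by (metis of_int_1_le_iff of_int_abs)
  have lm: "real_of_int l \<noteq> 0" "real_of_int (l - k) \<noteq> 0" using False by auto
  have "cmod (dsym t l k) \<le> cmod (of_real t / 6 * inverse (\<i> * of_int k) * phase t l k)
      + cmod (1 / 18 * (phase t l k - 1) / of_int (l * k\<^sup>2 * (l - k)))"
    using False by (simp only: dsym_def de_Morgan_disj if_False simp_thms norm_triangle_ineq4)
  also have "cmod (of_real t / 6 * inverse (\<i> * of_int k) * phase t l k) = t / 6 * (1 / q)"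
    using assms by (simp add: norm_mult norm_divide norm_inverse q_def divide_simps)
  also have "cmod (1 / 18 * (phase t l k - 1) / of_int (l * k\<^sup>2 * (l - k)))
      = 1 / 18 * cmod (1 - phase t l k) / \<bar>of_int (l * k\<^sup>2 * (l - k))\<bar>"
    by (simp only: norm_mult norm_divide norm_of_int norm_minus_commute) simp
  also have "\<dots> \<le> 1 / 18 * (3 * t * \<bar>of_int (l * k * (l - k))\<bar>) / \<bar>of_int (l * k\<^sup>2 * (l - k))\<bar>"
    by (intro divide_right_mono mult_left_mono norm_one_minus_phase_le assms) auto
  also have "\<dots> = t / 6 * (1 / q)"
    using lm q by (simp add: abs_mult q_def power2_eq_square divide_simps)
  also have "t / 6 * (1 / q) \<le> t / 6 * 1"
    using q assms by (intro mult_left_mono) (auto simp: divide_simps)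
  finally show ?thesis using assms by linarith
qed (use assms in \<open>auto simp: dsym_def\<close>)

lemma nsym_bound: "cmod (nsym t l k) \<le> 1 / 2 * J l powr 1 * J k powr 0 * J (l - k) powr 0"
  using abs_le_J[of l] by (simp add: nsym_def norm_mult norm_divide)

text \<open>A power of \<open>t\<close> is bought with derivatives: the phase contributes
  \<open>l k (l - k)\<close>, on top of the factor \<open>l\<close> that \<open>nsym\<close> has
  anyway.\<close>

lemma nsym_diff_bound:
  assumes "0 \<le> t"
  shows "cmod (nsym t l k - nsym 0 l k) \<le> (3 / 2 * t) * J l powr 2 * J k powr 1 * J (l - k) powr 1"
proof -
  have "nsym t l k - nsym 0 l k = - (\<i> * of_int l / 2) * (1 - phase t l k)"
    by (simp add: nsym_def algebra_simps diff_divide_distrib)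
  then have "cmod (nsym t l k - nsym 0 l k) = \<bar>of_int l\<bar> / 2 * cmod (1 - phase t l k)"
    by (simp add: norm_mult norm_divide)
  also have "\<dots> \<le> \<bar>of_int l\<bar> / 2 * (3 * t * \<bar>of_int (l * k * (l - k))\<bar>)"
    by (intro mult_left_mono norm_one_minus_phase_le assms) auto
  also have "\<dots> = (3 / 2 * t) * (\<bar>of_int l\<bar> * \<bar>of_int l\<bar> * \<bar>of_int k\<bar> * \<bar>of_int (l - k)\<bar>)"
    by (simp add: abs_mult)
  also have "\<dots> \<le> (3 / 2 * t) * (J l * J l * J k * J (l - k))"
    using assms by (intro mult_left_mono mult_mono abs_le_J mult_nonneg_nonneg) auto
  finally show ?thesis by (simp add: powr_numeral power2_eq_square mult_ac)
qed

text \<open>The bound may depend on \<open>l\<close>, since \<open>nsym\<close> grows like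
  \<open>|l|\<close>. Convergence of the sum over \<open>k\<close> concerns one \<open>l\<close> at
  a time.\<close>

definition sym_bounded :: "(int \<Rightarrow> int \<Rightarrow> complex) \<Rightarrow> bool" where
  "sym_bounded b \<longleftrightarrow> (\<forall>l. \<exists>K. \<forall>k. cmod (b l k) \<le> K)"

lemma sym_boundedI: "(\<And>l k. cmod (b l k) \<le> K l) \<Longrightarrow> sym_bounded b"
  by (auto simp: sym_bounded_def)

lemma sym_bounded_bsym: "0 \<le> t \<Longrightarrow> sym_bounded (bsym t)"
  by (rule sym_boundedI[OF bsym_bound])

lemma sym_bounded_dsym: "0 \<le> t \<Longrightarrow> sym_bounded (dsym t)"
  by (rule sym_boundedI[OF dsym_bound])

lemma sym_bounded_nsym: "sym_bounded (nsym t)"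
  by (rule sym_boundedI[where K = "\<lambda>l. J l"]) (rule order_trans[OF nsym_bound], simp)

lemma sym_bounded_one: "sym_bounded (\<lambda>_ _. 1)"
  by (rule sym_boundedI[where K = "\<lambda>_. 1"]) simp

lemma sym_bounded_swap: "sym_bounded b \<Longrightarrow> sym_bounded (\<lambda>l k. b l (l - k))"
  unfolding sym_bounded_def by blast

text \<open>In \<open>H^1\<close> all the sums in \<open>bil\<close> converge absolutely for such
  symbols. The existential hides a bound whose size is irrelevant for algebraic identities.\<close>

definition reg :: "seq \<Rightarrow> bool" where
  "reg x \<longleftrightarrow> (\<exists>A. Hs_le 1 A x)"

lemma regI: "Hs_le s A x \<Longrightarrow> 1 \<le> s \<Longrightarrow> reg x"
  unfolding reg_def using Hs_le_weaken by blast

lemma reg_diff: "reg x \<Longrightarrow> reg y \<Longrightarrow> reg (\<lambda>l. x l - y l)"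
  unfolding reg_def using Hs_le_diff by blast

lemma reg_bil_summable:
  assumes "reg x" "reg y" "sym_bounded b"
  shows "(\<lambda>k. cmod (b l k * x k * y (l - k))) summable_on UNIV"
    and "(\<lambda>k. b l k * x k * y (l - k)) summable_on UNIV"
proof -
  obtain A B K where "Hs_le 1 A x" "Hs_le 1 B y" "\<And>k. cmod (b l k) \<le> K"
    using assms unfolding reg_def sym_bounded_def by metis
  then show *: "(\<lambda>k. cmod (b l k * x k * y (l - k))) summable_on UNIV"
    by (intro bil_summable[OF Hs_le_weaken[of 1 A x 0 A]]) auto
  show "(\<lambda>k. b l k * x k * y (l - k)) summable_on UNIV"
    by (rule dominated_summable(2)[OF *]) simp
qed

lemma bil_swap: "bil b x y l = bil (\<lambda>l k. b l (l - k)) y x l"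
proof -
  have "bij (\<lambda>k. l - k)" by (rule bij_betwI[where g = "\<lambda>k. l - k"]) auto
  from infsum_reindex_bij_betw[OF this, of "\<lambda>k. b l k * x k * y (l - k)"]
  show ?thesis by (simp add: bil_def mult_ac)
qed

text \<open>The substitution of \<open>l - k\<close> for \<open>k\<close> exchanges the factors, so
  that the second one may be the less regular.\<close>

lemma Hs_le_bil':
  assumes "0 \<le> r" "r \<le> s" "1 \<le> s"
    and x: "Hs_le (s + p) A x" and y: "Hs_le (r + q) B y"
    and b: "\<And>l k. cmod (b l k) \<le> K * J l powr d * J k powr p * J (l - k) powr q" and K: "0 \<le> K"
    and C: "KC r * K * A * B \<le> C"
  shows "Hs_le (r - d) C (bil b x y)"
proof -
  have "bil b x y = bil (\<lambda>l k. b l (l - k)) y x" by (rule ext) (rule bil_swap)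
  moreover have "Hs_le (r - d) C (bil (\<lambda>l k. b l (l - k)) y x)"
  proof (rule Hs_le_bil[OF assms(1-3) y x _ K])
    show "cmod (b l (l - k)) \<le> K * J l powr d * J k powr q * J (l - k) powr p" for l k
      using b[of l "l - k"] by (simp add: mult_ac)
  qed (use C in \<open>simp add: mult_ac\<close>)
  ultimately show ?thesis by simp
qed

lemma bil_diff_left:
  assumes "reg x" "reg x'" "reg y" "sym_bounded b"
  shows "bil b (\<lambda>l. x l - x' l) y l = bil b x y l - bil b x' y l"
proof -
  have "bil b (\<lambda>l. x l - x' l) y l = (\<Sum>\<^sub>\<infinity>k. b l k * x k * y (l - k) - b l k * x' k * y (l - k))"
    unfolding bil_def by (simp add: algebra_simps)
  also have "\<dots> = bil b x y l - bil b x' y l"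
    unfolding bil_def using assms
    by (intro infsum_diff_complex reg_bil_summable)
  finally show ?thesis .
qed

lemma bil_diff_right:
  assumes "reg x" "reg y" "reg y'" "sym_bounded b"
  shows "bil b x (\<lambda>l. y l - y' l) l = bil b x y l - bil b x y' l"
  using bil_diff_left[OF assms(2,3,1) sym_bounded_swap[OF assms(4)]]
  by (simp add: bil_swap[of b x])

lemma bil_diff_sym:
  assumes "reg x" "reg y" "sym_bounded b" "sym_bounded b'"
  shows "bil (\<lambda>l k. b l k - b' l k) x y l = bil b x y l - bil b' x y l"
proof -
  have "bil (\<lambda>l k. b l k - b' l k) x y l = (\<Sum>\<^sub>\<infinity>k. b l k * x k * y (l - k) - b' l k * x k * y (l - k))"
    unfolding bil_def by (simp add: algebra_simps)
  also have "\<dots> = bil b x y l - bil b' x y l"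
    unfolding bil_def using assms
    by (intro infsum_diff_complex reg_bil_summable)
  finally show ?thesis .
qed

lemma bil_scale_right: "bil b x (\<lambda>l. c * y l) l = c * bil b x y l"
  unfolding bil_def by (subst infsum_cmult_right'[symmetric]) (simp_all add: mult_ac)

lemma bil_commute: "(\<And>l k. b l (l - k) = b l k) \<Longrightarrow> bil b x y l = bil b y x l"
  by (subst bil_swap) simp

section \<open>Stability\<close>

text \<open>Duality: Cauchy-Schwarz in \<open>l\<close> against the product estimate with one factor
  in \<open>l2\<close> and the other in \<open>H^1\<close>.\<close>

lemma trilinear_bound:
  assumes e: "Hs_le 0 E e" and g: "Hs_le 1 G g"
  defines "P \<equiv> \<lambda>(l, m). cmod (e l) * cmod (e m) * cmod (g (l - m))"
  shows "P summable_on UNIV" "infsum P UNIV \<le> KC 0 * E * E * G"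
proof -
  have P0: "0 \<le> P z" for z by (auto simp: P_def split: prod.split)
  have fin: "sum P F \<le> KC 0 * E * E * G" if F: "finite F" for F
  proof -
    define L K where "L = fst ` F" and "K = snd ` F"
    have LK: "finite L" "finite K" "F \<subseteq> L \<times> K" using F by (force simp: L_def K_def)+
    have "sum P F \<le> sum P (L \<times> K)"
      using LK P0 by (intro sum_mono2) auto
    also have "\<dots> = (\<Sum>l\<in>L. \<Sum>m\<in>K. P (l, m))"
      by (simp add: sum.cartesian_product)
    also have "\<dots> = (\<Sum>l\<in>L. \<bar>cmod (e l)\<bar> * \<bar>\<Sum>m\<in>K. cmod (e m) * cmod (g (l - m))\<bar>)"
      by (simp add: P_def sum_distrib_left mult.assoc abs_of_nonneg sum_nonneg)
    also have "\<dots> \<le> L2_set (\<lambda>l. cmod (e l)) L * L2_set (\<lambda>l. \<Sum>m\<in>K. cmod (e m) * cmod (g (l - m))) L"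
      by (rule L2_set_mult_ineq)
    also have "\<dots> \<le> E * (KC 0 * E * G)"
    proof (rule mult_mono)
      show "L2_set (\<lambda>l. cmod (e l)) L \<le> E"
        using Hs_leD[OF e, of L] by simp
      show "L2_set (\<lambda>l. \<Sum>m\<in>K. cmod (e m) * cmod (g (l - m))) L \<le> KC 0 * E * G"
        using product_finite[OF _ _ _ e g LK(1,2)] by simp
    qed (use Hs_le_nonneg[OF e] in auto)
    finally show ?thesis by (simp add: mult_ac)
  qed
  show *: "P summable_on UNIV"
    by (rule nonneg_bounded_partial_sums_imp_summable_on[where C = "KC 0 * E * E * G"])
       (auto simp: P0 fin intro: eventually_finite_subsets_at_top_weakI)
  show "infsum P UNIV \<le> KC 0 * E * E * G"
    by (rule infsum_le_finite_sums[OF *]) (rule fin)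
qed

text \<open>The mean value inequality for \<open>x * (1 + x^2) powr r\<close>, whose derivative is
  at most \<open>1 + 2 r\<close> times \<open>(1 + x^2) powr r\<close>. The gain over the two terms
  taken separately is the factor \<open>J (l - m)\<close> in place of \<open>J l\<close>.\<close>

lemma x_times_bracket_powr_lipschitz:
  assumes "0 \<le> r"
  shows "\<bar>of_int l * (J l powr r)\<^sup>2 - of_int m * (J m powr r)\<^sup>2\<bar>
      \<le> (1 + 2 * r) * 2 powr r * (J l powr r * J m powr r * (J (l - m) powr r * J (l - m)))"
proof -
  define h where "h x = x * (1 + x\<^sup>2) powr r" for x :: real
  have h: "of_int l * (J l powr r)\<^sup>2 = h (of_int l)" for l
  proof -
    have "(J l powr r)\<^sup>2 = (J l * J l) powr r"
      by (simp add: power2_eq_square powr_mult)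
    also have "J l * J l = 1 + (of_int l)\<^sup>2"
      by (simp add: japanese_bracket_def add_nonneg_nonneg)
    finally show ?thesis by (simp add: h_def)
  qed
  have P: "0 < 1 + x\<^sup>2" for x :: real by (simp add: add_pos_nonneg)
  have deriv: "(h has_real_derivative (1 + x\<^sup>2) powr r + 2 * r * x\<^sup>2 * (1 + x\<^sup>2) powr (r - 1)) (at x)" for x
    unfolding h_def using P[of x] by (auto intro!: derivative_eq_intros simp: power2_eq_square)
  define R where "R = max (J l) (J m)"
  have R: "0 < R" "J l \<le> R" "J m \<le> R" by (auto simp: R_def less_max_iff_disj)
  have bd: "\<bar>(1 + x\<^sup>2) powr r + 2 * r * x\<^sup>2 * (1 + x\<^sup>2) powr (r - 1)\<bar> \<le> (1 + 2 * r) * (R powr r)\<^sup>2"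
    if "1 + x\<^sup>2 \<le> R\<^sup>2" for x
  proof -
    have "x\<^sup>2 * (1 + x\<^sup>2) powr (r - 1) \<le> (1 + x\<^sup>2) powr 1 * (1 + x\<^sup>2) powr (r - 1)"
      using P[of x] by (intro mult_right_mono) auto
    also have "\<dots> = (1 + x\<^sup>2) powr r" by (simp only: powr_add[symmetric]) simp
    finally have 1: "2 * r * (x\<^sup>2 * (1 + x\<^sup>2) powr (r - 1)) \<le> 2 * r * (1 + x\<^sup>2) powr r"
      using assms by (intro mult_left_mono) auto
    have "(1 + x\<^sup>2) powr r \<le> (R\<^sup>2) powr r"
      using that P[of x] assms by (intro powr_mono2) auto
    also have "\<dots> = (R powr r)\<^sup>2" using R by (simp add: power2_eq_square powr_mult)
    finally have "(1 + 2 * r) * (1 + x\<^sup>2) powr r \<le> (1 + 2 * r) * (R powr r)\<^sup>2"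
      using assms by (intro mult_left_mono) auto
    moreover have "0 \<le> 2 * r * (x\<^sup>2 * (1 + x\<^sup>2) powr (r - 1))" using assms by simp
    ultimately show ?thesis using 1 by (simp add: algebra_simps)
  qed
  define S where "S = {x::real. 1 + x\<^sup>2 \<le> R\<^sup>2}"
  have R1: "1 \<le> R" using J_ge_1[of l] R(2) by linarith
  have S: "S = {- sqrt (R\<^sup>2 - 1)..sqrt (R\<^sup>2 - 1)}"
  proof -
    have *: "1 + x\<^sup>2 \<le> R\<^sup>2 \<longleftrightarrow> \<bar>x\<bar> \<le> sqrt (R\<^sup>2 - 1)" for x
    proof -
      have "\<bar>x\<bar> \<le> sqrt (R\<^sup>2 - 1) \<longleftrightarrow> sqrt (x\<^sup>2) \<le> sqrt (R\<^sup>2 - 1)" by simp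
      also have "\<dots> \<longleftrightarrow> x\<^sup>2 \<le> R\<^sup>2 - 1" by (rule real_sqrt_le_iff)
      finally show ?thesis by linarith
    qed
    show ?thesis unfolding S_def * by (simp add: set_eq_iff abs_le_iff) linarith
  qed
  have mem: "of_int k \<in> S" if "J k \<le> R" for k
    using power_mono[OF that J_nonneg, of 2] by (simp add: S_def japanese_bracket_def add_nonneg_nonneg)
  have "norm (h (of_int l) - h (of_int m)) \<le> (1 + 2 * r) * (R powr r)\<^sup>2 * norm (of_int l - of_int m :: real)"
  proof (rule field_differentiable_bound[of S])
    show "convex S" by (simp add: S)
    show "norm ((1 + x\<^sup>2) powr r + 2 * r * x\<^sup>2 * (1 + x\<^sup>2) powr (r - 1)) \<le> (1 + 2 * r) * (R powr r)\<^sup>2"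
      if "x \<in> S" for x
      using bd that by (simp add: S_def)
  qed (use mem R in \<open>auto intro: has_field_derivative_at_within deriv\<close>)
  also have "\<dots> \<le> (1 + 2 * r) * (R powr r)\<^sup>2 * J (l - m)"
    using abs_le_J[of "l - m"] assms by (intro mult_left_mono) auto
  also have "\<dots> \<le> (1 + 2 * r) * (2 powr r * (J l powr r * J m powr r * J (l - m) powr r)) * J (l - m)"
  proof (intro mult_right_mono mult_left_mono)
    \<comment> \<open>The larger of the two weights occurs squared; one copy is exchanged for the
      smaller weight times \<open>J (l - m)\<close>, so that the two copies of the error are
      weighted evenly.\<close>
    have "R * R \<le> 2 * (J l * J m * J (l - m))"
    proof (cases "J l \<le> J m")
      case True
      have "J m \<le> 2 * J l * J (l - m)" using J_le_mult[of m l] by (metis J_minus minus_diff_eq)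
      then have "J m * J m \<le> J m * (2 * J l * J (l - m))" by (intro mult_left_mono) auto
      then show ?thesis using True by (simp add: R_def mult_ac)
    next
      case False
      have "J l * J l \<le> J l * (2 * J m * J (l - m))" using J_le_mult[of l m] by (intro mult_left_mono) auto
      then show ?thesis using False by (simp add: R_def mult_ac)
    qed
    then have "(R * R) powr r \<le> (2 * (J l * J m * J (l - m))) powr r"
      using assms R by (intro powr_mono2) auto
    then show "(R powr r)\<^sup>2 \<le> 2 powr r * (J l powr r * J m powr r * J (l - m) powr r)"
      using R by (simp add: power2_eq_square powr_mult)
  qed (use assms in auto)
  finally show ?thesis by (simp add: h mult_ac)
qed

text \<open>
  The exchange of \<open>l\<close> and \<open>m\<close> conjugates \<open>bsym t l m / l\<close> and changes its sign, so that only the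
  commutator of the weight with the derivative survives.
\<close>

lemma bsym_antisymmetric:
  assumes "0 \<le> t" and c: "c (m - l) = cnj (c (l - m))"
  shows "cmod ((J l powr r)\<^sup>2 * cnj (e l) * (bsym t l m * e m * c (l - m))
      + cnj ((J m powr r)\<^sup>2 * cnj (e m) * (bsym t m l * e l * c (m - l))))
     \<le> t / 2 * \<bar>of_int l * (J l powr r)\<^sup>2 - of_int m * (J m powr r)\<^sup>2\<bar> * (cmod (e l) * cmod (e m) * cmod (c (l - m)))"
proof (cases "l = 0 \<or> m = 0 \<or> l = m")
  case True
  then have "bsym t l m = 0" "bsym t m l = 0" by (auto simp: bsym_def phase_def)
  then show ?thesis using assms by simp
next
  case False
  \<comment> \<open>\<open>q\<close> is \<open>bsym\<close> without its factor \<open>l\<close>.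
    Swapping \<open>l\<close> and \<open>m\<close> conjugates the phase and turns this factor into
    \<open>- m\<close>, so the weights combine to a difference, and \<open>q\<close> itself is of
    order \<open>t\<close>.\<close>
  define q where "q = (1 - phase t l m) / (6 * of_int (l * m * (l - m)))"
  have nz: "(of_int l :: complex) \<noteq> 0" "(of_int m :: complex) \<noteq> 0" "(of_int (l - m) :: complex) \<noteq> 0"
    "real_of_int (l * m * (l - m)) \<noteq> 0"
    using False by simp_all
  have 1: "bsym t l m = of_int l * q"
    using nz by (simp add: bsym_def q_def)
  have ph: "phase t m l = cnj (phase t l m)"
    by (simp add: phase_def cis_cnj) (simp add: algebra_simps)
  have 2: "cnj (bsym t m l) = - of_int m * q"
  proof -
    have "cnj (bsym t m l) = (1 - phase t l m) / (6 * of_int (l * (m - l)))"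
      by (simp add: bsym_def ph)
    also have "\<dots> = - of_int m * q"
      using nz by (simp add: q_def divide_simps) (simp add: algebra_simps)
    finally show ?thesis .
  qed
  have q: "cmod q \<le> t / 2"
  proof -
    have "cmod q = cmod (1 - phase t l m) / (6 * \<bar>of_int (l * m * (l - m))\<bar>)"
      unfolding q_def by (simp add: norm_divide norm_mult del: of_int_diff of_int_mult)
    also have "\<dots> \<le> (3 * t * \<bar>of_int (l * m * (l - m))\<bar>) / (6 * \<bar>of_int (l * m * (l - m))\<bar>)"
      by (intro divide_right_mono norm_one_minus_phase_le assms) auto
    also have "\<dots> = t / 2" using nz(4) by (simp del: of_int_diff of_int_mult)
    finally show ?thesis .
  qed
  have "(J l powr r)\<^sup>2 * cnj (e l) * (bsym t l m * e m * c (l - m))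
      + cnj ((J m powr r)\<^sup>2 * cnj (e m) * (bsym t m l * e l * c (m - l)))
     = of_real (of_int l * (J l powr r)\<^sup>2 - of_int m * (J m powr r)\<^sup>2) * q * (cnj (e l) * e m * c (l - m))"
    by (simp add: 1 2 c) (simp add: algebra_simps)
  also have "cmod \<dots> = \<bar>of_int l * (J l powr r)\<^sup>2 - of_int m * (J m powr r)\<^sup>2\<bar> * cmod q * (cmod (e l) * cmod (e m) * cmod (c (l - m)))"
    by (simp only: norm_mult norm_of_real complex_mod_cnj)
  also have "\<dots> \<le> \<bar>of_int l * (J l powr r)\<^sup>2 - of_int m * (J m powr r)\<^sup>2\<bar> * (t / 2) * (cmod (e l) * cmod (e m) * cmod (c (l - m)))"
    by (intro mult_right_mono mult_left_mono q) auto
  finally show ?thesis by (simp add: mult_ac)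
qed

text \<open>The form is an absolutely convergent double sum over \<open>(l, m)\<close>, so it may be
  symmetrised. Of the two derivatives asked of \<open>c\<close> beyond \<open>r\<close>, one is the
  derivative moved onto it by the commutator, the other makes its coefficients summable.\<close>

lemma energy_form_bound:
  assumes r: "0 \<le> r" and t: "0 \<le> t"
    and e: "Hs_le r E e" and c: "Hs_le (r + 2) M c" and herm: "\<And>l. c (- l) = cnj (c l)"
  shows "(\<lambda>l. (J l powr r)\<^sup>2 * Re (cnj (e l) * bil (bsym t) e c l)) summable_on UNIV"
    and "(\<Sum>\<^sub>\<infinity>l. (J l powr r)\<^sup>2 * Re (cnj (e l) * bil (bsym t) e c l))
      \<le> t / 4 * ((1 + 2 * r) * 2 powr r) * (KC 0 * E * E * M)"
proof -
  let ?f = "\<lambda>l. (J l powr r)\<^sup>2 * Re (cnj (e l) * bil (bsym t) e c l)"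
  let ?X = "\<lambda>l m. cmod (e l) * cmod (e m) * cmod (c (l - m))"
  define e' where "e' l = of_real (J l powr r) * e l" for l
  define g where "g l = of_real (J l powr (r + 1)) * c l" for l
  have e': "Hs_le 0 E e'" unfolding e'_def using Hs_le_shift[of 0 r E e] e by simp
  have g: "Hs_le 1 M g" unfolding g_def using Hs_le_shift[of 1 "r + 1" M c] c by (simp add: add.commute)
  define P where "P = (\<lambda>(l, m). cmod (e' l) * cmod (e' m) * cmod (g (l - m)))"
  have P: "P summable_on UNIV" "infsum P UNIV \<le> KC 0 * E * E * M"
    unfolding P_def by (rule trilinear_bound[OF e' g])+
  have Peq: "P (l, m) = J l powr r * J m powr r * (J (l - m) powr r * J (l - m)) * ?X l m" for l m
    by (simp add: P_def e'_def g_def norm_mult powr_add)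
  define Q where "Q = (\<lambda>(l, m). (J l powr r)\<^sup>2 * cnj (e l) * (bsym t l m * e m * c (l - m)))"
  \<comment> \<open>This bound is only of order \<open>sqrt t\<close>. It serves to justify the
    exchange of summations; the size of the form comes from the symmetrised sum.\<close>
  have Qb: "cmod (Q z) \<le> sqrt t * 2 powr r * P z" for z
  proof (cases z)
    case (Pair l m)
    have "J l powr r \<le> (2 * J m * J (l - m)) powr r"
      using J_le_mult[of l m] r by (intro powr_mono2) auto
    then have W: "J l powr r \<le> 2 powr r * (J m powr r * J (l - m) powr r)"
      by (simp add: powr_mult)
    have "cmod (Q z) = cmod (bsym t l m) * (J l powr r) * (J l powr r * ?X l m)"
      by (simp add: Pair Q_def norm_mult power2_eq_square)
    also have "\<dots> \<le> sqrt t * (2 powr r * (J m powr r * J (l - m) powr r)) * (J l powr r * ?X l m)"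
      using t by (intro mult_right_mono mult_mono W bsym_bound) auto
    also have "\<dots> = sqrt t * 2 powr r * (J l powr r * J m powr r * (J (l - m) powr r * 1) * ?X l m)"
      by simp
    also have "\<dots> \<le> sqrt t * 2 powr r * P z"
      unfolding Pair Peq using t by (intro mult_left_mono mult_right_mono J_ge_1) auto
    finally show ?thesis .
  qed
  have Qs: "Q summable_on UNIV"
    by (rule dominated_summable(2)[OF summable_on_cmult_right[OF P(1)] Qb])
  have inner: "(\<Sum>\<^sub>\<infinity>m. Q (l, m)) = (J l powr r)\<^sup>2 * cnj (e l) * bil (bsym t) e c l" for l
    unfolding Q_def bil_def by (simp add: infsum_cmult_right')
  have sg: "(\<Sum>\<^sub>\<infinity>l. \<Sum>\<^sub>\<infinity>m. Q (l, m)) = infsum Q UNIV"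
    using infsum_Sigma_banach[of Q UNIV "\<lambda>_. UNIV"] Qs by simp
  have outer: "(\<lambda>l. \<Sum>\<^sub>\<infinity>m. Q (l, m)) summable_on UNIV"
    using summable_on_Sigma_banach[of "\<lambda>l m. Q (l, m)" UNIV "\<lambda>_. UNIV"] Qs by simp
  have Re: "(\<lambda>l. Re (\<Sum>\<^sub>\<infinity>m. Q (l, m))) = ?f"
  proof
    fix l
    have "(\<Sum>\<^sub>\<infinity>m. Q (l, m)) = of_real ((J l powr r)\<^sup>2) * (cnj (e l) * bil (bsym t) e c l)"
      by (simp add: inner)
    then show "Re (\<Sum>\<^sub>\<infinity>m. Q (l, m)) = ?f l"
      by (simp only: Re_complex_of_real[symmetric] scaleR_conv_of_real[symmetric] scaleR_complex.sel)
  qed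
  show "?f summable_on UNIV"
    using summable_on_Re[OF outer] unfolding Re .
  \<comment> \<open>Transposition and conjugation do not change the real part of the double sum.
    Twice this real part is therefore that of the sum of \<open>Q + Q'\<close>, where the
    cancellation happens term by term.\<close>
  define Q' where "Q' = (\<lambda>(l, m). cnj (Q (m, l)))"
  have sw: "bij prod.swap" by (rule bij_swap)
  have Q's: "Q' summable_on UNIV" "infsum Q' UNIV = cnj (infsum Q UNIV)"
  proof -
    have "Q' = (\<lambda>z. cnj (Q (prod.swap z)))" by (auto simp: Q'_def)
    then show "Q' summable_on UNIV" "infsum Q' UNIV = cnj (infsum Q UNIV)"
      using summable_on_reindex_bij_betw[OF sw, of Q] infsum_reindex_bij_betw[OF sw, of Q] Qs by simp_all
  qed
  have bd: "cmod (Q z + Q' z) \<le> t / 2 * ((1 + 2 * r) * 2 powr r) * P z" for z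
  proof (cases z)
    case (Pair l m)
    have "cmod (Q z + Q' z) \<le> t / 2 * \<bar>of_int l * (J l powr r)\<^sup>2 - of_int m * (J m powr r)\<^sup>2\<bar> * ?X l m"
      unfolding Pair Q'_def Q_def using bsym_antisymmetric[OF t, of c m l r e] herm[of "l - m"] by simp
    also have "\<dots> \<le> t / 2 * ((1 + 2 * r) * 2 powr r * (J l powr r * J m powr r * (J (l - m) powr r * J (l - m)))) * ?X l m"
      using t by (intro mult_right_mono mult_left_mono x_times_bracket_powr_lipschitz r) auto
    also have "\<dots> = t / 2 * ((1 + 2 * r) * 2 powr r) * P z"
      by (simp add: Pair Peq)
    finally show ?thesis .
  qed
  have "2 * Re (infsum Q UNIV) = Re (infsum (\<lambda>z. Q z + Q' z) UNIV)"
    using infsum_add[OF Qs Q's(1)] Q's(2) by simp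
  also have "\<dots> \<le> cmod (infsum (\<lambda>z. Q z + Q' z) UNIV)" by (rule complex_Re_le_cmod)
  also have "\<dots> \<le> (\<Sum>\<^sub>\<infinity>z. t / 2 * ((1 + 2 * r) * 2 powr r) * P z)"
    by (rule dominated_summable(3)[OF summable_on_cmult_right[OF P(1)] bd])
  also have "\<dots> = t / 2 * ((1 + 2 * r) * 2 powr r) * infsum P UNIV"
    by (rule infsum_cmult_right'; simp)
  also have "\<dots> \<le> t / 2 * ((1 + 2 * r) * 2 powr r) * (KC 0 * E * E * M)"
    using t r by (intro mult_left_mono P) auto
  finally have "Re (infsum Q UNIV) \<le> t / 4 * ((1 + 2 * r) * 2 powr r) * (KC 0 * E * E * M)" by simp
  moreover have "Re (infsum Q UNIV) = (\<Sum>\<^sub>\<infinity>l. ?f l)"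
    using infsum_Re[OF outer] sg by (simp add: Re)
  ultimately show "(\<Sum>\<^sub>\<infinity>l. ?f l)
      \<le> t / 4 * ((1 + 2 * r) * 2 powr r) * (KC 0 * E * E * M)" by simp
qed

text \<open>The first summand is four times the constant of the energy form, with its
  \<open>t / 4\<close> removed; the second comes from \<open>4 |\<beta>|^2\<close>, where the bound
  of \<beta> contains \<open>sqrt t\<close>.\<close>

definition Clin :: "real \<Rightarrow> real \<Rightarrow> real" where
  "Clin r M = (1 + 2 * r) * 2 powr r * KC 0 * M + 4 * (KC r * M)\<^sup>2"

lemma linear_stability:
  assumes r: "0 \<le> r" and t: "0 \<le> t"
    and e: "Hs_le r E e" and c: "Hs_le (r + 2) M c" and herm: "\<And>l. c (- l) = cnj (c l)"
  shows "Hs_le r ((1 + Clin r M * t) * E) (\<lambda>l. e l + 2 * bil (bsym t) e c l)"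
proof -
  have M: "0 \<le> M" and E: "0 \<le> E" using c e Hs_le_nonneg by auto
  define \<beta> where "\<beta> = bil (bsym t) e c"
  have "Hs_le (r - 0) (KC r * sqrt t * E * M) (bil (bsym t) e c)"
    using e c r t bsym_bound[OF t]
    by (intro Hs_le_bil[where s = "r + 1" and p = 0 and q = 0 and K = "sqrt t" and A = E and B = M])
       (auto elim: Hs_le_weaken)
  then have \<beta>: "Hs_le r (KC r * sqrt t * E * M) \<beta>" by (simp add: \<beta>_def)
  have B0: "0 \<le> KC r * sqrt t * E * M" using t E M by simp
  note F = energy_form_bound[OF r t e c herm, folded \<beta>_def]
  note E1 = e[unfolded Hs_le_iff_infsum[OF E]]
  note B1 = \<beta>[unfolded Hs_le_iff_infsum[OF B0]]
  have C0: "0 \<le> Clin r M" using r M by (simp add: Clin_def)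
  have eq: "(J l powr r * cmod (e l + 2 * \<beta> l))\<^sup>2
     = (J l powr r * cmod (e l))\<^sup>2 + 4 * ((J l powr r)\<^sup>2 * Re (cnj (e l) * \<beta> l)) + 4 * (J l powr r * cmod (\<beta> l))\<^sup>2" for l
    unfolding power_mult_distrib cmod_power2 by (simp add: power2_eq_square algebra_simps)
  let ?S = "(\<Sum>\<^sub>\<infinity>l. (J l powr r * cmod (e l))\<^sup>2) + 4 * (\<Sum>\<^sub>\<infinity>l. (J l powr r)\<^sup>2 * Re (cnj (e l) * \<beta> l))
       + 4 * (\<Sum>\<^sub>\<infinity>l. (J l powr r * cmod (\<beta> l))\<^sup>2)"
  have hs: "((\<lambda>l. (J l powr r * cmod (e l + 2 * \<beta> l))\<^sup>2) has_sum
     ?S) UNIV"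
    unfolding eq using E1 B1 F(1) by (intro has_sum_add has_sum_cmult_right has_sum_infsum) auto
  have "?S
     \<le> E\<^sup>2 + 4 * (t / 4 * ((1 + 2 * r) * 2 powr r) * (KC 0 * E * E * M)) + 4 * (KC r * sqrt t * E * M)\<^sup>2"
    using E1 B1 F(2) by (intro add_mono mult_left_mono) auto
  also have "\<dots> = (1 + Clin r M * t) * E\<^sup>2"
    using t by (simp add: Clin_def power2_eq_square algebra_simps)
  \<comment> \<open>By \<open>1 + x \<le> (1 + x)^2\<close> for \<open>x \<ge> 0\<close>, which
    makes the root at the end free of square roots of constants.\<close>
  also have "\<dots> \<le> ((1 + Clin r M * t) * E)\<^sup>2"
    unfolding power_mult_distrib using t C0 by (intro mult_right_mono) (auto simp: self_le_power)
  finally have "(\<Sum>\<^sub>\<infinity>l. (J l powr r * cmod (e l + 2 * \<beta> l))\<^sup>2) \<le> ((1 + Clin r M * t) * E)\<^sup>2"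
    unfolding infsumI[OF hs] .
  moreover have "0 \<le> (1 + Clin r M * t) * E" using t C0 E by simp
  ultimately show ?thesis
    using has_sum_imp_summable[OF hs] unfolding \<beta>_def[symmetric] by (simp only: Hs_le_iff_infsum simp_thms)
qed

text \<open>One step of the scheme on Fourier coefficients. The outer factor is the symbol of the
  linear flow over time \<open>h\<close>; with it pulled out, the remaining multipliers are exactly
  the integrated symbols.\<close>

definition lri_seq :: "real \<Rightarrow> seq \<Rightarrow> int \<Rightarrow> complex" where
  "lri_seq h x l = cis (h * of_int l ^ 3)
     * (x l + bil (bsym h) x x l + bil (dsym h) x (conv x x) l)"

lemma Hs_le_bil_bounded:
  assumes "0 \<le> r" "r \<le> s" "1 \<le> s" "Hs_le r A x" "Hs_le s B y"
    and "\<And>l k. cmod (b l k) \<le> K" "0 \<le> K" "KC r * K * A * B \<le> C"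
  shows "Hs_le r C (bil b x y)"
  using Hs_le_bil[of r s 0 A x 0 B y b K 0 C] assms by simp

lemma Hs_le_bil_bounded':
  assumes "0 \<le> r" "r \<le> s" "1 \<le> s" "Hs_le s A x" "Hs_le r B y"
    and "\<And>l k. cmod (b l k) \<le> K" "0 \<le> K" "KC r * K * A * B \<le> C"
  shows "Hs_le r C (bil b x y)"
  using Hs_le_bil'[of r s 0 A x 0 B y b K 0 C] assms by simp

text \<open>In order: the part linear in \<open>e\<close>, the square of \<open>e\<close>, the
  factor \<open>e\<close> in front of \<open>conv c c\<close>, and the increment of the inner
  convolution.\<close>

definition Cstab :: "real \<Rightarrow> real \<Rightarrow> real \<Rightarrow> real" where
  "Cstab r s M = Clin r M + KC r + KC r * KC s * M\<^sup>2 + (KC r)\<^sup>2 * (M + 1) * (2 * M + 1)"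

text \<open>By bilinearity and symmetry the \<open>bsym\<close> terms differ by
  \<open>2 B e c - B e e\<close>. The first half belongs to the linear estimate; in the second the
  symbol and the \<open>H^s\<close> norm of \<open>e\<close> give \<open>sqrt h\<close> each. The
  \<open>dsym\<close> terms need no structure, as their symbol is bounded by
  \<open>h\<close>.\<close>

lemma step_stability:
  assumes r: "0 \<le> r" "r \<le> s" "1 \<le> s" and h: "0 \<le> h" "h \<le> 1"
    and c: "Hs_le (s + 2) M c" and herm: "\<And>l. c (- l) = cnj (c l)"
    and e: "Hs_le r E e" and es: "Hs_le s (sqrt h) e"
  shows "Hs_le r ((1 + Cstab r s M * h) * E) (\<lambda>l. lri_seq h c l - lri_seq h (\<lambda>l. c l - e l) l)"
proof -
  define x' where "x' l = c l - e l" for l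
  have M: "0 \<le> M" and E: "0 \<le> E" using c e Hs_le_nonneg by auto
  have cs: "Hs_le s M c" by (rule Hs_le_weaken[OF c]) auto
  have x's: "Hs_le s (M + 1) x'"
    using Hs_le_weaken[OF Hs_le_diff[OF cs es], of s "M + 1"] h by (simp add: x'_def[abs_def])
  have ccs: "Hs_le s (KC s * M * M) (conv c c)"
    unfolding conv_def using r by (intro Hs_le_bil_bounded[OF _ _ _ cs cs, where K = 1]) auto
  have xxs: "Hs_le s (KC s * (M + 1) * (M + 1)) (conv x' x')"
    unfolding conv_def using r by (intro Hs_le_bil_bounded[OF _ _ _ x's x's, where K = 1]) auto
  note regs = regI[OF cs r(3)] regI[OF es r(3)] regI[OF x's r(3)] regI[OF ccs r(3)] regI[OF xxs r(3)]
  note syms = sym_bounded_bsym[OF h(1)] sym_bounded_dsym[OF h(1)] sym_bounded_one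
  \<comment> \<open>The increment of the inner convolution is small only in \<open>H^r\<close>, so
    it has to be the less regular factor in the estimate of \<open>d2\<close>.\<close>
  define y where "y l = conv c c l - conv x' x' l" for l
  have B: "bil (bsym h) c c l - bil (bsym h) x' x' l = 2 * bil (bsym h) e c l - bil (bsym h) e e l" for l
  proof -
    have "bil (bsym h) x' x' l = bil (bsym h) c x' l - bil (bsym h) e x' l"
      unfolding x'_def[of "_ :: int", abs_def] by (rule bil_diff_left) (use regs syms in \<open>auto simp: x'_def[abs_def]\<close>)
    also have "bil (bsym h) c x' l = bil (bsym h) c c l - bil (bsym h) c e l"
      unfolding x'_def[abs_def] by (rule bil_diff_right) (use regs syms in auto)
    also have "bil (bsym h) e x' l = bil (bsym h) e c l - bil (bsym h) e e l"
      unfolding x'_def[abs_def] by (rule bil_diff_right) (use regs syms in auto)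
    finally show ?thesis by (simp add: bil_commute[of "bsym h" c e])
  qed
  have D: "bil (dsym h) c (conv c c) l - bil (dsym h) x' (conv x' x') l
      = bil (dsym h) e (conv c c) l + bil (dsym h) x' y l" for l
  proof -
    have "bil (dsym h) x' (conv c c) l = bil (dsym h) c (conv c c) l - bil (dsym h) e (conv c c) l"
      unfolding x'_def[abs_def] by (rule bil_diff_left) (use regs syms in auto)
    moreover have "bil (dsym h) x' y l = bil (dsym h) x' (conv c c) l - bil (dsym h) x' (conv x' x') l"
      unfolding y_def[abs_def] by (rule bil_diff_right) (use regs syms in auto)
    ultimately show ?thesis by simp
  qed
  have y: "y l = conv e c l + conv x' e l" for l
  proof -
    have "conv x' c l = conv c c l - conv e c l"
      unfolding conv_def x'_def[abs_def] by (rule bil_diff_left) (use regs syms in auto)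
    moreover have "conv x' x' l = conv x' c l - conv x' e l"
      using bil_diff_right[OF regs(3,1,2) sym_bounded_one, of l] by (simp add: conv_def x'_def[abs_def])
    ultimately show ?thesis by (simp add: y_def)
  qed
  have "Hs_le r (KC r * E * M + KC r * (M + 1) * E) (\<lambda>l. conv e c l + conv x' e l)"
    unfolding conv_def using r
    by (intro Hs_le_add Hs_le_bil_bounded[OF _ _ _ e cs, where K = 1]
          Hs_le_bil_bounded'[OF _ _ _ x's e, where K = 1]) auto
  then have yr: "Hs_le r (KC r * E * M + KC r * (M + 1) * E) y" by (simp add: y[abs_def])
  have lin: "Hs_le r ((1 + Clin r M * h) * E) (\<lambda>l. e l + 2 * bil (bsym h) e c l)"
    by (rule linear_stability[OF r(1) h(1) e Hs_le_weaken[OF c] herm]) (use r in auto)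
  have "KC r * sqrt h * E * sqrt h = KC r * (sqrt h * sqrt h) * E"
    by (simp only: mult_ac)
  also have "\<dots> = KC r * h * E" using h by simp
  finally have ee_const: "KC r * sqrt h * E * sqrt h \<le> KC r * h * E" by (rule eq_refl)
  have ee: "Hs_le r (KC r * h * E) (bil (bsym h) e e)"
    using r h by (intro Hs_le_bil_bounded[OF _ _ _ e es _ _ ee_const] bsym_bound) auto
  have d1: "Hs_le r (KC r * h * E * (KC s * M * M)) (bil (dsym h) e (conv c c))"
    using r h by (intro Hs_le_bil_bounded[OF _ _ _ e ccs, where K = "h"] dsym_bound) auto
  have d2: "Hs_le r (KC r * h * (M + 1) * (KC r * E * M + KC r * (M + 1) * E)) (bil (dsym h) x' y)"
    using r h by (intro Hs_le_bil_bounded'[OF _ _ _ x's yr, where K = "h"] dsym_bound) auto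
  have eq: "lri_seq h c l - lri_seq h (\<lambda>l. c l - e l) l = cis (h * of_int l ^ 3)
     * (((e l + 2 * bil (bsym h) e c l) - bil (bsym h) e e l) + (bil (dsym h) e (conv c c) l + bil (dsym h) x' y l))" for l
  proof -
    have "lri_seq h c l - lri_seq h x' l = cis (h * of_int l ^ 3)
     * ((c l - x' l) + (bil (bsym h) c c l - bil (bsym h) x' x' l)
      + (bil (dsym h) c (conv c c) l - bil (dsym h) x' (conv x' x') l))"
      by (simp add: lri_seq_def algebra_simps)
    then show ?thesis unfolding B D by (simp add: x'_def[abs_def] algebra_simps)
  qed
  show ?thesis
  proof (rule Hs_le_le[OF Hs_le_add[OF Hs_le_diff[OF lin ee] Hs_le_add[OF d1 d2]], where K = 1])
    show "1 * ((1 + Clin r M * h) * E + KC r * h * E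
        + (KC r * h * E * (KC s * M * M) + KC r * h * (M + 1) * (KC r * E * M + KC r * (M + 1) * E)))
      \<le> (1 + Cstab r s M * h) * E"
      using h by (simp add: Cstab_def power2_eq_square algebra_simps)
  qed (auto simp: eq norm_mult)
qed

section \<open>Local error\<close>

lemma KC_mono: "s \<le> t \<Longrightarrow> KC s \<le> KC t"
  using bracket_sum_ge_1 by (auto simp: KC_def intro!: mult_right_mono powr_mono)

section \<open>The scheme as a path in the step size\<close>

lemma phase_has_vector_derivative:
  "((\<lambda>s. phase s l k) has_vector_derivative - 3 * \<i> * of_int (l * k * (l - k)) * phase s l k) (at s)"
proof -
  have eq: "phase s l k = exp (- 3 * \<i> * of_int (l * k * (l - k)) * of_real s)" for s
    by (simp add: phase_def cis_conv_exp mult_ac)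
  show ?thesis unfolding eq
    by (rule has_vector_derivative_real_field) (auto intro!: derivative_eq_intros)
qed

text \<open>At the excluded modes \<open>bsym\<close> is constantly 0 while \<open>nsym\<close> need
  not vanish. The corresponding terms are removed later by \<open>a 0 = 0\<close>.\<close>

lemma bsym_has_vector_derivative:
  assumes "k \<noteq> 0" "l \<noteq> k"
  shows "((\<lambda>s. bsym s l k) has_vector_derivative nsym s l k) (at s)"
proof -
  have nz: "(of_int (k * (l - k)) :: complex) \<noteq> 0" using assms by simp
  have "((\<lambda>s. (1 - phase s l k) / (6 * of_int (k * (l - k)))) has_vector_derivative
      (0 - (- 3 * \<i> * of_int (l * k * (l - k)) * phase s l k)) / (6 * of_int (k * (l - k)))) (at s)"
    by (intro has_vector_derivative_divide has_vector_derivative_diff has_vector_derivative_const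
          phase_has_vector_derivative)
  also have "(0 - (- 3 * \<i> * of_int (l * k * (l - k)) * phase s l k)) / (6 * of_int (k * (l - k))) = nsym s l k"
    using nz by (simp add: nsym_def divide_simps)
  finally show ?thesis by (simp add: bsym_def)
qed

text \<open>The two summands of \<open>dsym\<close> are those of an integration by parts of the
  factor \<open>s\<close> against the phase: the boundary term, and the integral of the phase, which
  cancels the surplus produced by the product rule.\<close>

lemma dsym_has_vector_derivative:
  assumes "k \<noteq> 0" "l \<noteq> k"
  shows "((\<lambda>s. dsym s l k) has_vector_derivative nsym s l k * (2 * of_real s * (\<i> * of_int (l - k) / 2))) (at s)"
proof (cases "l = 0")
  case True
  then show ?thesis by (simp add: dsym_def nsym_def)
next
  case False
  define n where "n = (of_int (l * k * (l - k)) :: complex)"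
  have nz: "(of_int k :: complex) \<noteq> 0" "(of_int l :: complex) \<noteq> 0" "(of_int (l - k) :: complex) \<noteq> 0"
    using assms False by simp_all
  have "((\<lambda>s. of_real s * (inverse (\<i> * of_int k) / 6 * phase s l k) - (phase s l k - 1) / (18 * (n * of_int k)))
     has_vector_derivative
      (of_real s * (inverse (\<i> * of_int k) / 6 * (- 3 * \<i> * n * phase s l k))
         + 1 * (inverse (\<i> * of_int k) / 6 * phase s l k))
       - (- 3 * \<i> * n * phase s l k - 0) / (18 * (n * of_int k))) (at s)"
    unfolding n_def
    by (intro has_vector_derivative_diff has_vector_derivative_divide has_vector_derivative_mult
          has_vector_derivative_mult_right has_vector_derivative_const phase_has_vector_derivative)
       (auto intro!: derivative_eq_intros)
  also have "(of_real s * (inverse (\<i> * of_int k) / 6 * (- 3 * \<i> * n * phase s l k))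
         + 1 * (inverse (\<i> * of_int k) / 6 * phase s l k))
       - (- 3 * \<i> * n * phase s l k - 0) / (18 * (n * of_int k))
     = nsym s l k * (2 * of_real s * (\<i> * of_int (l - k) / 2))"
    using nz unfolding n_def nsym_def of_int_mult by (simp add: divide_simps) (simp add: algebra_simps)
  also have "(\<lambda>s. of_real s * (inverse (\<i> * of_int k) / 6 * phase s l k) - (phase s l k - 1) / (18 * (n * of_int k)))
      = (\<lambda>s. dsym s l k)"
    using False assms by (auto simp: dsym_def n_def power2_eq_square mult_ac)
  finally show ?thesis .
qed

lemma bil_nsym_0: "bil (nsym 0) a a m = \<i> * of_int m / 2 * conv a a m"
  unfolding bil_def conv_def nsym_def by (subst infsum_cmult_right'[symmetric]) (simp_all add: mult_ac)

definition lri_path :: "seq \<Rightarrow> real \<Rightarrow> int \<Rightarrow> complex" where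
  "lri_path a s l = a l + bil (bsym s) a a l + bil (dsym s) a (conv a a) l"

text \<open>Termwise differentiation with the dominating terms
  \<open>J l * |a k * a (l - k)|\<close>, and likewise with \<open>G\<close>. The modes without a
  derivative formula contribute nothing: \<open>a\<close> vanishes at 0, and so does
  \<open>G\<close> because of its factor \<open>l\<close>.\<close>

lemma lri_path_has_vector_derivative:
  assumes a: "Hs_le 2 M a" and a0: "a 0 = 0" and s: "0 \<le> s" "s \<le> 1"
  defines "G \<equiv> bil (nsym 0) a a"
  shows "((\<lambda>s. lri_path a s l) has_vector_derivative
       bil (nsym s) a a l + 2 * of_real s * bil (nsym s) a G l) (at s within {0..1})"
proof -
  have ra: "reg a" using regI[OF a] by simp
  have "Hs_le 2 (KC 2 * M * M) (conv a a)"
    unfolding conv_def by (intro Hs_le_bil_bounded[OF _ _ _ a a, where K = 1]) auto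
  then have rc: "reg (conv a a)" by (rule regI) simp
  have "Hs_le (2 - 1) (KC 2 * (1 / 2) * M * M) (bil (nsym 0) a a)"
    using a by (intro Hs_le_bil[where s = 2 and p = 0 and q = 0 and K = "1/2" and A = M and B = M] nsym_bound) auto
  then have rG: "reg G" unfolding G_def by (intro regI) auto
  have nb: "cmod (nsym t l k) \<le> J l" for t k
  proof -
    have "cmod (nsym t l k) \<le> 1 / 2 * J l" using nsym_bound[of t l k] by simp
    then show ?thesis using J_nonneg[of l] by linarith
  qed
  have absnb: "cmod (nsym t l k * x * y) \<le> J l * cmod (1 * x * y)" for t k x y
    by (simp add: norm_mult mult.assoc mult_right_mono nb)
  have smB: "(\<lambda>k. J l * cmod (1 * a k * a (l - k))) summable_on UNIV"
    by (intro summable_on_cmult_right reg_bil_summable(1)[of _ _ "\<lambda>_ _. 1"] ra sym_bounded_one)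
  have smD: "(\<lambda>k. 2 * (J l * cmod (1 * a k * G (l - k)))) summable_on UNIV"
    by (intro summable_on_cmult_right reg_bil_summable(1)[of _ _ "\<lambda>_ _. 1"] ra rG sym_bounded_one)
  have S: "convex {0..1::real}" "s \<in> {0..1}" using s by auto
  have B: "((\<lambda>s. \<Sum>\<^sub>\<infinity>k. bsym s l k * a k * a (l - k)) has_vector_derivative
      (\<Sum>\<^sub>\<infinity>k. nsym s l k * a k * a (l - k))) (at s within {0..1})"
  proof (rule has_vector_derivative_infsum[OF S _ absnb smB])
    show "((\<lambda>s. bsym s l k * a k * a (l - k)) has_vector_derivative nsym s l k * a k * a (l - k)) (at s within {0..1})" for k s
    proof (cases "k = 0 \<or> l = k")
      case False
      then show ?thesis
        by (intro has_vector_derivative_mult_left has_vector_derivative_at_within[OF bsym_has_vector_derivative]) auto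
    qed (auto simp: a0)
    show "(\<lambda>k. bsym s l k * a k * a (l - k)) summable_on UNIV" if "s \<in> {0..1}" for s
      using that by (intro reg_bil_summable ra sym_bounded_bsym) auto
  qed
  have D: "((\<lambda>s. \<Sum>\<^sub>\<infinity>k. dsym s l k * a k * conv a a (l - k)) has_vector_derivative
      (\<Sum>\<^sub>\<infinity>k. nsym s l k * a k * (2 * of_real s * G (l - k)))) (at s within {0..1})"
  proof (rule has_vector_derivative_infsum[OF S _ _ smD])
    show "((\<lambda>s. dsym s l k * a k * conv a a (l - k)) has_vector_derivative
        nsym s l k * a k * (2 * of_real s * G (l - k))) (at s within {0..1})" for k s
    proof (cases "k = 0 \<or> l = k")
      case False
      have "((\<lambda>s. dsym s l k * a k * conv a a (l - k)) has_vector_derivative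
        nsym s l k * (2 * of_real s * (\<i> * of_int (l - k) / 2)) * a k * conv a a (l - k)) (at s within {0..1})"
        using False
        by (intro has_vector_derivative_mult_left has_vector_derivative_at_within[OF dsym_has_vector_derivative]) auto
      then show ?thesis by (simp add: G_def bil_nsym_0 mult_ac del: of_int_diff)
    qed (auto simp: a0 dsym_def G_def bil_nsym_0)
    show "(\<lambda>k. dsym s l k * a k * conv a a (l - k)) summable_on UNIV" if "s \<in> {0..1}" for s
      using that by (intro reg_bil_summable ra rc sym_bounded_dsym) auto
    show "cmod (nsym s l k * a k * (2 * of_real s * G (l - k))) \<le> 2 * (J l * cmod (1 * a k * G (l - k)))"
      if "s \<in> {0..1}" for s k
    proof -
      have "cmod (nsym s l k * a k * (2 * of_real s * G (l - k))) = \<bar>s\<bar> * (2 * cmod (nsym s l k * a k * G (l - k)))"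
        by (simp add: norm_mult)
      also have "\<dots> \<le> 1 * (2 * (J l * cmod (1 * a k * G (l - k))))"
        using that absnb[of s k "a k" "G (l - k)"] by (intro mult_mono) auto
      finally show ?thesis by simp
    qed
  qed
  have "(\<Sum>\<^sub>\<infinity>k. nsym s l k * a k * (2 * of_real s * G (l - k))) = 2 * of_real s * bil (nsym s) a G l"
    using bil_scale_right[of "nsym s" a "2 * of_real s" G l] by (simp add: bil_def)
  then show ?thesis
    using has_vector_derivative_add[OF has_vector_derivative_add[OF has_vector_derivative_const[of "a l"] B] D]
    by (simp add: lri_path_def bil_def)
qed

section \<open>The local error over one step of the twisted exact flow\<close>

locale twisted_flow =
  fixes \<gamma> M h :: real and w :: "real \<Rightarrow> int \<Rightarrow> complex"
  assumes \<gamma>: "0 \<le> \<gamma>" and h: "0 \<le> h" "h \<le> 1"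
    and w: "\<And>s. 0 \<le> s \<Longrightarrow> s \<le> h \<Longrightarrow> Hs_le (\<gamma> + 4) M (w s)"
    and w_cont: "\<And>l. continuous_on {0..h} (\<lambda>s. w s l)"
    and w_deriv: "\<And>s l. 0 < s \<Longrightarrow> s < h \<Longrightarrow>
        ((\<lambda>s. w s l) has_vector_derivative bil (nsym s) (w s) (w s) l) (at s)"
    and w_zero: "w 0 0 = 0"
begin

text \<open>None of these constants involves \<open>h\<close> or \<open>w\<close>, which makes them
  uniform over all steps and solutions. \<kappa> majorises the product constants of all spaces in
  use, \<open>C1\<close> bounds the time derivative of \<open>w\<close> in
  \<open>H^(\<gamma>+3)\<close>, \<open>C2\<close> its second-order remainder in
  \<open>H^(\<gamma>+1)\<close>; \<open>C3\<close> and \<open>C4\<close> are the two local error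
  constants.\<close>

definition "\<kappa> = KC (\<gamma> + 4)"
definition "C1 = \<kappa> * M\<^sup>2 / 2"
definition "C2 = \<kappa> * C1 * M + 3 / 2 * \<kappa> * M\<^sup>2"
definition "C3 = \<kappa> * C1\<^sup>2 / 2 + \<kappa> * M * C2"
definition "C4 = 2 * \<kappa> * C1 * M"

abbreviation "a \<equiv> w 0"
definition "G = bil (nsym 0) a a"

lemma const_nonneg: "0 \<le> \<kappa>" "0 \<le> M" "0 \<le> C1" "0 \<le> C2" "0 \<le> C3" "0 \<le> C4"
proof -
  show "0 \<le> M" using Hs_le_nonneg[OF w[of 0]] h by simp
  then show "0 \<le> \<kappa>" "0 \<le> C1" "0 \<le> C2" "0 \<le> C3" "0 \<le> C4"
    by (simp_all add: \<kappa>_def C1_def C2_def C3_def C4_def)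
qed

lemma KC_le: "r \<le> \<gamma> + 4 \<Longrightarrow> KC r \<le> \<kappa>"
  by (simp add: \<kappa>_def KC_mono)

lemma nsym_left:
  assumes "1 \<le> r" "r \<le> \<gamma> + 4" "Hs_le r A x" "Hs_le r B y" "\<kappa> / 2 * A * B \<le> C" "\<rho> \<le> r - 1"
  shows "Hs_le \<rho> C (bil (nsym s) x y)"
proof (rule Hs_le_weaken[OF _ assms(6) order_refl])
  have "KC r * (1 / 2) * A * B \<le> \<kappa> * (1 / 2) * A * B"
    using assms Hs_le_nonneg KC_le by (intro mult_right_mono) auto
  then show "Hs_le (r - 1) C (bil (nsym s) x y)"
    using assms by (intro Hs_le_bil[where s = r and p = 0 and q = 0 and K = "1 / 2" and A = A and B = B] nsym_bound) auto
qed

lemma regw: "0 \<le> s \<Longrightarrow> s \<le> h \<Longrightarrow> reg (w s)"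
  using w regI \<gamma> by fastforce

lemma G: "Hs_le (\<gamma> + 3) C1 G"
  using nsym_left[of "\<gamma> + 4" M a M a C1 "\<gamma> + 3" 0] w[of 0] \<gamma> h by (simp add: G_def C1_def power2_eq_square)

lemma regG: "reg G"
  using regI[OF G] \<gamma> by simp

lemma increment:
  assumes "0 \<le> s" "s \<le> h"
  shows "Hs_le (\<gamma> + 3) (C1 * s) (\<lambda>l. w s l - a l)"
proof (rule Hs_le_mvt[where y = "\<lambda>s l. w s l - a l" and y' = "\<lambda>s. bil (nsym s) (w s) (w s)"])
  show "continuous_on {0..s} (\<lambda>s. w s l - a l)" for l
    by (intro continuous_intros continuous_on_subset[OF w_cont]) (use assms in auto)
  show "((\<lambda>s. w s l - a l) has_vector_derivative bil (nsym r) (w r) (w r) l) (at r)" if "0 < r" "r < s" for r l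
    using has_vector_derivative_diff[OF w_deriv has_vector_derivative_const[of "a l"]] that assms by fastforce
  show "Hs_le (\<gamma> + 3) C1 (bil (nsym r) (w r) (w r))" if "0 < r" "r < s" for r
    using nsym_left[of "\<gamma> + 4" M "w r" M "w r" C1 "\<gamma> + 3" r] w[of r] \<gamma> that assms by (simp add: C1_def power2_eq_square)
qed (use assms const_nonneg in auto)

lemma nonlinearity_increment:
  assumes "0 \<le> s" "s \<le> h"
  shows "bil (nsym s) (w s) (w s) l - bil (nsym s) a a l
     = bil (nsym s) (\<lambda>l. w s l - a l) (w s) l + bil (nsym s) a (\<lambda>l. w s l - a l) l"
proof -
  have "reg (w s)" "reg a" using regw assms by auto
  then show ?thesis
    by (simp add: bil_diff_left[OF _ _ _ sym_bounded_nsym] bil_diff_right[OF _ _ _ sym_bounded_nsym])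
qed

lemma Hs_le_nonlinearity_increment:
  assumes "0 \<le> s" "s \<le> h"
  shows "Hs_le (\<gamma> + 2) (\<kappa> * C1 * M * s) (\<lambda>l. bil (nsym s) (w s) (w s) l - bil (nsym s) a a l)"
proof -
  have w3: "Hs_le (\<gamma> + 3) M (w s)" "Hs_le (\<gamma> + 3) M a"
    using w[OF assms] w[of 0] h Hs_le_weaken by auto
  have "Hs_le (\<gamma> + 2) (\<kappa> / 2 * (C1 * s) * M + \<kappa> / 2 * M * (C1 * s))
      (\<lambda>l. bil (nsym s) (\<lambda>l. w s l - a l) (w s) l + bil (nsym s) a (\<lambda>l. w s l - a l) l)"
    using \<gamma> by (intro Hs_le_add nsym_left[OF _ _ increment[OF assms] w3(1) order_refl]
        nsym_left[OF _ _ w3(2) increment[OF assms] order_refl]) auto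
  then show ?thesis
    unfolding nonlinearity_increment[OF assms] by (rule Hs_le_weaken) (simp_all add: mult_ac)
qed

text \<open>The derivative \<open>N s w w\<close> leaves its initial value \<open>G\<close> for two
  reasons: \<open>w\<close> moves away from \<open>a\<close>, and the phase moves away from 1. The
  second is the expensive one, with two derivatives on the result and one on each factor, so that
  \<open>H^(\<gamma>+4)\<close> leaves only \<open>H^(\<gamma>+1)\<close>.\<close>

lemma second_increment:
  assumes "0 \<le> s" "s \<le> h"
  shows "Hs_le (\<gamma> + 1) (C2 * s * s) (\<lambda>l. w s l - a l - of_real s * G l)"
proof (rule Hs_le_mvt[where y = "\<lambda>s l. w s l - a l - of_real s * G l"
      and y' = "\<lambda>s l. bil (nsym s) (w s) (w s) l - G l"])
  show "continuous_on {0..s} (\<lambda>s. w s l - a l - of_real s * G l)" for l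
    by (intro continuous_intros continuous_on_subset[OF w_cont]) (use assms in auto)
  show "((\<lambda>s. w s l - a l - of_real s * G l) has_vector_derivative bil (nsym r) (w r) (w r) l - G l) (at r)"
    if "0 < r" "r < s" for r l
  proof -
    have "((\<lambda>s. w s l) has_vector_derivative bil (nsym r) (w r) (w r) l) (at r)"
      using w_deriv that assms by auto
    then show ?thesis by (auto intro!: derivative_eq_intros)
  qed
  show "Hs_le (\<gamma> + 1) (C2 * s) (\<lambda>l. bil (nsym r) (w r) (w r) l - G l)" if r: "0 < r" "r < s" for r
  proof -
    have r': "0 \<le> r" "r \<le> h" using r assms by auto
    have a4: "Hs_le (\<gamma> + 3 + 1) M a" using w[of 0] h by (simp add: add.assoc)
    have "Hs_le (\<gamma> + 3 - 2) (\<kappa> * (3 / 2 * r) * M * M) (bil (\<lambda>l k. nsym r l k - nsym 0 l k) a a)"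
    proof (rule Hs_le_bil[OF _ order_refl _ a4 a4 nsym_diff_bound])
      show "KC (\<gamma> + 3) * (3 / 2 * r) * M * M \<le> \<kappa> * (3 / 2 * r) * M * M"
        using const_nonneg r KC_le by (intro mult_right_mono) auto
    qed (use \<gamma> r in auto)
    then have 1: "Hs_le (\<gamma> + 1) (\<kappa> * (3 / 2 * r) * M * M) (\<lambda>l. bil (nsym r) a a l - G l)"
    proof (rule back_subst[where P = "Hs_le (\<gamma> + 1) (\<kappa> * (3 / 2 * r) * M * M)", OF Hs_le_weaken])
      show "bil (\<lambda>l k. nsym r l k - nsym 0 l k) a a = (\<lambda>l. bil (nsym r) a a l - G l)"
        using regw[of 0] h by (intro ext) (simp add: G_def bil_diff_sym[OF _ _ sym_bounded_nsym sym_bounded_nsym])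
    qed auto
    have 2: "Hs_le (\<gamma> + 1) (\<kappa> * C1 * M * r) (\<lambda>l. bil (nsym r) (w r) (w r) l - bil (nsym r) a a l)"
      by (rule Hs_le_weaken[OF Hs_le_nonlinearity_increment[OF r']]) auto
    have "\<kappa> * C1 * M * r + \<kappa> * (3 / 2 * r) * M * M = C2 * r"
      by (simp add: C2_def power2_eq_square algebra_simps)
    also have "\<dots> \<le> C2 * s" using r const_nonneg by (intro mult_left_mono) auto
    finally show ?thesis
      using Hs_le_weaken[OF Hs_le_add[OF 2 1] order_refl] by simp
  qed
qed (use assms const_nonneg in auto)

lemma path_deriv:
  assumes "0 < s" "s < h"
  shows "((\<lambda>s. w s l - lri_path a s l) has_vector_derivative
     bil (nsym s) (w s) (w s) l - (bil (nsym s) a a l + 2 * of_real s * bil (nsym s) a G l)) (at s)"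
proof (rule has_vector_derivative_diff[OF w_deriv[OF assms]])
  have "((\<lambda>s. lri_path a s l) has_vector_derivative
       bil (nsym s) a a l + 2 * of_real s * bil (nsym s) a G l) (at s within {0..1})"
    unfolding G_def
    using assms h w_zero \<gamma> by (intro lri_path_has_vector_derivative[OF Hs_le_weaken[OF w]]) auto
  then show "((\<lambda>s. lri_path a s l) has_vector_derivative
       bil (nsym s) a a l + 2 * of_real s * bil (nsym s) a G l) (at s)"
    using assms h by (subst (asm) at_within_interior) auto
qed

lemma path_cont: "continuous_on {0..h} (\<lambda>s. w s l - lri_path a s l)"
proof -
  have "continuous_on {0..1} (\<lambda>s. lri_path a s l)"
  proof (rule continuous_on_vector_derivative)
    show "((\<lambda>s. lri_path a s l) has_vector_derivative
       bil (nsym s) a a l + 2 * of_real s * bil (nsym s) a (bil (nsym 0) a a) l) (at s within {0..1})"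
      if "s \<in> {0..1}" for s
      using that h w_zero \<gamma> by (intro lri_path_has_vector_derivative[OF Hs_le_weaken[OF w]]) auto
  qed
  then show ?thesis
    using h by (intro continuous_on_diff w_cont) (auto elim: continuous_on_subset)
qed

lemma path_0: "lri_path a 0 l = a l"
proof -
  have "bsym 0 l k = 0" "dsym 0 l k = 0" for k by (simp_all add: bsym_def dsym_def)
  then show ?thesis by (simp add: lri_path_def bil_def)
qed

text \<open>With \<open>w = a + d\<close> and \<open>d = s G + r\<close> the defect of the
  derivatives is \<open>N d d + 2 N a r\<close>. It is quadratic in \<open>s\<close>, as
  \<open>d\<close> is of first and \<open>r\<close> of second order, and the derivative in
  \<open>N\<close> uses up the last one available.\<close>

lemma local_error_fine: "Hs_le \<gamma> (C3 * h\<^sup>2 * h) (\<lambda>l. w h l - lri_path a h l)"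
proof (rule Hs_le_mvt[where y = "\<lambda>s l. w s l - lri_path a s l", OF h(1) path_cont path_deriv])
  show "Hs_le \<gamma> (C3 * h\<^sup>2) (\<lambda>l. bil (nsym s) (w s) (w s) l - (bil (nsym s) a a l + 2 * of_real s * bil (nsym s) a G l))"
    if s: "0 < s" "s < h" for s
  proof -
    have s': "0 \<le> s" "s \<le> h" using s by auto
    define d where "d l = w s l - a l" for l
    define r where "r l = w s l - a l - of_real s * G l" for l
    have d: "Hs_le (\<gamma> + 3) (C1 * s) d" using increment[OF s'] by (simp add: d_def[abs_def])
    have r: "Hs_le (\<gamma> + 1) (C2 * s * s) r" using second_increment[OF s'] by (simp add: r_def[abs_def])
    have 1: "Hs_le \<gamma> (\<kappa> / 2 * (C1 * s) * (C1 * s)) (bil (nsym s) d d)"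
      using \<gamma> by (intro nsym_left[OF _ _ d d order_refl]) auto
    have a1: "Hs_le (\<gamma> + 1) M a" using w[of 0] h by (auto elim: Hs_le_weaken)
    have 2: "Hs_le \<gamma> (\<kappa> / 2 * M * (C2 * s * s)) (bil (nsym s) a r)"
      using \<gamma> by (intro nsym_left[OF _ _ a1 r order_refl]) auto
    have regs: "reg (w s)" "reg a" "reg G" "reg d" "reg r" "reg (\<lambda>l. of_real s * G l)"
      using regw s' regG \<gamma> regI[OF d] regI[OF r] reg_diff[of d r] by (simp_all add: d_def r_def)
    have eq: "bil (nsym s) (w s) (w s) l - (bil (nsym s) a a l + 2 * of_real s * bil (nsym s) a G l)
       = bil (nsym s) d d l + 1 * bil (nsym s) a r l + bil (nsym s) a r l" for l
    proof -
      have "bil (nsym s) d d l = bil (nsym s) (w s) (w s) l - bil (nsym s) a (w s) l - bil (nsym s) (w s) a l + bil (nsym s) a a l"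
        unfolding d_def[abs_def] using regs(1,2)
        by (simp add: bil_diff_left[OF _ _ _ sym_bounded_nsym] bil_diff_right[OF _ _ _ sym_bounded_nsym] reg_diff)
      moreover have "bil (nsym s) a r l = bil (nsym s) a (w s) l - bil (nsym s) a a l - of_real s * bil (nsym s) a G l"
        unfolding r_def[abs_def] using regs(1,2,6)
        by (simp add: bil_diff_right[OF _ _ _ sym_bounded_nsym] reg_diff bil_scale_right)
      moreover have "bil (nsym s) (w s) a l = bil (nsym s) a (w s) l"
        by (rule bil_commute) simp
      ultimately show ?thesis by (simp only:) (simp add: algebra_simps)
    qed
    have "\<kappa> / 2 * (C1 * s) * (C1 * s) + \<kappa> / 2 * M * (C2 * s * s) + \<kappa> / 2 * M * (C2 * s * s) = C3 * s\<^sup>2"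
      by (simp add: C3_def power2_eq_square algebra_simps)
    also have "\<dots> \<le> C3 * h\<^sup>2" using s const_nonneg by (intro mult_left_mono power_mono) auto
    finally show ?thesis
      unfolding eq using Hs_le_weaken[OF Hs_le_add[OF Hs_le_add[OF 1 2] 2] order_refl] by simp
  qed
qed (use const_nonneg path_0 in auto)

text \<open>No cancellation is used: the increment of \<open>N\<close> and the correction
  \<open>2 s N a G\<close> are of order \<open>s\<close> separately. The order lost in this way pays
  for the additional derivative in the norm.\<close>

lemma local_error_coarse: "Hs_le (\<gamma> + 1) (C4 * h * h) (\<lambda>l. w h l - lri_path a h l)"
proof (rule Hs_le_mvt[where y = "\<lambda>s l. w s l - lri_path a s l", OF h(1) path_cont path_deriv])
  show "Hs_le (\<gamma> + 1) (C4 * h) (\<lambda>l. bil (nsym s) (w s) (w s) l - (bil (nsym s) a a l + 2 * of_real s * bil (nsym s) a G l))"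
    if s: "0 < s" "s < h" for s
  proof -
    have s': "0 \<le> s" "s \<le> h" using s by auto
    have 1: "Hs_le (\<gamma> + 1) (\<kappa> * C1 * M * s) (\<lambda>l. bil (nsym s) (w s) (w s) l - bil (nsym s) a a l)"
      by (rule Hs_le_weaken[OF Hs_le_nonlinearity_increment[OF s']]) auto
    have a3: "Hs_le (\<gamma> + 3) M a" using w[of 0] h by (auto elim: Hs_le_weaken)
    have "Hs_le (\<gamma> + 1) (\<kappa> / 2 * M * C1) (bil (nsym s) a G)"
      using \<gamma> by (intro nsym_left[OF _ _ a3 G order_refl]) auto
    then have 2: "Hs_le (\<gamma> + 1) (\<kappa> * M * C1 * s) (\<lambda>l. 2 * of_real s * bil (nsym s) a G l)"
      by (rule Hs_le_le[where K = "2 * s"]) (use s in \<open>auto simp: norm_mult\<close>)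
    have "\<kappa> * C1 * M * s + \<kappa> * M * C1 * s = C4 * s" by (simp add: C4_def)
    also have "\<dots> \<le> C4 * h" using s const_nonneg by (intro mult_left_mono) auto
    finally show ?thesis
      using Hs_le_weaken[OF Hs_le_diff[OF 1 2] order_refl] by (simp add: algebra_simps)
  qed
qed (use const_nonneg path_0 h in auto)

end

section \<open>Convergence on the Fourier side\<close>

lemma Cstab_nonneg: "0 \<le> r \<Longrightarrow> 0 \<le> M \<Longrightarrow> 0 \<le> Cstab r s M"
  by (simp add: Cstab_def Clin_def)

text \<open>The KdV equation for the coefficients; \<open>i l^3\<close> is the symbol of minus the
  third derivative. Hermitian symmetry expresses that the solution is real. The differential
  equation holds inside the interval and continuity covers the ends.\<close>

definition fourier_kdv :: "real \<Rightarrow> real \<Rightarrow> real \<Rightarrow> (real \<Rightarrow> int \<Rightarrow> complex) \<Rightarrow> bool" where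
  "fourier_kdv s T M c \<longleftrightarrow>
     (\<forall>t\<in>{0..T}. Hs_le s M (c t) \<and> (\<forall>l. c t (- l) = cnj (c t l)) \<and> c t 0 = 0)
   \<and> (\<forall>l. continuous_on {0..T} (\<lambda>t. c t l))
   \<and> (\<forall>t\<in>{0<..<T}. \<forall>l. ((\<lambda>t. c t l) has_vector_derivative
        \<i> * of_int l ^ 3 * c t l + \<i> * of_int l / 2 * conv (c t) (c t) l) (at t))"

definition twist :: "(real \<Rightarrow> int \<Rightarrow> complex) \<Rightarrow> real \<Rightarrow> real \<Rightarrow> int \<Rightarrow> complex" where
  "twist c t s l = cis (- (s * of_int l ^ 3)) * c (t + s) l"

lemma bil_nsym_twist:
  "bil (nsym s) (twist c t s) (twist c t s) l
     = cis (- (s * of_int l ^ 3)) * (\<i> * of_int l / 2 * conv (c (t + s)) (c (t + s)) l)"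
proof -
  have "nsym s l k * twist c t s k * twist c t s (l - k)
      = cis (- (s * of_int l ^ 3)) * (\<i> * of_int l / 2) * (1 * c (t + s) k * c (t + s) (l - k))" for k
  proof -
    \<comment> \<open>This is the factorisation of the difference of cubes: the three phases of an
      interaction combine to the one of the output frequency.\<close>
    have "phase s l k * cis (- (s * of_int k ^ 3)) * cis (- (s * of_int (l - k) ^ 3)) = cis (- (s * of_int l ^ 3))"
      unfolding phase_def cis_mult by (rule arg_cong[where f = cis]) (simp add: power3_eq_cube algebra_simps)
    then have "nsym s l k * twist c t s k * twist c t s (l - k)
      = (\<i> * of_int l / 2) * (phase s l k * cis (- (s * of_int k ^ 3)) * cis (- (s * of_int (l - k) ^ 3)))
        * (c (t + s) k * c (t + s) (l - k))"
      by (simp add: nsym_def twist_def mult_ac)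
    then show ?thesis
      using \<open>phase s l k * _ * _ = _\<close> by simp
  qed
  then show ?thesis
    unfolding bil_def conv_def by (simp only: infsum_cmult_right' mult.assoc)
qed

lemma twisted_flow_twist:
  assumes c: "fourier_kdv (\<gamma> + 4) T M c" and \<gamma>: "0 \<le> \<gamma>" and h: "0 \<le> h" "h \<le> 1" and t: "0 \<le> t" "t + h \<le> T"
  shows "twisted_flow \<gamma> M h (twist c t)"
proof
  show "Hs_le (\<gamma> + 4) M (twist c t s)" if "0 \<le> s" "s \<le> h" for s
  proof (rule Hs_le_le[where K = 1])
    show "Hs_le (\<gamma> + 4) M (c (t + s))"
      using c t that by (auto simp: fourier_kdv_def)
  qed (auto simp: twist_def norm_mult)
  show "continuous_on {0..h} (\<lambda>s. twist c t s l)" for l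
  proof -
    have "continuous_on {0..h} (\<lambda>s. c (t + s) l)"
      using c t unfolding fourier_kdv_def
      by (intro continuous_on_compose2[where f = "\<lambda>s. t + s" and g = "\<lambda>t. c t l" and t = "{0..T}"])
         (auto intro!: continuous_intros)
    moreover have "continuous_on {0..h} (\<lambda>s. cis (- (s * of_int l ^ 3)))"
      by (intro continuous_intros)
    ultimately show ?thesis unfolding twist_def by (rule continuous_on_mult[rotated])
  qed
  show "((\<lambda>s. twist c t s l) has_vector_derivative bil (nsym s) (twist c t s) (twist c t s) l) (at s)"
    if s: "0 < s" "s < h" for s l
  proof -
    have "((\<lambda>t. c t l) has_vector_derivative
        \<i> * of_int l ^ 3 * c (t + s) l + \<i> * of_int l / 2 * conv (c (t + s)) (c (t + s)) l) (at (t + s))"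
      using c t s by (auto simp: fourier_kdv_def)
    then have 1: "((\<lambda>s. c (t + s) l) has_vector_derivative
        \<i> * of_int l ^ 3 * c (t + s) l + \<i> * of_int l / 2 * conv (c (t + s)) (c (t + s)) l) (at s)"
    proof -
      have "((\<lambda>s. t + s) has_vector_derivative 1) (at s)"
        by (auto intro!: derivative_eq_intros)
      from vector_diff_chain_at[OF this \<open>((\<lambda>t. c t l) has_vector_derivative _) _\<close>]
      show ?thesis by (simp add: o_def)
    qed
    have 2: "((\<lambda>s. cis (- (s * of_int l ^ 3))) has_vector_derivative
        (- \<i> * of_int l ^ 3) * cis (- (s * of_int l ^ 3))) (at s)"
    proof -
      have eq: "cis (- (s * of_int l ^ 3)) = exp (- \<i> * of_int l ^ 3 * of_real s)" for s
        by (simp add: cis_conv_exp mult_ac)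
      show ?thesis unfolding eq
        by (rule has_vector_derivative_real_field) (auto intro!: derivative_eq_intros)
    qed
    show ?thesis
      unfolding bil_nsym_twist using has_vector_derivative_mult[OF 2 1]
      by (simp add: twist_def algebra_simps)
  qed
  show "twist c t 0 0 = 0"
    using c t h by (simp add: twist_def fourier_kdv_def)
qed (use assms in auto)

lemma lri_seq_path: "lri_seq h x l = cis (h * of_int l ^ 3) * lri_path x h l"
  by (simp add: lri_seq_def lri_path_def)

lemma sequence_local_error:
  assumes c: "fourier_kdv (\<gamma> + 4) T M c" and \<gamma>: "0 \<le> \<gamma>" and h: "0 \<le> h" "h \<le> 1" and t: "0 \<le> t" "t + h \<le> T"
  shows "Hs_le \<gamma> (twisted_flow.C3 \<gamma> M * h ^ 3) (\<lambda>l. c (t + h) l - lri_seq h (c t) l)"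
    and "Hs_le (\<gamma> + 1) (twisted_flow.C4 \<gamma> M * h\<^sup>2) (\<lambda>l. c (t + h) l - lri_seq h (c t) l)"
    and "0 \<le> twisted_flow.C3 \<gamma> M" "0 \<le> twisted_flow.C4 \<gamma> M"
proof -
  interpret twisted_flow \<gamma> M h "twist c t" by (rule twisted_flow_twist[OF assms])
  have 0: "twist c t 0 = c t" by (auto simp: twist_def)
  have eq: "c (t + h) l - lri_seq h (c t) l = cis (h * of_int l ^ 3) * (twist c t h l - lri_path (c t) h l)" for l
  proof -
    have "cis (h * of_int l ^ 3) * twist c t h l = c (t + h) l"
      by (simp add: twist_def cis_mult flip: mult.assoc)
    then show ?thesis by (simp add: lri_seq_path algebra_simps)
  qed
  show "Hs_le \<gamma> (C3 * h ^ 3) (\<lambda>l. c (t + h) l - lri_seq h (c t) l)"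
    unfolding eq by (rule Hs_le_le[OF local_error_fine[unfolded 0], where K = 1])
      (auto simp: norm_mult power3_eq_cube power2_eq_square)
  show "Hs_le (\<gamma> + 1) (C4 * h\<^sup>2) (\<lambda>l. c (t + h) l - lri_seq h (c t) l)"
    unfolding eq by (rule Hs_le_le[OF local_error_coarse[unfolded 0], where K = 1])
      (auto simp: norm_mult power2_eq_square)
  show "0 \<le> C3" "0 \<le> C4" using const_nonneg by auto
qed

text \<open>A discrete Gronwall argument. \<open>h0\<close> and \<open>C\<close> are chosen before
  \<open>c\<close>, hence depend on \<gamma>, \<open>T\<close> and \<open>M\<close> only. The bound
  1 in \<open>H^(\<gamma>+1)\<close> keeps the iterates regular, which later identifies the
  numerical solution with its Fourier series.\<close>

lemma sequence_convergence:
  assumes \<gamma>: "0 \<le> \<gamma>" and T: "0 < T" and M: "0 \<le> M"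
  shows "\<exists>h0>0. \<exists>C>0. \<forall>c. fourier_kdv (\<gamma> + 4) T M c \<longrightarrow>
     (\<forall>h n. 0 < h \<longrightarrow> h \<le> h0 \<longrightarrow> real n * h \<le> T \<longrightarrow>
        Hs_le \<gamma> (C * h\<^sup>2) (\<lambda>l. c (real n * h) l - (lri_seq h ^^ n) (c 0) l)
      \<and> Hs_le (\<gamma> + 1) 1 (\<lambda>l. c (real n * h) l - (lri_seq h ^^ n) (c 0) l))"
proof -
  define S where "S = max (Cstab \<gamma> (\<gamma> + 1) M) (Cstab (\<gamma> + 1) (\<gamma> + 1) M)"
  have S: "0 \<le> S" "Cstab \<gamma> (\<gamma> + 1) M \<le> S" "Cstab (\<gamma> + 1) (\<gamma> + 1) M \<le> S"
    using Cstab_nonneg[OF \<gamma> M] by (auto simp: S_def intro: max.coboundedI1)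
  \<comment> \<open>The signs of the local constants are known only once some solution provides an
    instance of the locale; absolute values make them available beforehand.\<close>
  define C3 C4 where "C3 = \<bar>twisted_flow.C3 \<gamma> M\<bar>" and "C4 = \<bar>twisted_flow.C4 \<gamma> M\<bar>"
  have C34: "0 \<le> C3" "0 \<le> C4" by (auto simp: C3_def C4_def)
  define K where "K = C4 * T * exp (S * T)"
  define C where "C = C3 * T * exp (S * T) + 1"
  \<comment> \<open>Chosen so that \<open>K * h \<le> sqrt h\<close> for \<open>h \<le> h0\<close>,
    where \<open>K * h\<close> is the coarse error that accumulates up to time
    \<open>T\<close>.\<close>
  define h0 where "h0 = (1 / (K + 1))\<^sup>2"
  have K: "0 \<le> K" using C34 T by (simp add: K_def)
  have h0: "0 < h0" "h0 \<le> 1"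
    using K by (auto simp: h0_def intro!: power_le_one zero_less_power)
  have C: "0 < C" using C34 T by (simp add: C_def add_nonneg_pos)
  have "Hs_le \<gamma> (C * h\<^sup>2) (\<lambda>l. c (real n * h) l - (lri_seq h ^^ n) (c 0) l)
      \<and> Hs_le (\<gamma> + 1) 1 (\<lambda>l. c (real n * h) l - (lri_seq h ^^ n) (c 0) l)"
    if c: "fourier_kdv (\<gamma> + 4) T M c" and h: "0 < h" "h \<le> h0" and n: "real n * h \<le> T" for c h n
  proof -
    have growth: "real n * h * (1 + S * h) ^ n \<le> T * exp (S * T)" if "real n * h \<le> T" for n
    proof (rule mult_mono)
      have "(1 + S * h) ^ n \<le> exp (S * h) ^ n"
        using S h exp_ge_add_one_self[of "S * h"] by (intro power_mono) auto
      also have "\<dots> = exp (S * (real n * h))"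
        by (simp add: exp_of_nat_mult[symmetric] mult_ac)
      also have "\<dots> \<le> exp (S * T)" using S that by (simp add: mult_left_mono)
      finally show "(1 + S * h) ^ n \<le> exp (S * T)" .
    qed (use that T S h in auto)
    have sq: "K * h \<le> sqrt h"
    proof -
      have "sqrt h \<le> sqrt h0" using h by simp
      also have "sqrt h0 = 1 / (K + 1)" using K by (simp add: h0_def)
      finally have "(K + 1) * sqrt h \<le> 1" using K by (simp add: field_simps)
      then have "K * sqrt h \<le> 1" using h by (simp add: algebra_simps) (smt (verit) real_sqrt_ge_zero)
      then have "K * sqrt h * sqrt h \<le> 1 * sqrt h" using h by (intro mult_right_mono) auto
      then show ?thesis using h by (simp add: mult.assoc)
    qed
    define e where "e n l = c (real n * h) l - (lri_seq h ^^ n) (c 0) l" for n l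
    \<comment> \<open>The factor \<open>n * h\<close> is the elapsed time, that is, the number of
      local errors added so far; \<open>(1 + S * h) ^ n\<close> is their amplification.\<close>
    have inv: "Hs_le (\<gamma> + 1) (C4 * h * (real n * h * (1 + S * h) ^ n)) (e n)
        \<and> Hs_le \<gamma> (C3 * h\<^sup>2 * (real n * h * (1 + S * h) ^ n)) (e n)"
      if "real n * h \<le> T" for n using that
    proof (induction n)
      case 0
      then show ?case by (simp add: e_def[abs_def] Hs_le_zero)
    next
      case (Suc n)
      define t where "t = real n * h"
      have t: "0 \<le> t" "t + h \<le> T" "t \<le> T" "t + h = real (Suc n) * h"
        using Suc.prems h by (auto simp: t_def algebra_simps)
      have IH: "Hs_le (\<gamma> + 1) (C4 * h * (t * (1 + S * h) ^ n)) (e n)"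
        "Hs_le \<gamma> (C3 * h\<^sup>2 * (t * (1 + S * h) ^ n)) (e n)"
        using Suc.IH t(3) by (auto simp: t_def)
      have h1: "0 \<le> h" "h \<le> 1" using h h0 by auto
      have "C4 * h * (t * (1 + S * h) ^ n) \<le> C4 * h * (T * exp (S * T))"
        using growth[of n] t C34 h by (intro mult_left_mono) (auto simp: t_def)
      also have "\<dots> = K * h" by (simp add: K_def)
      finally have es: "Hs_le (\<gamma> + 1) (sqrt h) (e n)"
        using Hs_le_weaken[OF IH(1) order_refl] sq by auto
      have c4: "Hs_le (\<gamma> + 4) M (c t)" and herm: "c t (- l) = cnj (c t l)" for l
        using c t(1,3) by (auto simp: fourier_kdv_def)
      have c3: "Hs_le (\<gamma> + 1 + 2) M (c t)" by (rule Hs_le_weaken[OF c4]) auto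
      have split: "e (Suc n) = (\<lambda>l. (c (t + h) l - lri_seq h (c t) l)
          + (lri_seq h (c t) l - lri_seq h (\<lambda>l. c t l - e n l) l))"
      proof -
        have "(\<lambda>l. c t l - e n l) = (lri_seq h ^^ n) (c 0)" by (auto simp: e_def t_def)
        then show ?thesis by (simp add: e_def[abs_def] t(4)[symmetric] del: of_nat_Suc)
      qed
      \<comment> \<open>Both norms advance by the same argument. The smallness \<open>es\<close>,
        taken from the coarse half of the induction hypothesis, is used in either case.\<close>
      have step: "Hs_le r (D * (t + h) * (1 + S * h) ^ Suc n) (e (Suc n))"
        if r: "0 \<le> r" "r \<le> \<gamma> + 1" and D: "0 \<le> D" and CS: "Cstab r (\<gamma> + 1) M \<le> S"
          and e: "Hs_le r (D * t * (1 + S * h) ^ n) (e n)"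
          and loc: "Hs_le r (D * h) (\<lambda>l. c (t + h) l - lri_seq h (c t) l)" for r D
      proof -
        let ?E = "D * t * (1 + S * h) ^ n"
        have "Hs_le r ((1 + Cstab r (\<gamma> + 1) M * h) * ?E)
           (\<lambda>l. lri_seq h (c t) l - lri_seq h (\<lambda>l. c t l - e n l) l)"
          by (rule step_stability[OF r _ h1 c3 herm e es]) (use \<gamma> in auto)
        then have 1: "Hs_le r (D * h + (1 + Cstab r (\<gamma> + 1) M * h) * ?E) (e (Suc n))"
          unfolding split by (rule Hs_le_add[OF loc])
        have "(1 + Cstab r (\<gamma> + 1) M * h) * ?E \<le> (1 + S * h) * ?E"
          using CS D t h S by (intro mult_right_mono add_left_mono) auto
        moreover have "D * h * 1 \<le> D * h * (1 + S * h) ^ Suc n"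
          using D h S by (intro mult_left_mono one_le_power) auto
        ultimately have "D * h + (1 + Cstab r (\<gamma> + 1) M * h) * ?E \<le> D * (t + h) * (1 + S * h) ^ Suc n"
          by (simp add: algebra_simps)
        then show ?thesis using Hs_le_weaken[OF 1 order_refl] by blast
      qed
      have loc: "Hs_le \<gamma> (C3 * h\<^sup>2 * h) (\<lambda>l. c (t + h) l - lri_seq h (c t) l)"
        "Hs_le (\<gamma> + 1) (C4 * h * h) (\<lambda>l. c (t + h) l - lri_seq h (c t) l)"
        using sequence_local_error[OF c \<gamma> h1 t(1,2)]
        by (simp_all add: C3_def C4_def power3_eq_cube power2_eq_square mult.assoc)
      have "Hs_le (\<gamma> + 1) (C4 * h * (t + h) * (1 + S * h) ^ Suc n) (e (Suc n))"
        using \<gamma> C34 h IH(1) by (intro step[OF _ _ _ S(3) _ loc(2)]) (auto simp: mult.assoc)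
      moreover have "Hs_le \<gamma> (C3 * h\<^sup>2 * (t + h) * (1 + S * h) ^ Suc n) (e (Suc n))"
        using \<gamma> C34 h IH(2) by (intro step[OF _ _ _ S(2) _ loc(1)]) (auto simp: mult.assoc)
      ultimately show ?case by (simp only: t(4) mult.assoc simp_thms)
    qed
    have "C4 * h * (real n * h * (1 + S * h) ^ n) \<le> C4 * h * (T * exp (S * T))"
      using growth[OF n] C34 h by (intro mult_left_mono) auto
    also have "\<dots> \<le> sqrt h" using sq by (simp add: K_def mult_ac)
    also have "\<dots> \<le> 1" using h h0 by simp
    finally have b1: "C4 * h * (real n * h * (1 + S * h) ^ n) \<le> 1" .
    have "C3 * h\<^sup>2 * (real n * h * (1 + S * h) ^ n) \<le> C3 * h\<^sup>2 * (T * exp (S * T))"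
      using growth[OF n] C34 by (intro mult_left_mono) auto
    also have "\<dots> \<le> C * h\<^sup>2" by (simp add: C_def algebra_simps)
    finally have b2: "C3 * h\<^sup>2 * (real n * h * (1 + S * h) ^ n) \<le> C * h\<^sup>2" .
    show ?thesis
      using inv[OF n] Hs_le_weaken[OF _ order_refl b1] Hs_le_weaken[OF _ order_refl b2]
      by (auto simp: e_def[abs_def])
  qed
  then show ?thesis using h0 C by blast
qed

section \<open>Fourier series\<close>

abbreviation circ :: "real measure" where "circ \<equiv> lebesgue_on {0..2 * pi}"

definition l1 :: "seq \<Rightarrow> bool" where
  "l1 a \<longleftrightarrow> (\<lambda>l. cmod (a l)) summable_on UNIV"

definition trig :: "seq \<Rightarrow> real \<Rightarrow> complex" where
  "trig a x = (\<Sum>\<^sub>\<infinity>l. a l * cis (of_int l * x))"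

lemma l1_Hs_le: "Hs_le s A a \<Longrightarrow> 1 \<le> s \<Longrightarrow> l1 a"
  unfolding l1_def using Hs_le_l1(1) Hs_le_weaken by blast

lemma l1_bound: "l1 a \<Longrightarrow> (\<And>l. cmod (b l) \<le> K * cmod (a l)) \<Longrightarrow> l1 b"
  unfolding l1_def by (rule dominated_summable(1)[OF summable_on_cmult_right])

lemma l1_mult: "l1 a \<Longrightarrow> (\<And>l. cmod (m l) \<le> K) \<Longrightarrow> l1 (\<lambda>l. m l * a l)"
  by (erule l1_bound[where K = K]) (auto simp: norm_mult intro: mult_right_mono)

lemma l1_add: "l1 a \<Longrightarrow> l1 b \<Longrightarrow> l1 (\<lambda>l. a l + b l)"
  unfolding l1_def
  by (rule dominated_summable(1)[of "\<lambda>l. cmod (a l) + cmod (b l)"])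
     (auto intro: summable_on_add norm_triangle_ineq)

lemma l1_diff: "l1 a \<Longrightarrow> l1 b \<Longrightarrow> l1 (\<lambda>l. a l - b l)"
  unfolding l1_def
  by (rule dominated_summable(1)[of "\<lambda>l. cmod (a l) + cmod (b l)"])
     (auto intro: summable_on_add norm_triangle_ineq4)

lemma trig_summable: "l1 a \<Longrightarrow> (\<lambda>l. a l * cis (of_int l * x)) summable_on UNIV"
  unfolding l1_def by (erule dominated_summable(2)) (simp add: norm_mult)

lemma trig_norm_le: "l1 a \<Longrightarrow> cmod (trig a x) \<le> (\<Sum>\<^sub>\<infinity>l. cmod (a l))"
  unfolding l1_def trig_def by (erule dominated_summable(3)) (simp add: norm_mult)

lemma trig_add: "l1 a \<Longrightarrow> l1 b \<Longrightarrow> trig (\<lambda>l. a l + b l) x = trig a x + trig b x"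
  unfolding trig_def by (simp add: distrib_right infsum_add trig_summable)

lemma trig_diff: "l1 a \<Longrightarrow> l1 b \<Longrightarrow> trig (\<lambda>l. a l - b l) x = trig a x - trig b x"
  unfolding trig_def by (simp add: left_diff_distrib infsum_diff_complex trig_summable)

lemma trig_scale: "trig (\<lambda>l. c * a l) x = c * trig a x"
  unfolding trig_def by (simp add: mult.assoc infsum_cmult_right')

lemma trig_periodic: "trig a (x + 2 * pi) = trig a x"
proof -
  have "cis (of_int l * (x + 2 * pi)) = cis (of_int l * x)" for l
    by (simp add: distrib_left cis_mult[symmetric]) (metis cis_multiple_2pi Ints_of_int mult.commute mult.left_commute)
  then show ?thesis by (simp add: trig_def)
qed

lemma trig_uniform_limit:
  assumes "l1 a"
  shows "uniform_limit UNIV (\<lambda>K x. \<Sum>l\<in>K. a l * cis (of_int l * x)) (trig a) (finite_subsets_at_top UNIV)"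
  unfolding trig_def using assms unfolding l1_def
  by (intro Weierstrass_m_test_general[where M = "\<lambda>l. cmod (a l)"]) (auto simp: norm_mult)

lemma trig_continuous: "l1 a \<Longrightarrow> continuous_on S (trig a)"
  by (rule continuous_on_subset[OF uniform_limit_theorem[OF _ trig_uniform_limit]])
     (auto intro!: always_eventually continuous_intros)

section \<open>Fourier coefficients as integrals, and absolutely convergent series\<close>

lemma circ_integrable_continuous: "continuous_on {0..2 * pi} f \<Longrightarrow> integrable circ f" for f :: "real \<Rightarrow> complex"
  by (rule continuous_imp_integrable_real)

lemma circ_integrable_mult:
  fixes g h :: "real \<Rightarrow> complex"
  assumes h: "continuous_on {0..2 * pi} h" and g: "integrable circ g"
  shows "integrable circ (\<lambda>x. h x * g x)"
proof -
  have "bounded (h ` {0..2 * pi})"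
    by (intro compact_imp_bounded compact_continuous_image h) auto
  then obtain B where "\<forall>y\<in>h ` {0..2 * pi}. cmod y \<le> B"
    unfolding bounded_iff by (rule exE)
  then have B: "cmod (h x) \<le> B" if "x \<in> {0..2 * pi}" for x
    using that by (rule bspec[OF _ imageI])
  have hm: "h \<in> borel_measurable circ"
    by (rule continuous_imp_measurable_on_sets_lebesgue[OF h]) auto
  have le: "cmod (h x * g x) \<le> norm (\<bar>B\<bar> * cmod (g x))" if "x \<in> {0..2 * pi}" for x
    using mult_right_mono[OF order_trans[OF B[OF that] abs_ge_self], of "cmod (g x)"] by (simp add: norm_mult abs_mult)
  show ?thesis
  proof (rule Bochner_Integration.integrable_bound)
    show "integrable circ (\<lambda>x. \<bar>B\<bar> * cmod (g x))"
      using g by (intro integrable_mult_right integrable_norm)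
    show "(\<lambda>x. h x * g x) \<in> borel_measurable circ"
      by (intro borel_measurable_times hm borel_measurable_integrable[OF g])
    show "AE x in circ. cmod (h x * g x) \<le> norm (\<bar>B\<bar> * cmod (g x))"
      by (rule AE_I2) (simp only: space_lebesgue_on le)
  qed
qed

lemma fourier_coeff_eq: "fourier_coeff f l = (LINT x|circ. cis (- (of_int l * x)) * f x) / (2 * pi)"
  unfolding fourier_coeff_def of_real_divide of_real_1 by (simp only: times_divide_eq_left mult_1_left)

lemma circ_integrable_cis_mult: "integrable circ f \<Longrightarrow> integrable circ (\<lambda>x. cis (t * x) * f x)"
  by (intro circ_integrable_mult continuous_intros)

lemma circ_integrable_coeff: "integrable circ f \<Longrightarrow> integrable circ (\<lambda>x. cis (- (of_int l * x)) * f x)"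
  by (intro circ_integrable_mult continuous_intros)

lemma fourier_coeff_diff:
  assumes "integrable circ f" "integrable circ g"
  shows "fourier_coeff (\<lambda>x. f x - g x) l = fourier_coeff f l - fourier_coeff g l"
  unfolding fourier_coeff_eq
  using Bochner_Integration.integral_diff[OF circ_integrable_coeff[OF assms(1)] circ_integrable_coeff[OF assms(2)]]
  by (simp add: right_diff_distrib diff_divide_distrib)

lemma fourier_coeff_cong_AE:
  assumes "AE x in circ. f x = g x" "f \<in> borel_measurable circ" "g \<in> borel_measurable circ"
  shows "fourier_coeff f l = fourier_coeff g l"
proof -
  have "(\<lambda>x. cis (- (of_int l * x))) \<in> borel_measurable circ"
    by (rule continuous_imp_measurable_on_sets_lebesgue) (auto intro!: continuous_intros)
  then have "(LINT x|circ. cis (- (of_int l * x)) * f x) = (LINT x|circ. cis (- (of_int l * x)) * g x)"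
    using assms by (intro integral_cong_AE) (auto elim: AE_mp)
  then show ?thesis by (simp add: fourier_coeff_eq)
qed

lemma measure_circ: "measure circ {0..2 * pi} = 2 * pi"
  by (simp add: measure_restrict_space)

lemma integral_cis: "(LINT x|circ. cis (of_int k * x)) = (if k = 0 then 2 * pi else 0)"
proof (cases "k = 0")
  case True
  then show ?thesis using measure_circ by (simp add: scaleR_conv_of_real)
next
  case False
  let ?F = "\<lambda>x. cis (of_int k * x) / (\<i> * of_int k)"
  have d: "(?F has_vector_derivative cis (of_int k * x)) (at x within {0..2 * pi})" for x
  proof -
    define c where "c = \<i> * of_int k"
    have c: "c \<noteq> 0" using False by (simp add: c_def)
    have eq: "cis (of_int k * x) = exp (c * of_real x)" for x
      by (simp add: c_def cis_conv_exp mult_ac)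
    have "((\<lambda>z. exp (c * z)) has_field_derivative exp (c * w) * c) (at w)" for w
      by (auto intro!: derivative_eq_intros)
    from DERIV_cdivide[OF this, of c]
    have "((\<lambda>z. exp (c * z) / c) has_field_derivative exp (c * of_real x)) (at (of_real x))"
      using c by simp
    then show ?thesis
      unfolding eq c_def[symmetric]
      by (rule has_vector_derivative_at_within[OF has_vector_derivative_real_field])
  qed
  have "((\<lambda>x. cis (of_int k * x)) has_integral ?F (2 * pi) - ?F 0) {0..2 * pi}"
    by (rule fundamental_theorem_of_calculus[OF _ d]) simp
  moreover have "cis (of_int k * (2 * pi)) = 1"
    by (metis cis_multiple_2pi Ints_of_int mult.commute)
  ultimately have "((\<lambda>x. cis (of_int k * x)) has_integral 0) {0..2 * pi}" by simp
  then have "integral {0..2 * pi} (\<lambda>x. cis (of_int k * x)) = 0" by (rule integral_unique)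
  moreover have "integrable circ (\<lambda>x. cis (of_int k * x))"
    by (intro circ_integrable_continuous continuous_intros)
  ultimately show ?thesis using False
    by (simp add: lebesgue_integral_eq_integral)
qed

lemma norm_integral_circ_le:
  fixes f :: "real \<Rightarrow> complex"
  assumes "integrable circ f" "\<And>x. x \<in> {0..2 * pi} \<Longrightarrow> cmod (f x) \<le> B"
  shows "cmod (LINT x|circ. f x) \<le> 2 * pi * B"
proof -
  have "cmod (LINT x|circ. f x) \<le> (LINT x|circ. cmod (f x))" by (rule integral_norm_bound)
  also have "\<dots> \<le> (LINT x|circ. B)"
    using assms by (intro integral_mono) (auto intro!: continuous_imp_integrable_real continuous_intros)
  finally show ?thesis using measure_circ by simp
qed

text \<open>By orthogonality a partial sum that contains the mode \<open>l\<close> has the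
  coefficient \<open>a l\<close>. It is uniformly within \<open>e / 2\<close> of the series, so the
  coefficient of the series cannot be off by \<open>e\<close>.\<close>

lemma fourier_coeff_trig:
  assumes a: "l1 a"
  shows "fourier_coeff (trig a) l = a l"
proof (rule ccontr)
  assume neq: "fourier_coeff (trig a) l \<noteq> a l"
  define e where "e = cmod (fourier_coeff (trig a) l - a l)"
  have e: "0 < e" using neq by (simp add: e_def)
  have "\<forall>\<^sub>F K in finite_subsets_at_top UNIV. \<forall>x\<in>UNIV. dist (\<Sum>l\<in>K. a l * cis (of_int l * x)) (trig a x) < e / 2"
    using trig_uniform_limit[OF a] e unfolding uniform_limit_iff by (auto dest: spec[of _ "e / 2"])
  then obtain K0 where K0: "finite K0" "\<And>K x. finite K \<Longrightarrow> K0 \<subseteq> K \<Longrightarrow> dist (\<Sum>l\<in>K. a l * cis (of_int l * x)) (trig a x) < e / 2"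
    unfolding eventually_finite_subsets_at_top by auto
  define K where "K = insert l K0"
  have K: "finite K" "l \<in> K" using K0(1) by (auto simp: K_def)
  define p where "p x = (\<Sum>m\<in>K. a m * cis (of_int m * x))" for x
  have near: "cmod (trig a x - p x) \<le> e / 2" for x
  proof -
    have "K0 \<subseteq> K" by (auto simp: K_def)
    from K0(2)[OF K(1) this, of x] show ?thesis by (simp add: p_def dist_norm norm_minus_commute)
  qed
  have ip: "integrable circ p"
    unfolding p_def by (intro circ_integrable_continuous continuous_intros)
  have it: "integrable circ (trig a)" by (intro circ_integrable_continuous trig_continuous a)
  have "fourier_coeff p l = (\<Sum>m\<in>K. a m * (LINT x|circ. cis (of_int (m - l) * x))) / (2 * pi)"
  proof -
    have "cis (- (of_int l * x)) * p x = (\<Sum>m\<in>K. a m * cis (of_int (m - l) * x))" for x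
      unfolding p_def sum_distrib_left
      by (intro sum.cong refl) (simp add: cis_mult algebra_simps)
    then show ?thesis unfolding fourier_coeff_eq
      by (simp add: Bochner_Integration.integral_sum circ_integrable_continuous continuous_intros del: of_int_diff)
  qed
  also have "(\<Sum>m\<in>K. a m * (LINT x|circ. cis (of_int (m - l) * x))) = (\<Sum>m\<in>K. if m = l then a l * (2 * pi) else 0)"
    by (intro sum.cong refl) (simp add: integral_cis del: of_int_diff)
  also have "\<dots> / (2 * pi) = a l" using K by simp
  finally have "fourier_coeff (trig a) l - a l = fourier_coeff (\<lambda>x. trig a x - p x) l"
    using fourier_coeff_diff[OF it ip] by simp
  then have "e = cmod (LINT x|circ. cis (- (of_int l * x)) * (trig a x - p x)) / (2 * pi)"
    by (simp add: e_def fourier_coeff_eq norm_divide norm_mult)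
  also have "\<dots> \<le> (2 * pi * (e / 2)) / (2 * pi)"
    using near by (intro divide_right_mono norm_integral_circ_le circ_integrable_coeff Bochner_Integration.integrable_diff it ip)
      (auto simp: norm_mult)
  finally show False using e by simp
qed

text \<open>The Cauchy product: pairs of frequencies \<open>(k, m)\<close> are counted by their sum
  \<open>l = k + m\<close> and by \<open>k\<close>, and absolute convergence allows the
  rearrangement.\<close>

lemma trig_mult:
  assumes a: "l1 a" and b: "l1 b"
  shows "trig a x * trig b x = trig (conv a b) x" "l1 (conv a b)"
proof -
  define f where "f = (\<lambda>(l, k). a k * b (l - k))"
  have "(\<lambda>(k, m). cmod (a k) * cmod (b m)) summable_on UNIV \<times> UNIV"
    using a b unfolding l1_def
    by (intro summable_on_SigmaI[where g = "\<lambda>k. cmod (a k) * (\<Sum>\<^sub>\<infinity>m. cmod (b m))"])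
       (auto intro!: has_sum_cmult_right summable_on_cmult_left has_sum_infsum)
  moreover have bij: "bij (\<lambda>(l, k). (k, l - k :: int))"
    by (rule bij_betwI[where g = "\<lambda>(k, m). (k + m, k)"]) auto
  ultimately have fs: "(\<lambda>z. cmod (f z)) summable_on UNIV"
    using summable_on_reindex_bij_betw[OF bij, of "\<lambda>(k, m). cmod (a k) * cmod (b m)"]
    by (simp add: f_def case_prod_unfold norm_mult)
  have inner: "(\<Sum>\<^sub>\<infinity>k. f (l, k)) = conv a b l" for l by (simp add: f_def conv_def bil_def)
  have "(\<lambda>l. \<Sum>\<^sub>\<infinity>k. cmod (f (l, k))) summable_on UNIV"
    using summable_on_Sigma_banach[of "\<lambda>l k. cmod (f (l, k))" UNIV "\<lambda>_. UNIV"] fs by (simp add: case_prod_unfold)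
  moreover have "cmod (conv a b l) \<le> (\<Sum>\<^sub>\<infinity>k. cmod (f (l, k)))" for l
  proof -
    have "(\<lambda>k. cmod (f (l, k))) summable_on UNIV"
      using summable_on_SigmaD1[of "\<lambda>l k. cmod (f (l, k))" UNIV "\<lambda>_. UNIV" l] fs by (simp add: case_prod_unfold)
    then show ?thesis unfolding inner[symmetric] by (rule dominated_summable(3)) simp
  qed
  ultimately show "l1 (conv a b)" unfolding l1_def by (rule dominated_summable(1))
  define g where "g = (\<lambda>(l, k). f (l, k) * cis (of_int l * x))"
  have gs: "g summable_on UNIV"
    by (rule dominated_summable(2)[OF fs]) (auto simp: g_def norm_mult)
  define h where "h = (\<lambda>(k, m). a k * cis (of_int k * x) * (b m * cis (of_int m * x)))"
  have hg: "h (case z of (l, k) \<Rightarrow> (k, l - k)) = g z" for z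
  proof (cases z)
    case (Pair l k)
    have "cis (of_int k * x) * cis (of_int (l - k) * x) = cis (of_int l * x)"
      by (simp add: cis_mult left_diff_distrib)
    then show ?thesis unfolding Pair h_def g_def f_def prod.case
      by (metis (no_types, opaque_lifting) mult.assoc mult.commute)
  qed
  have hs: "h summable_on UNIV"
    using gs summable_on_reindex_bij_betw[OF bij, of h] by (simp add: hg)
  have "trig a x * trig b x = (\<Sum>\<^sub>\<infinity>k. a k * cis (of_int k * x) * trig b x)"
    unfolding trig_def[of a] by (simp add: infsum_cmult_left')
  also have "\<dots> = (\<Sum>\<^sub>\<infinity>k. \<Sum>\<^sub>\<infinity>m. a k * cis (of_int k * x) * (b m * cis (of_int m * x)))"
    unfolding trig_def[of b] by (simp add: infsum_cmult_right')
  also have "\<dots> = infsum h UNIV"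
    using infsum_Sigma_banach[of h UNIV "\<lambda>_. UNIV"] hs by (simp add: h_def)
  also have "\<dots> = infsum g UNIV"
    using infsum_reindex_bij_betw[OF bij, of h] by (simp add: hg)
  also have "\<dots> = (\<Sum>\<^sub>\<infinity>l. \<Sum>\<^sub>\<infinity>k. g (l, k))"
    using infsum_Sigma_banach[of g UNIV "\<lambda>_. UNIV"] gs by simp
  also have "\<dots> = trig (conv a b) x"
    unfolding trig_def inner[symmetric] by (simp add: g_def infsum_cmult_left')
  finally show "trig a x * trig b x = trig (conv a b) x" .
qed

lemma trig_has_vector_derivative:
  assumes a: "l1 a" and la: "l1 (\<lambda>l. of_int l * a l)"
  shows "(trig a has_vector_derivative trig (\<lambda>l. \<i> * of_int l * a l) x) (at x)"
  unfolding trig_def[abs_def]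
proof (rule has_vector_derivative_infsum[of UNIV, simplified])
  show "((\<lambda>x. a l * cis (of_int l * x)) has_vector_derivative \<i> * of_int l * a l * cis (of_int l * x)) (at x)" for l x
  proof -
    have eq: "cis (of_int l * x) = exp (\<i> * of_int l * of_real x)" for x
      by (simp add: cis_conv_exp mult_ac)
    show ?thesis unfolding eq
      by (rule has_vector_derivative_real_field) (auto intro!: derivative_eq_intros)
  qed
  show "(\<lambda>l. cmod (of_int l * a l)) summable_on UNIV" using la by (simp add: l1_def)
qed (auto simp: norm_mult trig_summable[OF a])

section \<open>Uniqueness of Fourier coefficients\<close>

text \<open>
  Testing against all frequencies at once makes the property stable under multiplication by
  polynomials in \<open>cis x\<close>.
\<close>

definition test_fun :: "(real \<Rightarrow> complex) \<Rightarrow> (real \<Rightarrow> complex) \<Rightarrow> bool" where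
  "test_fun g h \<longleftrightarrow> continuous_on UNIV h \<and> (\<forall>l::int. (LINT x|circ. cis (of_int l * x) * (h x * g x)) = 0)"

lemma circ_integrable_mult_UNIV:
  fixes g h :: "real \<Rightarrow> complex"
  shows "continuous_on UNIV h \<Longrightarrow> integrable circ g \<Longrightarrow> integrable circ (\<lambda>x. h x * g x)"
  by (rule circ_integrable_mult) (auto elim: continuous_on_subset)

lemma test_fun_polynomial:
  assumes g: "integrable circ g" and p: "real_polynomial_function p" and h: "test_fun g h"
  shows "test_fun g (\<lambda>x. of_real (p (cis x)) * h x)"
  using p h
proof (induction p arbitrary: h rule: real_polynomial_function.induct)
  case (linear f)
  \<comment> \<open>Euler's formula turns \<open>cos x * f 1 + sin x * f \<i>\<close> into a
    combination of \<open>cis x\<close> and \<open>cis (- x)\<close>, so a linear factor only shifts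
    the tested frequency by one.\<close>
  define c d where "c = Complex (f 1 / 2) (- f \<i> / 2)" and "d = Complex (f 1 / 2) (f \<i> / 2)"
  have f: "complex_of_real (f (cis x)) = c * cis x + d * cis (- x)" for x
  proof -
    have "f (cis x) = f (cos x *\<^sub>R 1 + sin x *\<^sub>R \<i>)"
      by (rule arg_cong[where f = f]) (simp add: complex_eq_iff)
    also have "\<dots> = cos x * f 1 + sin x * f \<i>"
      using linear(1) by (simp add: bounded_linear.linear linear_add linear_cmul)
    finally show ?thesis by (simp add: c_def d_def complex_eq_iff)
  qed
  note h = linear(2)[unfolded test_fun_def]
  have int: "integrable circ (\<lambda>x. cis (of_int l * x) * (h x * g x))" for l
    using h g by (intro circ_integrable_cis_mult circ_integrable_mult_UNIV) auto
  have "(LINT x|circ. cis (of_int l * x) * (of_real (f (cis x)) * h x * g x)) = 0" for l :: int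
  proof -
    have "cis (of_int l * x) * (of_real (f (cis x)) * h x * g x)
        = c * (cis (of_int (l + 1) * x) * (h x * g x)) + d * (cis (of_int (l - 1) * x) * (h x * g x))" for x
    proof -
      have "cis (of_int (l + 1) * x) = cis (of_int l * x) * cis x" "cis (of_int (l - 1) * x) = cis (of_int l * x) * cis (- x)"
        unfolding cis_mult by (simp_all add: algebra_simps)
      then show ?thesis unfolding f by (simp add: algebra_simps)
    qed
    then have "(LINT x|circ. cis (of_int l * x) * (of_real (f (cis x)) * h x * g x))
       = (LINT x|circ. c * (cis (of_int (l + 1) * x) * (h x * g x)) + d * (cis (of_int (l - 1) * x) * (h x * g x)))"
      by presburger
    also have "\<dots> = (LINT x|circ. c * (cis (of_int (l + 1) * x) * (h x * g x))) + (LINT x|circ. d * (cis (of_int (l - 1) * x) * (h x * g x)))"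
      by (intro Bochner_Integration.integral_add integrable_mult_right int)
    also have "\<dots> = 0"
      using h by (simp only: integral_mult_right_zero mult_zero_right add_0)
    finally show ?thesis .
  qed
  moreover have "continuous_on UNIV (\<lambda>x. of_real (f (cis x)) * h x)"
    unfolding f using h by (intro continuous_intros) auto
  ultimately show ?case by (simp only: test_fun_def simp_thms)
next
  case (const c)
  have "cis (of_int l * x) * (of_real c * h x * g x) = of_real c * (cis (of_int l * x) * (h x * g x))" for l :: int and x
    by (simp only: mult_ac)
  then show ?case
    using const unfolding test_fun_def by (auto intro!: continuous_intros simp only: integral_mult_right_zero mult_zero_right)
next
  case (add p q)
  note h = add.IH(1)[OF add.prems, unfolded test_fun_def] add.IH(2)[OF add.prems, unfolded test_fun_def]
  have int: "integrable circ (\<lambda>x. cis (of_int l * x) * (of_real (p (cis x)) * h x * g x))"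
    "integrable circ (\<lambda>x. cis (of_int l * x) * (of_real (q (cis x)) * h x * g x))" for l
    using h g by (intro circ_integrable_cis_mult circ_integrable_mult_UNIV; blast)+
  have "(LINT x|circ. cis (of_int l * x) * (of_real (p (cis x) + q (cis x)) * h x * g x)) = 0" for l :: int
  proof -
    have "(LINT x|circ. cis (of_int l * x) * (of_real (p (cis x) + q (cis x)) * h x * g x))
       = (LINT x|circ. cis (of_int l * x) * (of_real (p (cis x)) * h x * g x) + cis (of_int l * x) * (of_real (q (cis x)) * h x * g x))"
      by (simp only: of_real_add distrib_left distrib_right)
    also have "\<dots> = 0"
      using h by (simp only: Bochner_Integration.integral_add int add_0)
    finally show ?thesis .
  qed
  moreover have "continuous_on UNIV (\<lambda>x. of_real (p (cis x)) * h x + of_real (q (cis x)) * h x)"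
    using h by (intro continuous_on_add) auto
  ultimately show ?case by (simp only: test_fun_def of_real_add distrib_right simp_thms)
next
  case (mult p q)
  then have "test_fun g (\<lambda>x. of_real (p (cis x)) * (of_real (q (cis x)) * h x))" by blast
  then show ?case by (simp only: of_real_mult mult.assoc)
qed

text \<open>Composition with \<open>cis\<close> builds in periodicity, so Stone-Weierstrass applies
  on the unit circle. Polynomials have integral zero against \<open>g\<close>, and the error of the
  approximation is controlled by the \<open>L^1\<close> norm of \<open>g\<close>.\<close>

lemma integral_continuous_circle_eq_0:
  fixes \<phi> :: "complex \<Rightarrow> real"
  assumes g: "integrable circ g" and g0: "\<And>l. fourier_coeff g l = 0" and \<phi>: "continuous_on UNIV \<phi>"
  shows "(LINT x|circ. of_real (\<phi> (cis x)) * g x) = 0"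
proof -
  have one: "test_fun g (\<lambda>_. 1)"
    unfolding test_fun_def
  proof (intro conjI allI)
    fix l :: int
    have "(LINT x|circ. cis (of_int l * x) * g x) = 0"
      using g0[of "- l"] by (simp add: fourier_coeff_eq)
    then show "(LINT x|circ. cis (of_int l * x) * (1 * g x)) = 0" by simp
  qed (rule continuous_on_const)
  have ig: "integrable circ (\<lambda>x. of_real (\<phi> (cis x)) * g x)"
    using \<phi> g by (intro circ_integrable_mult_UNIV continuous_intros continuous_on_compose2[OF \<phi>]) auto
  have "cmod (LINT x|circ. of_real (\<phi> (cis x)) * g x) \<le> e * (LINT x|circ. cmod (g x))" if e: "0 < e" for e
  proof -
    obtain p where p: "real_polynomial_function p" "\<And>z. z \<in> sphere 0 1 \<Longrightarrow> \<bar>\<phi> z - p z\<bar> < e"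
      using Stone_Weierstrass_real_polynomial_function[of "sphere (0::complex) 1" \<phi> e] \<phi> e
      by (auto intro: continuous_on_subset)
    have t: "test_fun g (\<lambda>x. of_real (p (cis x)) * 1)" by (rule test_fun_polynomial[OF g p(1) one])
    then have ip: "integrable circ (\<lambda>x. of_real (p (cis x)) * g x)"
      using circ_integrable_mult_UNIV[OF _ g] by (simp add: test_fun_def)
    have "(LINT x|circ. cis (of_int 0 * x) * (of_real (p (cis x)) * 1 * g x)) = 0"
      using t unfolding test_fun_def by blast
    then have p0: "(LINT x|circ. of_real (p (cis x)) * g x) = 0" by simp
    have "(LINT x|circ. of_real (\<phi> (cis x)) * g x) = (LINT x|circ. of_real (\<phi> (cis x)) * g x - of_real (p (cis x)) * g x)"
      by (simp only: Bochner_Integration.integral_diff[OF ig ip] p0 diff_zero)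
    also have "cmod \<dots> \<le> (LINT x|circ. cmod (of_real (\<phi> (cis x)) * g x - of_real (p (cis x)) * g x))"
      by (rule integral_norm_bound)
    also have "\<dots> \<le> (LINT x|circ. e * cmod (g x))"
    proof (rule integral_mono)
      show "cmod (of_real (\<phi> (cis x)) * g x - of_real (p (cis x)) * g x) \<le> e * cmod (g x)" for x
      proof -
        have "cmod (of_real (\<phi> (cis x)) * g x - of_real (p (cis x)) * g x) = \<bar>\<phi> (cis x) - p (cis x)\<bar> * cmod (g x)"
          by (simp only: left_diff_distrib[symmetric] norm_mult of_real_diff[symmetric] norm_of_real)
        then show ?thesis using p(2)[of "cis x"] by (simp add: mult_right_mono)
      qed
    qed (use ig ip g in auto)
    also have "\<dots> = e * (LINT x|circ. cmod (g x))" by (rule integral_mult_right_zero)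
    finally show ?thesis .
  qed
  then have le: "cmod (LINT x|circ. of_real (\<phi> (cis x)) * g x) \<le> e * (LINT x|circ. cmod (g x))" if "0 < e" for e
    using that by blast
  define N where "N = (LINT x|circ. cmod (g x))"
  have N: "0 \<le> N" unfolding N_def by (rule Bochner_Integration.integral_nonneg) simp
  have "cmod (LINT x|circ. of_real (\<phi> (cis x)) * g x) \<le> 0 + e" if "0 < e" for e
  proof -
    have "e / (N + 1) * N \<le> e" using N that by (simp add: field_simps)
    then show ?thesis using le[of "e / (N + 1)"] N that unfolding N_def[symmetric] by (simp add: add_nonneg_pos)
  qed
  then have "cmod (LINT x|circ. of_real (\<phi> (cis x)) * g x) \<le> 0" by (rule field_le_epsilon)
  then show ?thesis by simp
qed

lemma AE_circ_neq: "AE x in circ. x \<noteq> c"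
proof -
  have "AE x in lebesgue. x \<noteq> c" by (rule AE_completion[OF AE_lborel_singleton])
  then show ?thesis by (subst AE_restrict_space_iff) (auto elim: AE_mp)
qed

text \<open>The indicator of \<open>K\<close> is the limit of the functions
  \<open>max 0 (1 - n * dist)\<close> on the circle. \<open>K\<close> avoids both end points, so
  that \<open>cis\<close> does not glue it to any other point of the interval.\<close>

lemma integral_compact_eq_0:
  assumes g: "integrable circ g" and g0: "\<And>l. fourier_coeff g l = 0" and K: "compact K" "K \<subseteq> {0<..<2 * pi}"
  shows "(LINT x|circ. of_real (indicator K x) * g x) = 0"
proof (cases "K = {}")
  case False
  define \<phi> where "\<phi> n z = max 0 (1 - real n * infdist z (cis ` K))" for n z
  have cK: "compact (cis ` K)" by (intro compact_continuous_image continuous_intros K)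
  have ne: "cis ` K \<noteq> {}" using False by auto
  have \<phi>: "continuous_on UNIV (\<phi> n)" for n unfolding \<phi>_def by (intro continuous_intros)
  have lim: "(\<lambda>n. \<phi> n (cis x)) \<longlonglongrightarrow> indicator K x" if x: "x \<in> {0..2 * pi}" "x \<noteq> 2 * pi" for x
  proof (cases "x \<in> K")
    case True
    then have "\<phi> n (cis x) = 1" for n by (simp add: \<phi>_def)
    then show ?thesis using True by simp
  next
    case notin: False
    have "cis x \<notin> cis ` K"
    proof
      assume "cis x \<in> cis ` K"
      then obtain y where y: "y \<in> K" "cis x = cis y" by auto
      have "Arg2pi (cis z) = z" if "0 \<le> z" "z < 2 * pi" for z
        using that by (intro Arg2pi_unique[of 1]) (auto simp: cis_conv_exp)
      then have "x = y"
        using x y K(2) by (metis atLeastAtMost_iff greaterThanLessThan_iff less_eq_real_def subsetD)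
      then show False using y notin by simp
    qed
    then have pos: "0 < infdist (cis x) (cis ` K)"
      using infdist_pos_not_in_closed[OF compact_imp_closed[OF cK] ne] by simp
    obtain m :: nat where m: "1 < real m * infdist (cis x) (cis ` K)"
      using reals_Archimedean3[OF pos] by blast
    have "\<phi> n (cis x) = 0" if "m \<le> n" for n
    proof -
      have "real m * infdist (cis x) (cis ` K) \<le> real n * infdist (cis x) (cis ` K)"
        using that pos by (intro mult_right_mono) auto
      then show ?thesis using m by (simp add: \<phi>_def)
    qed
    then show ?thesis using notin
      by (intro tendsto_eventually) (auto simp: eventually_sequentially)
  qed
  have "AE x in circ. x \<noteq> 2 * pi" by (rule AE_circ_neq)
  then have aelim: "AE x in circ. (\<lambda>n. of_real (\<phi> n (cis x)) * g x) \<longlonglongrightarrow> of_real (indicator K x) * g x"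
    by (rule AE_mp) (rule AE_I2, auto intro!: tendsto_intros lim)
  have "(\<lambda>n. LINT x|circ. of_real (\<phi> n (cis x)) * g x) \<longlonglongrightarrow> (LINT x|circ. of_real (indicator K x) * g x)"
  proof (rule integral_dominated_convergence[OF _ _ _ aelim])
    have "K \<in> sets circ"
      using K lmeasurable_compact[OF K(1)] by (auto simp: sets_restrict_space image_iff fmeasurable_def intro!: bexI[of _ K])
    then have "(\<lambda>x. complex_of_real (indicator K x)) \<in> borel_measurable circ"
      by (intro measurable_compose[OF borel_measurable_indicator borel_measurable_continuous_onI[OF continuous_on_of_real[OF continuous_on_id]]])
    then show "(\<lambda>x. of_real (indicator K x) * g x) \<in> borel_measurable circ"
      by (rule borel_measurable_times[OF _ borel_measurable_integrable[OF g]])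
    show "(\<lambda>x. of_real (\<phi> n (cis x)) * g x) \<in> borel_measurable circ" for n
      by (intro borel_measurable_integrable circ_integrable_mult_UNIV g continuous_intros continuous_on_compose2[OF \<phi>]) auto
    show "AE x in circ. norm (of_real (\<phi> n (cis x)) * g x) \<le> cmod (g x)" for n
    proof (rule AE_I2)
      fix x
      have "0 \<le> \<phi> n (cis x)" "\<phi> n (cis x) \<le> 1"
        by (auto simp: \<phi>_def infdist_nonneg)
      then show "norm (of_real (\<phi> n (cis x)) * g x) \<le> cmod (g x)"
        by (simp add: norm_mult mult_left_le_one_le)
    qed
  qed (use g in auto)
  then have "(\<lambda>n. 0) \<longlonglongrightarrow> (LINT x|circ. of_real (indicator K x) * g x)"
    by (simp only: integral_continuous_circle_eq_0[OF g g0 \<phi>])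
  then show ?thesis by (simp only: LIMSEQ_const_iff)
qed simp

text \<open>Inner regularity: a compact \<open>K\<close> inside the set where \<open>r > 0\<close>
  exhausts that set up to measure \<open>e\<close>. The integral of the positive function over
  \<open>K\<close> is 0, so \<open>K\<close> is a null set, and the whole set has measure at most
  \<open>e\<close>.\<close>

lemma AE_nonpos_of_compact_integrals:
  fixes r :: "real \<Rightarrow> real"
  assumes r: "integrable circ r"
    and zero: "\<And>K. compact K \<Longrightarrow> K \<subseteq> {0<..<2 * pi} \<Longrightarrow> (LINT x|circ. indicator K x * r x) = 0"
  shows "AE x in circ. r x \<le> 0"
proof -
  define A where "A = {x \<in> {0<..<2 * pi}. 0 < r x}"
  have "{x \<in> space circ. 0 < r x} \<in> sets circ"
    using borel_measurable_integrable[OF r] by measurable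
  then have B: "{x \<in> {0..2 * pi}. 0 < r x} \<in> sets lebesgue"
    by (simp add: sets_restrict_space_iff)
  have Aeq: "A = {x \<in> {0..2 * pi}. 0 < r x} \<inter> {0<..<2 * pi}" by (auto simp: A_def)
  have A: "A \<in> sets lebesgue"
    unfolding Aeq by (rule sets.Int[OF B]) simp
  have "emeasure lebesgue A \<le> ennreal e" if e: "0 < e" for e
  proof -
    obtain K where K: "closed K" "K \<subseteq> A" "A - K \<in> lmeasurable" "emeasure lebesgue (A - K) < ennreal e"
      using sets_lebesgue_inner_closed[OF A e] by blast
    have KI: "K \<subseteq> {0<..<2 * pi}" using K(2) by (auto simp: A_def)
    have "bounded K" by (rule bounded_subset[OF bounded_box[of 0 "2 * pi"]]) (use KI in auto)
    then have cK: "compact K" using K(1) by (simp add: compact_eq_bounded_closed)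
    have Kl: "K \<in> sets lebesgue" using K(1) by auto
    have Kc: "K \<in> sets circ"
      using KI Kl by (auto simp: sets_restrict_space_iff)
    have ae: "AE x in circ. indicator K x * r x = 0"
    proof (rule integral_nonneg_eq_0_iff_AE[THEN iffD1, OF _ _ zero[OF cK KI]])
      show "integrable circ (\<lambda>x. indicator K x * r x)"
        using integrable_mult_indicator[OF Kc r] by simp
      show "AE x in circ. 0 \<le> indicator K x * r x"
        using K(2) by (intro AE_I2) (auto simp: A_def indicator_def)
    qed
    have "AE x in circ. x \<notin> K"
      using ae by (rule AE_mp) (rule AE_I2, use K(2) in \<open>auto simp: A_def indicator_def\<close>)
    then have "AE x in lebesgue. x \<in> {0..2 * pi} \<longrightarrow> x \<notin> K"
      by (subst (asm) AE_restrict_space_iff) auto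
    then have "AE x in lebesgue. x \<notin> K"
      by (rule eventually_mono) (use KI in fastforce)
    then have "K \<in> null_sets lebesgue"
      using AE_iff_null_sets[OF Kl] by blast
    then have "emeasure lebesgue A = emeasure lebesgue (A - K)"
      using emeasure_Diff_null_set[of K lebesgue A] A by simp
    then show ?thesis using K(4) by simp
  qed
  then have "emeasure lebesgue A \<le> 0 + ennreal e" if "0 < e" for e using that by simp
  then have "emeasure lebesgue A \<le> 0" by (rule ennreal_le_epsilon)
  then have "A \<in> null_sets lebesgue" using A by (simp add: null_sets_def)
  then have "AE x in lebesgue. x \<notin> A" by (rule AE_not_in)
  then have "AE x in circ. x \<notin> A"
    by (subst AE_restrict_space_iff) (auto elim: AE_mp)
  moreover note AE_circ_neq[of 0] AE_circ_neq[of "2 * pi"] AE_space[of circ]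
  ultimately show ?thesis
  proof eventually_elim
  qed (auto simp: A_def)
qed

text \<open>The hypotheses are invariant under multiplication by constants, so the one-sided
  criterion applies to the real parts of \<open>g\<close>, \<open>-g\<close>,
  \<open>\<i> * g\<close> and \<open>- \<i> * g\<close>.\<close>

lemma fourier_uniqueness:
  assumes g: "integrable circ g" and g0: "\<And>l. fourier_coeff g l = 0"
  shows "AE x in circ. g x = 0"
proof -
  have *: "AE x in circ. Re (c * g x) \<le> 0" for c
  proof (rule AE_nonpos_of_compact_integrals)
    show "integrable circ (\<lambda>x. Re (c * g x))"
      using g by (intro integrable_Re integrable_mult_right)
    fix K :: "real set" assume K: "compact K" "K \<subseteq> {0<..<2 * pi}"
    have "(LINT x|circ. indicator K x * Re (c * g x)) = (LINT x|circ. Re (c * (of_real (indicator K x) * g x)))"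
      by (rule Bochner_Integration.integral_cong) (auto simp: indicator_def)
    also have "\<dots> = Re (LINT x|circ. c * (of_real (indicator K x) * g x))"
    proof (rule integral_Re)
      have "K \<in> sets lebesgue" using lmeasurable_compact[OF K(1)] by (auto simp: fmeasurable_def)
      then have "K \<in> sets circ" using K by (auto simp: sets_restrict_space_iff)
      from integrable_mult_indicator[OF this g]
      show "integrable circ (\<lambda>x. c * (of_real (indicator K x) * g x))"
        by (intro integrable_mult_right) (simp add: scaleR_conv_of_real)
    qed
    also have "\<dots> = Re (c * (LINT x|circ. of_real (indicator K x) * g x))"
      by (simp only: integral_mult_right_zero)
    also have "\<dots> = 0" by (simp only: integral_compact_eq_0[OF g g0 K] mult_zero_right zero_complex.sel)
    finally show "(LINT x|circ. indicator K x * Re (c * g x)) = 0" .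
  qed
  have "AE x in circ. Re (1 * g x) \<le> 0 \<and> Re (- 1 * g x) \<le> 0 \<and> Re (\<i> * g x) \<le> 0 \<and> Re (- \<i> * g x) \<le> 0"
    by (intro AE_conjI *)
  then show ?thesis by (rule eventually_mono) (auto simp: complex_eq_iff)
qed

section \<open>Sobolev functions and their Fourier series\<close>

lemma sobolev_norm_bound:
  assumes "Hs_le s A (fourier_coeff f)"
  shows "Hs_le s (sobolev_norm s f) (fourier_coeff f)" "sobolev_norm s f \<le> A"
proof -
  have A: "0 \<le> A" using assms Hs_le_nonneg by blast
  note A1 = assms[unfolded Hs_le_iff_infsum[OF A]]
  have n: "0 \<le> sobolev_norm s f" by (simp add: sobolev_norm_def infsum_nonneg)
  show "Hs_le s (sobolev_norm s f) (fourier_coeff f)"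
    unfolding Hs_le_iff_infsum[OF n] using A1 by (simp add: sobolev_norm_def infsum_nonneg)
  show "sobolev_norm s f \<le> A"
    unfolding sobolev_norm_def using A1 A by (intro real_le_lsqrt) auto
qed

lemma sobolevD:
  assumes f: "f \<in> sobolev s"
  shows "f (x + 2 * pi) = f x" "f \<in> borel_measurable circ" "integrable circ (\<lambda>x. (cmod (f x))\<^sup>2)"
    and "Hs_le s (sobolev_norm s f) (fourier_coeff f)" "integrable circ f"
proof -
  show "f (x + 2 * pi) = f x" and m: "f \<in> borel_measurable circ" and i: "integrable circ (\<lambda>x. (cmod (f x))\<^sup>2)"
    using f unfolding sobolev_def by blast+
  have sm: "(\<lambda>l. (J l powr s * cmod (fourier_coeff f l))\<^sup>2) summable_on UNIV"
    using f unfolding sobolev_def by blast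
  have n: "0 \<le> sobolev_norm s f" by (simp add: sobolev_norm_def infsum_nonneg)
  show "Hs_le s (sobolev_norm s f) (fourier_coeff f)"
    unfolding Hs_le_iff_infsum[OF n] using sm by (simp add: sobolev_norm_def infsum_nonneg)
  have i1: "integrable circ (\<lambda>x. 1 + (cmod (f x))\<^sup>2)"
    by (intro Bochner_Integration.integrable_add i continuous_imp_integrable_real continuous_intros)
  show "integrable circ f"
  proof (rule Bochner_Integration.integrable_bound[OF i1 m], rule AE_I2)
    fix x
    have "0 \<le> (cmod (f x) - 1)\<^sup>2" by simp
    then have "2 * cmod (f x) \<le> (cmod (f x))\<^sup>2 + 1" by (simp add: power2_diff)
    then have "cmod (f x) \<le> 1 + (cmod (f x))\<^sup>2"
      using norm_ge_zero[of "f x"] zero_le_power2[of "cmod (f x)"] by linarith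
    then show "norm (f x) \<le> norm (1 + (cmod (f x))\<^sup>2)" by simp
  qed
qed

lemma sobolev_AE_trig:
  assumes f: "f \<in> sobolev s" and s: "1 \<le> s"
  shows "AE x in circ. f x = trig (fourier_coeff f) x"
proof -
  note D = sobolevD[OF f]
  have l: "l1 (fourier_coeff f)" by (rule l1_Hs_le[OF D(4) s])
  have it: "integrable circ (trig (fourier_coeff f))"
    by (intro circ_integrable_continuous trig_continuous l)
  have "AE x in circ. f x - trig (fourier_coeff f) x = 0"
    by (rule fourier_uniqueness)
       (simp_all add: D(5) it fourier_coeff_diff[OF D(5) it] fourier_coeff_trig[OF l] Bochner_Integration.integrable_diff)
  then show ?thesis by (rule eventually_mono) simp
qed

lemma fourier_coeff_trig_square:
  assumes "l1 a"
  shows "fourier_coeff (\<lambda>x. (trig a x)\<^sup>2) = conv a a"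
  using fourier_coeff_trig[OF trig_mult(2)[OF assms assms]]
  by (auto simp: power2_eq_square trig_mult(1)[OF assms assms])

lemma fourier_coeff_square:
  assumes f: "f \<in> sobolev s" and s: "1 \<le> s"
  shows "fourier_coeff (\<lambda>x. (f x)\<^sup>2) = conv (fourier_coeff f) (fourier_coeff f)"
proof -
  have l: "l1 (fourier_coeff f)" by (rule l1_Hs_le[OF sobolevD(4)[OF f] s])
  have "trig (fourier_coeff f) \<in> borel_measurable circ"
    by (intro borel_measurable_integrable circ_integrable_continuous trig_continuous l)
  then have "fourier_coeff (\<lambda>x. (f x)\<^sup>2) l = fourier_coeff (\<lambda>x. (trig (fourier_coeff f) x)\<^sup>2) l" for l
    using sobolev_AE_trig[OF f s] sobolevD(2)[OF f]
    by (intro fourier_coeff_cong_AE borel_measurable_power) (auto elim: eventually_mono)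
  then show ?thesis using fourier_coeff_trig_square[OF l] by (simp add: fun_eq_iff)
qed

text \<open>Two continuous functions that agree almost everywhere differ on an open null set, which
  is empty. Closure and periodicity carry the equality from the open interval to the line.\<close>

lemma sobolev_continuous_eq_trig:
  assumes f: "f \<in> sobolev s" and s: "1 \<le> s" and cont: "continuous_on UNIV f"
  shows "f x = trig (fourier_coeff f) x"
proof -
  let ?g = "\<lambda>x. f x - trig (fourier_coeff f) x"
  have l: "l1 (fourier_coeff f)" by (rule l1_Hs_le[OF sobolevD(4)[OF f] s])
  have gc: "continuous_on S ?g" for S
    by (intro continuous_on_diff trig_continuous l continuous_on_subset[OF cont]) auto
  define U where "U = {0<..<2 * pi} \<inter> {x. ?g x \<noteq> 0}"
  have "open U" unfolding U_def
    by (intro open_Int open_Collect_neq gc continuous_on_const) auto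
  moreover have "negligible U"
  proof -
    have "AE x in lebesgue. x \<in> {0..2 * pi} \<longrightarrow> f x = trig (fourier_coeff f) x"
      using sobolev_AE_trig[OF f s] by (subst (asm) AE_restrict_space_iff) auto
    then have "AE x in lebesgue. x \<notin> U" by (rule eventually_mono) (auto simp: U_def)
    moreover have "U \<in> sets lebesgue" using \<open>open U\<close> by auto
    ultimately show ?thesis by (simp add: negligible_iff_null_sets AE_iff_null_sets)
  qed
  ultimately have U: "U = {}" using open_not_negligible by blast
  have closed: "?g x = 0" if "x \<in> {0..2 * pi}" for x
  proof -
    have "closed {x. ?g x = 0}" by (intro closed_Collect_eq gc continuous_on_const)
    moreover have "{0<..<2 * pi} \<subseteq> {x. ?g x = 0}" using U by (auto simp: U_def)
    ultimately have "closure {0<..<2 * pi} \<subseteq> {x. ?g x = 0}" by (intro closure_minimal)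
    then show ?thesis using that by auto
  qed
  interpret F: periodic_fun_simple f "2 * pi" by standard (rule sobolevD(1)[OF f])
  interpret G: periodic_fun_simple "trig (fourier_coeff f)" "2 * pi" by standard (rule trig_periodic)
  define y where "y = x - of_int \<lfloor>x / (2 * pi)\<rfloor> * (2 * pi)"
  have "of_int \<lfloor>x / (2 * pi)\<rfloor> \<le> x / (2 * pi)" "x / (2 * pi) \<le> of_int \<lfloor>x / (2 * pi)\<rfloor> + 1" by linarith+
  then have "of_int \<lfloor>x / (2 * pi)\<rfloor> * (2 * pi) \<le> x" "x \<le> (of_int \<lfloor>x / (2 * pi)\<rfloor> + 1) * (2 * pi)"
    by (simp_all only: pos_le_divide_eq pos_divide_le_eq pi_gt_zero mult_pos_pos zero_less_numeral)
  then have "y \<in> {0..2 * pi}" by (simp add: y_def algebra_simps)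
  then have "f y = trig (fourier_coeff f) y" using closed by simp
  moreover have "x = y + of_int \<lfloor>x / (2 * pi)\<rfloor> * (2 * pi)" by (simp add: y_def)
  ultimately show ?thesis using F.plus_of_int[of y] G.plus_of_int[of y] by metis
qed

text \<open>The imaginary part of the differentiated series is the derivative of the imaginary part
  of \<open>trig a\<close>, which is constantly 0.\<close>

lemma real_trig_derivative:
  fixes g :: "real \<Rightarrow> real"
  assumes g: "\<And>x. complex_of_real (g x) = trig a x" and a: "l1 a" and la: "l1 (\<lambda>l. of_int l * a l)"
  shows "complex_of_real (deriv g x) = trig (\<lambda>l. \<i> * of_int l * a l) x"
proof -
  have d: "((\<lambda>x. complex_of_real (g x)) has_vector_derivative trig (\<lambda>l. \<i> * of_int l * a l) x) (at x)"
  proof -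
    have "(\<lambda>x. complex_of_real (g x)) = trig a" by (rule ext) (rule g)
    then show ?thesis by (simp only: trig_has_vector_derivative[OF a la])
  qed
  have Re: "(g has_real_derivative Re (trig (\<lambda>l. \<i> * of_int l * a l) x)) (at x)"
    using bounded_linear.has_vector_derivative[OF bounded_linear_Re d]
    by (simp add: has_real_derivative_iff_has_vector_derivative)
  have "((\<lambda>x. 0::real) has_vector_derivative Im (trig (\<lambda>l. \<i> * of_int l * a l) x)) (at x)"
    using bounded_linear.has_vector_derivative[OF bounded_linear_Im d] by simp
  then have "Im (trig (\<lambda>l. \<i> * of_int l * a l) x) = 0"
    using vector_derivative_unique_at has_vector_derivative_const by metis
  then show ?thesis using DERIV_imp_deriv[OF Re] by (simp add: complex_eq_iff)
qed

lemma fourier_coeff_real_minus: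
  "fourier_coeff (\<lambda>x. complex_of_real (f x)) (- l) = cnj (fourier_coeff (\<lambda>x. complex_of_real (f x)) l)"
proof -
  have "cnj (LINT x|circ. cis (- (of_int l * x)) * of_real (f x)) = (LINT x|circ. cnj (cis (- (of_int l * x)) * of_real (f x)))"
    by (rule Bochner_Integration.integral_cnj[symmetric])
  also have "\<dots> = (LINT x|circ. cis (- (of_int (- l) * x)) * of_real (f x))"
    by (rule Bochner_Integration.integral_cong) (simp_all add: cis_cnj)
  finally show ?thesis by (simp only: fourier_coeff_eq complex_cnj_divide complex_cnj_complex_of_real)
qed

section \<open>The KdV solution on the Fourier side\<close>

lemma Hs_le_derivative:
  assumes "Hs_le s A x"
  shows "Hs_le (s - real k) A (\<lambda>l. (\<i> * of_int l) ^ k * x l)"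
proof (rule Hs_le_le[OF Hs_le_shift'[OF assms, of "real k"], where K = 1])
  show "cmod ((\<i> * of_int l) ^ k * x l) \<le> 1 * cmod (of_real (J l powr real k) * x l)" for l
    using power_mono[OF abs_le_J[of l], of k]
    by (simp add: norm_mult norm_power powr_realpow mult_right_mono)
qed auto

lemma l1_derivative:
  assumes "Hs_le s A x" "1 + real k \<le> s"
  shows "l1 (\<lambda>l. (\<i> * of_int l) ^ k * x l)"
  by (rule l1_Hs_le[OF Hs_le_derivative[OF assms(1)]]) (use assms(2) in simp)

lemma l1_of_int:
  assumes "Hs_le s A x" "2 + real k \<le> s"
  shows "l1 (\<lambda>l. of_int l * ((\<i> * of_int l) ^ k * x l))"
proof (rule l1_bound[where K = 1])
  show "l1 (\<lambda>l. (\<i> * of_int l) ^ Suc k * x l)"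
    by (rule l1_derivative[OF assms(1)]) (use assms(2) in simp)
  show "cmod (of_int l * ((\<i> * of_int l) ^ k * x l)) \<le> 1 * cmod ((\<i> * of_int l) ^ Suc k * x l)" for l
    by (simp add: norm_mult)
qed

definition ddt :: "seq \<Rightarrow> int \<Rightarrow> complex" where
  "ddt a l = \<i> * of_int l ^ 3 * a l + \<i> * of_int l / 2 * conv a a l"

lemma ddt_eq: "ddt a l = 1 / 2 * (\<i> * of_int l * conv a a l) - (\<i> * of_int l) ^ 3 * a l"
proof -
  have "(\<i> * of_int l) ^ 3 = - (\<i> * of_int l ^ 3)"
    unfolding power_mult_distrib by (simp add: power3_eq_cube)
  then show ?thesis by (simp add: ddt_def)
qed

text \<open>The dispersion takes three derivatives and one is left, just enough for the series of
  the time derivative to converge absolutely.\<close>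

lemma Hs_le_ddt:
  assumes a: "Hs_le s M a" and s: "4 \<le> s"
  shows "Hs_le 1 (KC s * M * M + M) (ddt a)"
proof -
  have c: "Hs_le s (KC s * M * M) (conv a a)"
    unfolding conv_def using s by (intro Hs_le_bil_bounded[OF _ _ _ a a, where K = 1]) auto
  have "Hs_le 1 (KC s * M * M) (\<lambda>l. (\<i> * of_int l) ^ 1 * conv a a l)"
    by (rule Hs_le_weaken[OF Hs_le_derivative[OF c]]) (use s in auto)
  then have "Hs_le 1 (KC s * M * M) (\<lambda>l. 1 / 2 * (\<i> * of_int l * conv a a l))"
    by (rule Hs_le_le[where K = 1]) (use Hs_le_nonneg[OF c] in \<open>auto simp: norm_mult\<close>)
  moreover have "Hs_le 1 M (\<lambda>l. (\<i> * of_int l) ^ 3 * a l)"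
    by (rule Hs_le_weaken[OF Hs_le_derivative[OF a]]) (use s in auto)
  ultimately show ?thesis unfolding ddt_eq[abs_def] by (rule Hs_le_diff)
qed

lemma kdv_time_derivative:
  fixes f :: "real \<Rightarrow> real"
  assumes f: "\<And>x. complex_of_real (f x) = trig a x" and a: "Hs_le s M a" and s: "4 \<le> s"
    and eq: "D + (deriv ^^ 3) f x = 1 / 2 * deriv (\<lambda>y. (f y)\<^sup>2) x"
  shows "complex_of_real D = trig (ddt a) x"
proof -
  have l: "l1 a" by (rule l1_Hs_le[OF a]) (use s in auto)
  have c: "Hs_le s (KC s * M * M) (conv a a)"
    unfolding conv_def using s by (intro Hs_le_bil_bounded[OF _ _ _ a a, where K = 1]) auto
  have der: "complex_of_real ((deriv ^^ k) f x) = trig (\<lambda>l. (\<i> * of_int l) ^ k * a l) x" if "k \<le> 3" for k x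
    using that
  proof (induction k arbitrary: x)
    case 0
    then show ?case using f by simp
  next
    case (Suc k)
    have "complex_of_real (deriv ((deriv ^^ k) f) x) = trig (\<lambda>l. \<i> * of_int l * ((\<i> * of_int l) ^ k * a l)) x"
    proof (rule real_trig_derivative)
      show "complex_of_real ((deriv ^^ k) f x) = trig (\<lambda>l. (\<i> * of_int l) ^ k * a l) x" for x
        using Suc by simp
      show "l1 (\<lambda>l. (\<i> * of_int l) ^ k * a l)" by (rule l1_derivative[OF a]) (use s Suc.prems in auto)
      show "l1 (\<lambda>l. of_int l * ((\<i> * of_int l) ^ k * a l))" by (rule l1_of_int[OF a]) (use s Suc.prems in auto)
    qed
    then show ?case by (simp add: mult.assoc)
  qed
  have "complex_of_real (deriv (\<lambda>y. (f y)\<^sup>2) x) = trig (\<lambda>l. \<i> * of_int l * conv a a l) x"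
  proof (rule real_trig_derivative)
    show "complex_of_real ((f x)\<^sup>2) = trig (conv a a) x" for x
      by (simp add: power2_eq_square f trig_mult(1)[OF l l])
    show "l1 (conv a a)" by (rule trig_mult(2)[OF l l])
    show "l1 (\<lambda>l. of_int l * conv a a l)" using l1_of_int[OF c, of 0] s by simp
  qed
  moreover have "complex_of_real D = 1 / 2 * complex_of_real (deriv (\<lambda>y. (f y)\<^sup>2) x) - complex_of_real ((deriv ^^ 3) f x)"
  proof -
    have "D = 1 / 2 * deriv (\<lambda>y. (f y)\<^sup>2) x - (deriv ^^ 3) f x" using eq by linarith
    then show ?thesis by (simp only: of_real_diff of_real_mult) simp
  qed
  ultimately have "complex_of_real D = 1 / 2 * trig (\<lambda>l. \<i> * of_int l * conv a a l) x - trig (\<lambda>l. (\<i> * of_int l) ^ 3 * a l) x"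
    using der[of 3] by simp
  also have "\<dots> = trig (ddt a) x"
  proof -
    have "l1 (\<lambda>l. (\<i> * of_int l) ^ 1 * conv a a l)" by (rule l1_derivative[OF c]) (use s in auto)
    then have l1: "l1 (\<lambda>l. 1 / 2 * (\<i> * of_int l * conv a a l))"
      by (rule l1_bound[where K = 1]) (simp add: norm_mult)
    have l3: "l1 (\<lambda>l. (\<i> * of_int l) ^ 3 * a l)" by (rule l1_derivative[OF a]) (use s in auto)
    show ?thesis
      unfolding ddt_eq[abs_def] trig_diff[OF l1 l3] trig_scale ..
  qed
  finally show ?thesis .
qed

locale kdv =
  fixes s T M :: real and u0 :: "real \<Rightarrow> real" and u :: "real \<Rightarrow> real \<Rightarrow> real"
  assumes s: "4 \<le> s" and T: "0 < T"
    and sol: "kdv_solution s T u0 u"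
    and mean: "fourier_coeff (\<lambda>x. complex_of_real (u0 x)) 0 = 0"
    and norm: "Linf_sobolev_norm T s u = ereal M"
begin

abbreviation "uc t \<equiv> \<lambda>x. complex_of_real (u t x)"

definition "c t = fourier_coeff (uc t)"

lemma u_sobolev: "t \<in> {0..T} \<Longrightarrow> uc t \<in> sobolev s"
  using sol unfolding kdv_solution_def by blast

lemma c_bound: "t \<in> {0..T} \<Longrightarrow> Hs_le s (sobolev_norm s (uc t)) (c t)"
  unfolding c_def by (rule sobolevD(4)[OF u_sobolev])

lemma c_diff:
  assumes "t \<in> {0..T}" "r \<in> {0..T}"
  shows "fourier_coeff (\<lambda>x. complex_of_real (u r x - u t x)) l = c r l - c t l"
  unfolding c_def of_real_diff using assms by (intro fourier_coeff_diff sobolevD(5)[OF u_sobolev])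

lemma c_continuous: "continuous_on {0..T} (\<lambda>t. c t l)"
  unfolding continuous_on_def
proof
  fix t assume t: "t \<in> {0..T}"
  let ?N = "\<lambda>r. sobolev_norm s (\<lambda>x. complex_of_real (u r x - u t x))"
  have lim: "(?N \<longlongrightarrow> 0) (at t within {0..T})"
    using sol t unfolding kdv_solution_def by blast
  have "cmod (c r l - c t l) \<le> ?N r" if r: "r \<in> {0..T}" for r
  proof -
    \<comment> \<open>The sum of the norms only ensures that the norm of the difference is a
      convergent sum; that norm is then a bound itself.\<close>
    have "Hs_le s (sobolev_norm s (uc r) + sobolev_norm s (uc t)) (\<lambda>l. c r l - c t l)"
      by (intro Hs_le_diff c_bound r t)
    moreover have "(\<lambda>l. c r l - c t l) = fourier_coeff (\<lambda>x. complex_of_real (u r x - u t x))"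
      using c_diff[OF t r] by auto
    ultimately have "Hs_le s (?N r) (\<lambda>l. c r l - c t l)"
      using sobolev_norm_bound(1) by metis
    then have "J l powr s * cmod (c r l - c t l) \<le> ?N r" by (rule Hs_le_single)
    moreover have "1 * cmod (c r l - c t l) \<le> J l powr s * cmod (c r l - c t l)"
      using s by (intro mult_right_mono J_powr_ge_1) auto
    ultimately show ?thesis by linarith
  qed
  then have "((\<lambda>r. c r l - c t l) \<longlongrightarrow> 0) (at t within {0..T})"
    by (intro Lim_null_comparison[OF _ lim]) (auto simp: eventually_at_filter)
  then show "((\<lambda>r. c r l) \<longlongrightarrow> c t l) (at t within {0..T})"
    by (simp add: LIM_zero_iff)
qed

text \<open>The essential supremum gives the bound for almost every time only. For finitely many
  modes the norm is continuous in time, so the set of exceptions is open and null, hence empty, and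
  the end points follow by closure.\<close>

lemma c_bound_M:
  assumes t: "t \<in> {0..T}"
  shows "Hs_le s M (c t)"
proof (rule Hs_leI)
  fix L :: "int set" assume L: "finite L"
  define F where "F t = wnorm s (c t) L" for t
  have F: "continuous_on {0..T} F"
    unfolding F_def L2_set_def by (intro continuous_intros c_continuous)
  define U where "U = {0<..<T} \<inter> {t. M < F t}"
  have "AE t in lebesgue_on {0<..<T}. ereal (sobolev_norm s (uc t)) \<le> ereal M"
    using esssup_AE[of "\<lambda>t. ereal (sobolev_norm s (uc t))" "lebesgue_on {0<..<T}"] norm
    unfolding Linf_sobolev_norm_def by (simp only:)
  then have "AE t in lebesgue. t \<in> {0<..<T} \<longrightarrow> sobolev_norm s (uc t) \<le> M"
    by (subst (asm) AE_restrict_space_iff) auto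
  then have "AE t in lebesgue. t \<notin> U"
  proof (rule eventually_mono)
    fix t assume *: "t \<in> {0<..<T} \<longrightarrow> sobolev_norm s (uc t) \<le> M"
    have "F t \<le> sobolev_norm s (uc t)" if "t \<in> {0<..<T}"
      unfolding F_def by (rule Hs_leD[OF c_bound]) (use that in auto)
    then show "t \<notin> U" using * by (force simp: U_def)
  qed
  moreover have "open U"
  proof -
    have "continuous_on {0<..<T} F" by (rule continuous_on_subset[OF F]) auto
    then have "open ({0<..<T} \<inter> F -` {M<..})" by (intro continuous_open_preimage) auto
    then show ?thesis by (simp add: U_def vimage_def)
  qed
  ultimately have "negligible U"
    by (simp add: negligible_iff_null_sets AE_iff_null_sets)
  then have U: "U = {}" using \<open>open U\<close> open_not_negligible by blast
  have "F t \<le> M"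
  proof (rule continuous_le_on_closure[of "{0<..<T}" F t M])
    show "continuous_on (closure {0<..<T}) F" using F T by simp
    show "t \<in> closure {0<..<T}" using t T by simp
    show "F x \<le> M" if "x \<in> {0<..<T}" for x using that U by (force simp: U_def)
  qed
  then show "wnorm s (c t) L \<le> M" by (simp add: F_def)
qed

text \<open>
  At \<open>t = 0\<close> and \<open>t = T\<close> the function \<open>u t\<close> agrees with its Fourier series only almost everywhere, and
  only its coefficients are used there.
\<close>

lemma u_eq_trig:
  assumes t: "t \<in> {0<..<T}"
  shows "complex_of_real (u t x) = trig (c t) x"
proof -
  have "\<forall>x. (deriv ^^ 0) (u t) differentiable (at x)"
    using sol t unfolding kdv_solution_def by fastforce
  then have "continuous_on UNIV (u t)"
    by (simp add: continuous_at_imp_continuous_on differentiable_imp_continuous_within)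
  then show ?thesis
    unfolding c_def using t s by (intro sobolev_continuous_eq_trig[OF u_sobolev] continuous_on_of_real) auto
qed

lemma ut:
  assumes t: "t \<in> {0<..<T}"
  shows "((\<lambda>r. u r x) has_real_derivative deriv (\<lambda>r. u r x) t) (at t)"
    and "complex_of_real (deriv (\<lambda>r. u r x) t) = trig (ddt (c t)) x"
proof -
  have "(\<lambda>r. u r x) differentiable (at t)"
    and eq: "deriv (\<lambda>r. u r x) t + (deriv ^^ 3) (u t) x = 1 / 2 * deriv (\<lambda>y. (u t y)\<^sup>2) x"
    using sol t unfolding kdv_solution_def by blast+
  then show "((\<lambda>r. u r x) has_real_derivative deriv (\<lambda>r. u r x) t) (at t)"
    by (simp add: DERIV_deriv_iff_real_differentiable)
  show "complex_of_real (deriv (\<lambda>r. u r x) t) = trig (ddt (c t)) x"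
    by (rule kdv_time_derivative[OF u_eq_trig[OF t] c_bound_M s eq]) (use t in auto)
qed

definition "B = sqrt bracket_sum * (KC s * M * M + M)"

lemma ut_bound:
  assumes t: "t \<in> {0<..<T}"
  shows "\<bar>deriv (\<lambda>r. u r x) t\<bar> \<le> B"
proof -
  have b: "Hs_le 1 (KC s * M * M + M) (ddt (c t))"
    by (rule Hs_le_ddt[OF c_bound_M s]) (use t in auto)
  have "\<bar>deriv (\<lambda>r. u r x) t\<bar> = cmod (trig (ddt (c t)) x)"
    using ut(2)[OF t, of x] by (metis norm_of_real)
  also have "\<dots> \<le> (\<Sum>\<^sub>\<infinity>l. cmod (ddt (c t) l))"
    by (rule trig_norm_le[OF l1_Hs_le[OF b]]) simp
  also have "\<dots> \<le> B" unfolding B_def by (rule Hs_le_l1(2)[OF b])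
  finally show ?thesis .
qed

lemma u_lipschitz:
  assumes "t \<in> {0<..<T}" "r \<in> {0<..<T}"
  shows "\<bar>u r x - u t x\<bar> \<le> B * \<bar>r - t\<bar>"
  using field_differentiable_bound[of "{0<..<T}" "\<lambda>r. u r x" "\<lambda>t. deriv (\<lambda>r. u r x) t" B r t]
    ut(1) ut_bound assms by (auto intro: has_field_derivative_at_within)

text \<open>Differentiation under the integral. The difference quotients of \<open>u\<close>
  converge pointwise and are bounded by \<open>B\<close>, uniformly in \<open>x\<close>, by the
  Lipschitz bound in time, so dominated convergence applies along every sequence of times.\<close>

lemma c_has_vector_derivative:
  assumes t: "t \<in> {0<..<T}"
  shows "((\<lambda>t. c t l) has_vector_derivative ddt (c t) l) (at t)"
proof -
  define D where "D x = deriv (\<lambda>r. u r x) t" for x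
  have Dt: "complex_of_real (D x) = trig (ddt (c t)) x" for x unfolding D_def by (rule ut(2)[OF t])
  have l1d: "l1 (ddt (c t))"
    by (rule l1_Hs_le[OF Hs_le_ddt[OF c_bound_M s]]) (use t in auto)
  have cont_u: "continuous_on A (uc r)" if "r \<in> {0<..<T}" for r A
    unfolding u_eq_trig[OF that]
    by (intro trig_continuous l1_Hs_le[OF c_bound_M]) (use that s in auto)
  have cont_D: "continuous_on A (\<lambda>x. complex_of_real (D x))" for A
    unfolding Dt by (intro trig_continuous l1d)
  define R where "R r x = complex_of_real (u r x) - complex_of_real (u t x) - of_real (r - t) * complex_of_real (D x)" for r x
  have intR: "integrable circ (R r)" if "r \<in> {0<..<T}" for r
    unfolding R_def by (intro circ_integrable_continuous continuous_intros cont_u cont_D that t)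
  have coeffR: "fourier_coeff (R r) l = c r l - c t l - (r - t) *\<^sub>R ddt (c t) l" if r: "r \<in> {0<..<T}" for r
  proof -
    have "fourier_coeff (R r) l = fourier_coeff (\<lambda>x. complex_of_real (u r x) - complex_of_real (u t x)) l
        - fourier_coeff (\<lambda>x. of_real (r - t) * complex_of_real (D x)) l"
      unfolding R_def
      by (intro fourier_coeff_diff circ_integrable_continuous continuous_intros cont_u cont_D r t)
    also have "fourier_coeff (\<lambda>x. complex_of_real (u r x) - complex_of_real (u t x)) l = c r l - c t l"
      unfolding c_def by (intro fourier_coeff_diff circ_integrable_continuous cont_u r t)
    also have "fourier_coeff (\<lambda>x. of_real (r - t) * complex_of_real (D x)) l = of_real (r - t) * ddt (c t) l"
      unfolding Dt trig_scale[symmetric]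
      by (subst fourier_coeff_trig) (auto intro!: l1_mult[where K = "\<bar>r - t\<bar>"] l1d simp flip: of_real_diff)
    finally show ?thesis by (simp add: scaleR_conv_of_real)
  qed
  have lim: "((\<lambda>r. norm (c r l - c t l - (r - t) *\<^sub>R ddt (c t) l) / norm (r - t)) \<longlongrightarrow> 0) (at t within {0<..<T})"
    unfolding tendsto_at_iff_sequentially comp_def
  proof (intro allI impI)
    fix X assume X: "\<forall>i. X i \<in> {0<..<T} - {t}" "X \<longlonglongrightarrow> t"
    have Xi: "X i \<in> {0<..<T}" "X i \<noteq> t" for i using X(1) by auto
    define q where "q i x = cis (- (of_int l * x)) * R (X i) x / of_real (X i - t)" for i x
    have "(\<lambda>i. LINT x|circ. q i x) \<longlonglongrightarrow> (LINT x|circ. 0)"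
    proof (rule integral_dominated_convergence[where w = "\<lambda>_. 2 * B"])
      show "q i \<in> borel_measurable circ" for i
        unfolding q_def by (intro borel_measurable_integrable integrable_divide circ_integrable_coeff intR Xi)
      show "integrable circ (\<lambda>_. 2 * B)"
        by (intro continuous_imp_integrable_real continuous_intros)
      show "AE x in circ. norm (q i x) \<le> 2 * B" for i
      proof (rule AE_I2)
        fix x
        have "cmod (R (X i) x) \<le> \<bar>u (X i) x - u t x\<bar> + \<bar>X i - t\<bar> * \<bar>D x\<bar>"
        proof -
          have "R (X i) x = complex_of_real (u (X i) x - u t x) - complex_of_real ((X i - t) * D x)"
            by (simp add: R_def)
          then have "cmod (R (X i) x) \<le> cmod (complex_of_real (u (X i) x - u t x)) + cmod (complex_of_real ((X i - t) * D x))"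
            by (simp only: norm_triangle_ineq4)
          then show ?thesis by (simp only: norm_of_real abs_mult)
        qed
        also have "\<dots> \<le> B * \<bar>X i - t\<bar> + \<bar>X i - t\<bar> * B"
          unfolding D_def by (intro add_mono u_lipschitz mult_left_mono ut_bound t Xi) auto
        finally have "cmod (R (X i) x) / \<bar>X i - t\<bar> \<le> 2 * B"
          using Xi(2)[of i] by (simp add: pos_divide_le_eq)
        moreover have "norm (q i x) = cmod (R (X i) x) / \<bar>X i - t\<bar>"
          by (simp add: q_def norm_divide norm_mult del: of_real_diff)
        ultimately show "norm (q i x) \<le> 2 * B" by simp
      qed
      show "AE x in circ. (\<lambda>i. q i x) \<longlonglongrightarrow> 0"
      proof (rule AE_I2)
        fix x
        have "((\<lambda>r. (u r x - u t x) / (r - t)) \<longlongrightarrow> D x) (at t within {0<..<T})"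
          using has_field_derivative_at_within[OF ut(1)[OF t, of x], of "{0<..<T}"]
          unfolding D_def has_field_derivative_iff by simp
        then have "(\<lambda>i. (u (X i) x - u t x) / (X i - t)) \<longlonglongrightarrow> D x"
          using X unfolding tendsto_at_iff_sequentially comp_def by blast
        then have "(\<lambda>i. cis (- (of_int l * x)) * complex_of_real ((u (X i) x - u t x) / (X i - t) - D x)) \<longlonglongrightarrow> cis (- (of_int l * x)) * complex_of_real (D x - D x)"
          by (intro tendsto_intros)
        moreover have "cis (- (of_int l * x)) * complex_of_real ((u (X i) x - u t x) / (X i - t) - D x) = q i x" for i
        proof -
          have "complex_of_real (X i - t) \<noteq> 0" using Xi(2)[of i] by simp
          then show ?thesis
            by (simp add: q_def R_def diff_divide_distrib right_diff_distrib del: of_real_diff) (simp add: diff_divide_distrib algebra_simps)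
        qed
        ultimately show "(\<lambda>i. q i x) \<longlonglongrightarrow> 0"
          by (simp only: diff_self of_real_0 mult_zero_right)
      qed
    qed simp
    then have "(\<lambda>i. cmod ((LINT x|circ. q i x) / (2 * pi))) \<longlonglongrightarrow> cmod ((LINT x|circ. 0) / (2 * pi))"
      by (intro tendsto_intros) auto
    moreover have "cmod ((LINT x|circ. q i x) / (2 * pi)) = norm (c (X i) l - c t l - (X i - t) *\<^sub>R ddt (c t) l) / norm (X i - t)" for i
    proof -
      have "(LINT x|circ. q i x) / (2 * pi) = fourier_coeff (R (X i)) l / of_real (X i - t)"
        unfolding q_def integral_divide_zero fourier_coeff_eq by (simp only: divide_divide_eq_left mult.commute)
      then show ?thesis by (simp only: coeffR[OF Xi(1)] norm_divide norm_of_real real_norm_def)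
    qed
    ultimately show "(\<lambda>i. norm (c (X i) l - c t l - (X i - t) *\<^sub>R ddt (c t) l) / norm (X i - t)) \<longlonglongrightarrow> 0"
      by simp
  qed
  have "((\<lambda>t. c t l) has_vector_derivative ddt (c t) l) (at t within {0<..<T})"
    unfolding has_vector_derivative_def has_derivative_iff_norm
    by (intro conjI bounded_linear_scaleR_left lim)
  then show ?thesis by (simp only: at_within_open[OF t open_greaterThanLessThan])
qed

text \<open>Conservation of the mean: both terms of \<open>ddt\<close> carry a factor
  \<open>l\<close>. The mean value inequality is applied with derivative 0 to a sequence that
  repeats the zero mode at every index.\<close>

lemma c_zero:
  assumes t: "t \<in> {0..T}"
  shows "c t 0 = 0"
proof -
  have "Hs_le 0 (0 * t) (\<lambda>_. c t 0)"
  proof (rule Hs_le_mvt[where y = "\<lambda>t _. c t 0" and y' = "\<lambda>_ _. 0"])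
    show "continuous_on {0..t} (\<lambda>t. c t 0)"
      by (rule continuous_on_subset[OF c_continuous]) (use t in auto)
    show "((\<lambda>t. c t 0) has_vector_derivative 0) (at r)" if "0 < r" "r < t" for r
      using c_has_vector_derivative[of r 0] that t by (simp add: ddt_def)
    show "c 0 0 = 0" using mean sol unfolding c_def kdv_solution_def by simp
  qed (use t in \<open>auto intro: Hs_le_zero\<close>)
  from Hs_le_single[OF this, of 0] show ?thesis by simp
qed

lemma fourier_kdv: "fourier_kdv s T M c"
  unfolding fourier_kdv_def
  using c_bound_M c_zero c_continuous c_has_vector_derivative fourier_coeff_real_minus
  by (simp add: ddt_def c_def)

end

section \<open>The scheme on the Fourier side\<close>

definition esym :: "real \<Rightarrow> int \<Rightarrow> complex" where
  "esym t l = cis (t * of_int l ^ 3)"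

text \<open>For \<open>m \<ge> 1\<close> the value at \<open>l = 0\<close> is 0, by the convention
  for inverses, in agreement with the sum over nonzero modes in \<open>antideriv\<close>.\<close>

definition isym :: "nat \<Rightarrow> int \<Rightarrow> complex" where
  "isym m l = inverse ((\<i> * of_int l) ^ m)"

lemma norm_esym [simp]: "cmod (esym t l) = 1"
  by (simp add: esym_def)

lemma norm_isym_le: "cmod (isym m l) \<le> 1"
proof (cases "l = 0")
  case True
  then show ?thesis by (cases m) (simp_all add: isym_def)
next
  case False
  then have "1 \<le> \<bar>l\<bar>" by simp
  then have "1 \<le> \<bar>real_of_int l\<bar>" by (metis of_int_1_le_iff of_int_abs)
  then have "1 \<le> \<bar>real_of_int l\<bar> ^ m" by (rule one_le_power)
  then show ?thesis by (simp add: isym_def norm_inverse norm_power norm_mult inverse_le_1_iff)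
qed

lemma isym_0: "1 \<le> m \<Longrightarrow> isym m 0 = 0"
  by (simp add: isym_def)

lemma airy_eq_trig: "airy (- t) f = trig (\<lambda>l. esym t l * fourier_coeff f l)"
  by (simp add: fun_eq_iff airy_def trig_def esym_def)

lemma antideriv_eq_trig:
  assumes "1 \<le> m"
  shows "antideriv m f = trig (\<lambda>l. isym m l * fourier_coeff f l)"
proof
  fix x
  show "antideriv m f x = trig (\<lambda>l. isym m l * fourier_coeff f l) x"
    unfolding antideriv_def trig_def
    by (rule infsum_cong_neutral) (use isym_0[OF assms] in \<open>auto simp: isym_def\<close>)
qed

lemma nonzero_modes_eq_trig: "nonzero_modes f = trig (\<lambda>l. if l = 0 then 0 else fourier_coeff f l)"
proof
  fix x
  show "nonzero_modes f x = trig (\<lambda>l. if l = 0 then 0 else fourier_coeff f l) x"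
    unfolding nonzero_modes_def trig_def by (rule infsum_cong_neutral) auto
qed

lemma reg_l1: "reg a \<Longrightarrow> l1 a"
  unfolding reg_def using l1_Hs_le by blast

lemma reg_conv: "reg a \<Longrightarrow> reg b \<Longrightarrow> reg (conv a b)"
  unfolding reg_def conv_def
  by (blast intro: Hs_le_bil_bounded[of 1 1 _ a _ b "\<lambda>_ _. 1" 1, OF _ _ _ _ _ _ _ order_refl] zero_le_one order_refl norm_one[THEN eq_refl])

lemma conv_mult: "conv (\<lambda>l. p l * x l) (\<lambda>l. q l * y l) l = bil (\<lambda>l k. p k * q (l - k)) x y l"
  unfolding conv_def bil_def by (simp add: mult_ac)

lemma bil_scale: "c * bil b x y l = bil (\<lambda>l k. c * b l k) x y l"
  unfolding bil_def by (subst infsum_cmult_right'[symmetric]) (simp_all add: mult_ac)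

lemma bil_add_sym:
  assumes "reg x" "reg y" "sym_bounded b" "sym_bounded b'"
  shows "bil (\<lambda>l k. b l k + b' l k) x y l = bil b x y l + bil b' x y l"
  unfolding bil_def using assms
  by (subst infsum_add[symmetric]) (simp_all add: reg_bil_summable distrib_right)

lemma bil_cong: "(\<And>k. b l k = b' l k) \<Longrightarrow> bil b x y l = bil b' x y l"
  by (simp add: bil_def)

lemma esym_product: "esym t k * esym t (l - k) = esym t l * phase t l k"
  unfolding esym_def phase_def cis_mult by (rule arg_cong[where f = cis]) (simp add: power3_eq_cube algebra_simps)

lemma sym_bounded_scale:
  assumes "sym_bounded b"
  shows "sym_bounded (\<lambda>l k. c * b l k)"
  unfolding sym_bounded_def
proof
  fix l
  obtain K where "\<And>k. cmod (b l k) \<le> K" using assms unfolding sym_bounded_def by blast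
  then have "cmod (c * b l k) \<le> cmod c * K" for k by (simp add: norm_mult mult_left_mono)
  then show "\<exists>K. \<forall>k. cmod (c * b l k) \<le> K" by blast
qed

lemma sym_bounded_diff:
  assumes "sym_bounded b" "sym_bounded b'"
  shows "sym_bounded (\<lambda>l k. b l k - b' l k)"
  unfolding sym_bounded_def
proof
  fix l
  obtain K K' where "\<And>k. cmod (b l k) \<le> K" "\<And>k. cmod (b' l k) \<le> K'"
    using assms unfolding sym_bounded_def by metis
  then have "cmod (b l k - b' l k) \<le> K + K'" for k by (meson add_mono norm_triangle_le_diff order_trans norm_triangle_ineq4)
  then show "\<exists>K. \<forall>k. cmod (b l k - b' l k) \<le> K" by blast
qed

lemma norm_mult_le_1: "cmod x \<le> 1 \<Longrightarrow> cmod y \<le> 1 \<Longrightarrow> cmod (x * y) \<le> 1"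
  by (simp add: norm_mult mult_le_one)

text \<open>The square of the propagated antiderivative contributes the phase and the propagated
  square contributes 1. The two antiderivatives give \<open>-1 / (k (l - k))\<close>, and the
  factors 1/2 and 1/3 make the 6 in \<open>bsym\<close>.\<close>

lemma J1_modes:
  assumes a: "reg a"
  shows "1 / 2 * (1 / 3 * conv (\<lambda>l. esym t l * (isym 1 l * a l)) (\<lambda>l. esym t l * (isym 1 l * a l)) l
      - 1 / 3 * (esym t l * conv (\<lambda>l. isym 1 l * a l) (\<lambda>l. isym 1 l * a l) l))
    = esym t l * bil (bsym t) a a l" (is "?L = _")
proof -
  define p where "p l k = esym t k * isym 1 k * (esym t (l - k) * isym 1 (l - k))" for l k
  define q where "q l k = esym t l * (isym 1 k * isym 1 (l - k))" for l k
  have pb: "sym_bounded p" and qb: "sym_bounded q"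
    by (rule sym_boundedI[where K = "\<lambda>_. 1"], simp only: p_def q_def, intro norm_mult_le_1 norm_isym_le eq_refl norm_esym)+
  have 1: "conv (\<lambda>l. esym t l * (isym 1 l * a l)) (\<lambda>l. esym t l * (isym 1 l * a l)) l = bil p a a l"
    using conv_mult[of "\<lambda>l. esym t l * isym 1 l" a "\<lambda>l. esym t l * isym 1 l" a l] by (simp only: p_def[abs_def] mult.assoc)
  have 2: "esym t l * conv (\<lambda>l. isym 1 l * a l) (\<lambda>l. isym 1 l * a l) l = bil q a a l"
    unfolding conv_mult bil_scale by (simp add: bil_def q_def)
  have "?L
    = 1 / 6 * (bil p a a l - bil q a a l)"
    unfolding 1 2 by (simp add: algebra_simps)
  also have "\<dots> = bil (\<lambda>l k. 1 / 6 * (p l k - q l k)) a a l"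
    unfolding bil_diff_sym[OF a a pb qb, symmetric] by (rule bil_scale)
  also have "\<dots> = bil (\<lambda>l k. esym t l * bsym t l k) a a l"
  proof (rule bil_cong)
    fix k
    have "p l k - q l k = esym t l * (phase t l k - 1) * (isym 1 k * isym 1 (l - k))"
      using esym_product[of t k l] by (simp add: p_def q_def algebra_simps)
    also have "isym 1 k * isym 1 (l - k) = - (1 / of_int (k * (l - k)))"
      by (simp add: isym_def divide_simps del: of_int_diff)
    finally show "1 / 6 * (p l k - q l k) = esym t l * bsym t l k"
      unfolding bsym_def by (simp add: divide_simps del: of_int_diff of_int_mult) (simp add: algebra_simps)
  qed
  also have "\<dots> = esym t l * bil (bsym t) a a l"
    unfolding bil_scale by (simp add: bil_def)
  finally show ?thesis .
qed

text \<open>The first term is the boundary term of \<open>dsym\<close>; the other two have the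
  common factor \<open>1 / (l k^2 (l - k))\<close>, once with the phase and once without. The
  conditional in the first convolution is the subtracted mean of the square.\<close>

lemma J2_modes:
  assumes a: "reg a" and l: "l \<noteq> 0"
  shows "of_real t / 6 * conv (\<lambda>l. esym t l * (isym 1 l * a l)) (\<lambda>l. (if l = 0 then 0 else esym t l) * conv a a l) l
      - 1 / 18 * (isym 1 l * conv (\<lambda>l. esym t l * (isym 2 l * a l)) (\<lambda>l. esym t l * (isym 1 l * conv a a l)) l)
      + 1 / 18 * (esym t l * (isym 1 l * conv (\<lambda>l. isym 2 l * a l) (\<lambda>l. isym 1 l * conv a a l) l))
    = esym t l * bil (dsym t) a (conv a a) l" (is "?L = _")
proof -
  define p where "p l k = esym t k * isym 1 k * (if l - k = 0 then 0 else esym t (l - k))" for l k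
  define q where "q l k = isym 1 l * (esym t k * isym 2 k * (esym t (l - k) * isym 1 (l - k)))" for l k
  define r where "r l k = esym t l * isym 1 l * (isym 2 k * isym 1 (l - k))" for l k
  have pb: "sym_bounded p"
  proof (rule sym_boundedI[where K = "\<lambda>_. 1"])
    show "cmod (p l k) \<le> 1" for l k
      unfolding p_def by (intro norm_mult_le_1 norm_isym_le) auto
  qed
  have qb: "sym_bounded q" and rb: "sym_bounded r"
    by (rule sym_boundedI[where K = "\<lambda>_. 1"], simp only: q_def r_def, intro norm_mult_le_1 norm_isym_le eq_refl norm_esym)+
  have sb: "sym_bounded (\<lambda>l k. of_real t / 6 * p l k - 1 / 18 * q l k)"
    "sym_bounded (\<lambda>l k. of_real t / 6 * p l k)" "sym_bounded (\<lambda>l k. 1 / 18 * q l k)" "sym_bounded (\<lambda>l k. 1 / 18 * r l k)"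
    by (intro sym_bounded_diff sym_bounded_scale pb qb rb)+
  note c = reg_conv[OF a a]
  have 1: "conv (\<lambda>l. esym t l * (isym 1 l * a l)) (\<lambda>l. (if l = 0 then 0 else esym t l) * conv a a l) l = bil p a (conv a a) l"
    using conv_mult[of "\<lambda>l. esym t l * isym 1 l" a "\<lambda>l. if l = 0 then 0 else esym t l" "conv a a" l]
    by (simp only: p_def[abs_def] mult.assoc)
  have 2: "isym 1 l * conv (\<lambda>l. esym t l * (isym 2 l * a l)) (\<lambda>l. esym t l * (isym 1 l * conv a a l)) l = bil q a (conv a a) l"
    using conv_mult[of "\<lambda>l. esym t l * isym 2 l" a "\<lambda>l. esym t l * isym 1 l" "conv a a" l]
    by (simp only: mult.assoc bil_scale) (simp add: bil_def q_def mult.assoc)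
  have 3: "esym t l * (isym 1 l * conv (\<lambda>l. isym 2 l * a l) (\<lambda>l. isym 1 l * conv a a l) l) = bil r a (conv a a) l"
    unfolding conv_mult bil_scale by (simp add: bil_def r_def mult.assoc)
  have "?L
    = of_real t / 6 * bil p a (conv a a) l - 1 / 18 * bil q a (conv a a) l + 1 / 18 * bil r a (conv a a) l"
    unfolding 1 2 3 ..
  also have "\<dots> = bil (\<lambda>l k. of_real t / 6 * p l k - 1 / 18 * q l k + 1 / 18 * r l k) a (conv a a) l"
    unfolding bil_scale bil_add_sym[OF a c sb(1,4)] bil_diff_sym[OF a c sb(2,3)] ..
  also have "\<dots> = bil (\<lambda>l k. esym t l * dsym t l k) a (conv a a) l"
  proof (rule bil_cong)
    fix k
    show "of_real t / 6 * p l k - 1 / 18 * q l k + 1 / 18 * r l k = esym t l * dsym t l k"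
    proof (cases "l = k")
      case True
      then show ?thesis by (simp add: p_def q_def r_def dsym_def isym_0)
    next
      case False
      have 1: "p l k = esym t l * phase t l k * isym 1 k"
        using esym_product[of t k l] False by (simp add: p_def mult_ac)
      have 2: "q l k = esym t l * phase t l k * (isym 1 l * isym 2 k * isym 1 (l - k))"
        using esym_product[of t k l] by (simp add: q_def mult_ac)
      have 3: "isym 1 l * isym 2 k * isym 1 (l - k) = 1 / of_int (l * k\<^sup>2 * (l - k))"
        by (simp add: isym_def power2_eq_square divide_simps del: of_int_diff)
      have 4: "r l k = esym t l * (isym 1 l * isym 2 k * isym 1 (l - k))" by (simp add: r_def mult_ac)
      have 5: "isym 1 k = inverse (\<i> * of_int k)" by (simp add: isym_def)
      show ?thesis unfolding 1 2 4 3 5 dsym_def using False l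
        by (simp add: diff_divide_distrib algebra_simps del: of_int_diff of_int_mult)
    qed
  qed
  also have "\<dots> = esym t l * bil (dsym t) a (conv a a) l"
    unfolding bil_scale by (simp add: bil_def)
  finally show ?thesis .
qed

lemma bsym_zero_mode: "bil (bsym t) x y 0 = 0"
  by (simp add: bil_def bsym_def phase_def)

lemma dsym_zero_mode: "bil (dsym t) x y 0 = 0"
  by (simp add: bil_def dsym_def)

text \<open>Only the coefficients of \<open>v\<close> and of its square enter, so \<open>v\<close>
  need not equal its Fourier series pointwise. This admits an arbitrary representative as the
  initial value.\<close>

lemma lri_step_eq_trig:
  assumes v: "fourier_coeff v = a" and v2: "fourier_coeff (\<lambda>x. (v x)\<^sup>2) = conv a a" and a: "reg a"
  shows "lri_step t v = trig (lri_seq t a)"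
proof -
  define A1 A2 c C1 where "A1 = (\<lambda>l. isym 1 l * a l)" and "A2 = (\<lambda>l. isym 2 l * a l)"
    and "c = conv a a" and "C1 = (\<lambda>l. isym 1 l * c l)"
  have la: "l1 a" by (rule reg_l1[OF a])
  have lc: "l1 c" unfolding c_def by (rule trig_mult(2)[OF la la])
  have lA1: "l1 A1" and lA2: "l1 A2" and lC1: "l1 C1"
    unfolding A1_def A2_def C1_def using la lc norm_isym_le by (auto intro!: l1_mult[where K = 1])
  have lE: "l1 (\<lambda>l. esym t l * x l)" if "l1 x" for x
    using that by (rule l1_mult[where K = 1]) simp
  have lD: "l1 (\<lambda>l. isym m l * x l)" if "l1 x" for m x
    using that norm_isym_le by (rule l1_mult)
  have airy: "airy (- t) (trig x) = trig (\<lambda>l. esym t l * x l)" if "l1 x" for x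
    unfolding airy_eq_trig fourier_coeff_trig[OF that] ..
  have anti: "antideriv (Suc 0) (trig x) = trig (\<lambda>l. isym 1 l * x l)" if "l1 x" for x
    using antideriv_eq_trig[of 1 "trig x"] fourier_coeff_trig[OF that] by simp
  have av: "antideriv (Suc 0) v = trig A1" "antideriv 2 v = trig A2" "antideriv (Suc 0) (\<lambda>z. (v z)\<^sup>2) = trig C1"
    using antideriv_eq_trig[of 1 v] antideriv_eq_trig[of 2 v] antideriv_eq_trig[of 1 "\<lambda>z. (v z)\<^sup>2"]
    by (simp_all add: v v2 A1_def A2_def C1_def c_def)
  have airy2: "airy (- t) (\<lambda>y. (v y)\<^sup>2) = trig (\<lambda>l. esym t l * c l)"
    unfolding airy_eq_trig v2 c_def ..
  define j1 where "j1 l = 1 / 3 * conv (\<lambda>l. esym t l * A1 l) (\<lambda>l. esym t l * A1 l) l - 1 / 3 * (esym t l * conv A1 A1 l)" for l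
  have l11: "l1 (conv (\<lambda>l. esym t l * A1 l) (\<lambda>l. esym t l * A1 l))" "l1 (\<lambda>l. esym t l * conv A1 A1 l)"
    by (intro trig_mult(2) lE lA1)+
  have l1s: "l1 (\<lambda>l. k * x l)" if "l1 x" for x k
    using that by (rule l1_mult[where K = "cmod k"]) simp
  have J1: "J1 t v = trig j1"
  proof
    fix x
    have sq: "(\<lambda>y. (trig A1 y)\<^sup>2) = trig (conv A1 A1)"
      by (simp add: fun_eq_iff power2_eq_square trig_mult(1)[OF lA1 lA1])
    have "J1 t v x = 1 / 3 * (trig (\<lambda>l. esym t l * A1 l) x)\<^sup>2 - 1 / 3 * trig (\<lambda>l. esym t l * conv A1 A1 l) x"
      by (simp add: J1_def av sq airy lA1 trig_mult(2)[OF lA1 lA1])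
    also have "(trig (\<lambda>l. esym t l * A1 l) x)\<^sup>2 = trig (conv (\<lambda>l. esym t l * A1 l) (\<lambda>l. esym t l * A1 l)) x"
      unfolding power2_eq_square by (rule trig_mult(1)[OF lE lE]) (rule lA1)+
    finally show "J1 t v x = trig j1 x"
      unfolding j1_def[abs_def] trig_diff[OF l1s[OF l11(1)] l1s[OF l11(2)]] trig_scale .
  qed
  have lj1: "l1 j1" unfolding j1_def[abs_def] by (intro l1_diff l1s l11)
  define c' where "c' = (\<lambda>l. (if l = 0 then 0 else esym t l) * c l)"
  have lc': "l1 c'" unfolding c'_def by (rule l1_mult[where K = 1]) (auto simp: lc)
  define j2 where "j2 l = of_real t / 6 * conv (\<lambda>l. esym t l * A1 l) c' l
     - 1 / 18 * (isym 1 l * conv (\<lambda>l. esym t l * A2 l) (\<lambda>l. esym t l * C1 l) l)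
     + 1 / 18 * (esym t l * (isym 1 l * conv A2 C1 l))" for l
  have l12: "l1 (conv (\<lambda>l. esym t l * A1 l) c')" "l1 (\<lambda>l. isym 1 l * conv (\<lambda>l. esym t l * A2 l) (\<lambda>l. esym t l * C1 l) l)"
    "l1 (\<lambda>l. esym t l * (isym 1 l * conv A2 C1 l))"
    by (intro trig_mult(2) lE lD lA1 lA2 lC1 lc')+
  have J2: "J2 t v = trig j2"
  proof
    fix x
    have z: "trig (\<lambda>l. esym t l * c l) x - fourier_coeff (\<lambda>y. (v y)\<^sup>2) 0 = trig c' x"
    proof -
      have single: "trig (\<lambda>l. if l = 0 then c 0 else 0) x = c 0"
      proof -
        have "trig (\<lambda>l. if l = 0 then c 0 else 0) x = (\<Sum>\<^sub>\<infinity>l\<in>{0::int}. c 0)"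
          unfolding trig_def by (rule infsum_cong_neutral) auto
        then show ?thesis by simp
      qed
      have "c' = (\<lambda>l. esym t l * c l - (if l = 0 then c 0 else 0))"
        by (auto simp: c'_def esym_def)
      moreover have "l1 (\<lambda>l. if l = 0 then c 0 else 0)"
        by (rule l1_bound[OF lc, where K = 1]) simp
      ultimately show ?thesis
        using trig_diff[OF lE[OF lc], of "\<lambda>l. if l = 0 then c 0 else 0" x] single by (simp add: v2 c_def)
    qed
    have m1: "trig (\<lambda>l. esym t l * A1 l) x * trig c' x = trig (conv (\<lambda>l. esym t l * A1 l) c') x"
      by (rule trig_mult(1)[OF lE[OF lA1] lc'])
    have m2: "(\<lambda>y. trig (\<lambda>l. esym t l * A2 l) y * trig (\<lambda>l. esym t l * C1 l) y) = trig (conv (\<lambda>l. esym t l * A2 l) (\<lambda>l. esym t l * C1 l))"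
      by (rule ext) (rule trig_mult(1)[OF lE[OF lA2] lE[OF lC1]])
    have m3: "(\<lambda>y. trig A2 y * trig C1 y) = trig (conv A2 C1)"
      by (rule ext) (rule trig_mult(1)[OF lA2 lC1])
    have "J2 t v x = of_real t / 6 * trig (conv (\<lambda>l. esym t l * A1 l) c') x
      - 1 / 18 * trig (\<lambda>l. isym 1 l * conv (\<lambda>l. esym t l * A2 l) (\<lambda>l. esym t l * C1 l) l) x
      + 1 / 18 * trig (\<lambda>l. esym t l * (isym 1 l * conv A2 C1 l)) x"
      unfolding J2_def One_nat_def av airy[OF lA1] airy[OF lA2] airy[OF lC1] airy2 z m2 m3
        anti[OF trig_mult(2)[OF lE[OF lA2] lE[OF lC1]]] anti[OF trig_mult(2)[OF lA2 lC1]]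
        airy[OF lD[OF trig_mult(2)[OF lA2 lC1]]] m1[symmetric]
      by simp
    then show "J2 t v x = trig j2 x"
      unfolding j2_def[abs_def] trig_add[OF l1_diff[OF l1s[OF l12(1)] l1s[OF l12(2)]] l1s[OF l12(3)]]
        trig_diff[OF l1s[OF l12(1)] l1s[OF l12(2)]] trig_scale .
  qed
  have lj2: "l1 j2" unfolding j2_def[abs_def] by (intro l1_add l1_diff l1s l12)
  have lnz: "l1 (\<lambda>l. if l = 0 then 0 else x l)" if "l1 x" for x
    by (rule l1_bound[OF that, where K = 1]) auto
  show ?thesis
  proof
    fix x
    have "lri_step t v x = trig (\<lambda>l. esym t l * a l) x + 1 / 2 * trig (\<lambda>l. if l = 0 then 0 else j1 l) x
       + trig (\<lambda>l. if l = 0 then 0 else j2 l) x"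
      unfolding lri_step_def airy_eq_trig v nonzero_modes_eq_trig J1 J2 fourier_coeff_trig[OF lj1] fourier_coeff_trig[OF lj2] ..
    also have "\<dots> = trig (\<lambda>l. esym t l * a l + 1 / 2 * (if l = 0 then 0 else j1 l) + (if l = 0 then 0 else j2 l)) x"
      unfolding trig_add[OF l1_add[OF lE[OF la] l1s[OF lnz[OF lj1]]] lnz[OF lj2]]
        trig_add[OF lE[OF la] l1s[OF lnz[OF lj1]]] trig_scale ..
    also have "(\<lambda>l. esym t l * a l + 1 / 2 * (if l = 0 then 0 else j1 l) + (if l = 0 then 0 else j2 l)) = lri_seq t a"
    proof
      fix l
      show "esym t l * a l + 1 / 2 * (if l = 0 then 0 else j1 l) + (if l = 0 then 0 else j2 l) = lri_seq t a l"
      proof (cases "l = 0")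
        case True
        then show ?thesis by (simp add: lri_seq_def bsym_zero_mode dsym_zero_mode esym_def)
      next
        case False
        have "1 / 2 * j1 l = esym t l * bil (bsym t) a a l"
          unfolding j1_def A1_def by (rule J1_modes[OF a])
        moreover have "j2 l = esym t l * bil (dsym t) a (conv a a) l"
          unfolding j2_def A1_def A2_def C1_def c'_def c_def by (rule J2_modes[OF a False])
        ultimately show ?thesis using False
          by (simp add: lri_seq_def esym_def[symmetric] distrib_left)
      qed
    qed
    finally show "lri_step t v x = trig (lri_seq t a) x" .
  qed
qed

section \<open>From coefficients back to functions\<close>

lemma sobolev_diff_trig:
  assumes f: "f \<in> sobolev s" and a: "reg a" and C: "Hs_le t K (\<lambda>l. fourier_coeff f l - a l)"
  shows "(\<lambda>x. f x - trig a x) \<in> sobolev t" "sobolev_norm t (\<lambda>x. f x - trig a x) \<le> K"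
proof -
  have la: "l1 a" by (rule reg_l1[OF a])
  note F = sobolevD[OF f]
  have it: "integrable circ (trig a)" by (intro circ_integrable_continuous trig_continuous la)
  have coeff: "fourier_coeff (\<lambda>x. f x - trig a x) = (\<lambda>l. fourier_coeff f l - a l)"
    by (rule ext) (simp only: fourier_coeff_diff[OF F(5) it] fourier_coeff_trig[OF la])
  have bound: "Hs_le t K (fourier_coeff (\<lambda>x. f x - trig a x))" unfolding coeff by (rule C)
  have m: "(\<lambda>x. f x - trig a x) \<in> borel_measurable circ"
    by (intro borel_measurable_diff F(2) borel_measurable_integrable it)
  have i2: "integrable circ (\<lambda>x. 2 * (cmod (f x))\<^sup>2 + 2 * (cmod (trig a x))\<^sup>2)"
    by (intro Bochner_Integration.integrable_add integrable_mult_right F(3) continuous_imp_integrable_real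
          continuous_intros trig_continuous la)
  have "integrable circ (\<lambda>x. (cmod (f x - trig a x))\<^sup>2)"
  proof (rule Bochner_Integration.integrable_bound[OF i2])
    show "(\<lambda>x. (cmod (f x - trig a x))\<^sup>2) \<in> borel_measurable circ"
      by (rule borel_measurable_power[OF measurable_compose[OF m borel_measurable_norm]])
    show "AE x in circ. norm ((cmod (f x - trig a x))\<^sup>2) \<le> norm (2 * (cmod (f x))\<^sup>2 + 2 * (cmod (trig a x))\<^sup>2)"
    proof (rule AE_I2)
      fix x
      have "(cmod (f x - trig a x))\<^sup>2 \<le> (cmod (f x) + cmod (trig a x))\<^sup>2"
        by (intro power_mono norm_triangle_ineq4) simp
      also have "\<dots> \<le> 2 * (cmod (f x))\<^sup>2 + 2 * (cmod (trig a x))\<^sup>2"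
        using zero_le_power2[of "cmod (f x) - cmod (trig a x)"] by (simp add: power2_sum power2_diff)
      finally show "norm ((cmod (f x - trig a x))\<^sup>2) \<le> norm (2 * (cmod (f x))\<^sup>2 + 2 * (cmod (trig a x))\<^sup>2)"
        by simp
    qed
  qed
  moreover have "(\<lambda>l. (J l powr t * cmod (fourier_coeff (\<lambda>x. f x - trig a x) l))\<^sup>2) summable_on UNIV"
    using bound Hs_le_nonneg[OF bound] Hs_le_iff_infsum by blast
  moreover have "f (x + 2 * pi) - trig a (x + 2 * pi) = f x - trig a x" for x
    by (simp only: F(1) trig_periodic)
  ultimately show "(\<lambda>x. f x - trig a x) \<in> sobolev t"
    unfolding sobolev_def using m by blast
  show "sobolev_norm t (\<lambda>x. f x - trig a x) \<le> K" by (rule sobolev_norm_bound(2)[OF bound])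
qed

lemma sobolev_zero: "(\<lambda>x. 0) \<in> sobolev t" "sobolev_norm t (\<lambda>x. 0) = 0"
proof -
  have "fourier_coeff (\<lambda>x. 0) = (\<lambda>l. 0)" by (rule ext) (simp add: fourier_coeff_eq)
  then show "(\<lambda>x. 0) \<in> sobolev t" "sobolev_norm t (\<lambda>x. 0) = 0"
    by (simp_all add: sobolev_def sobolev_norm_def)
qed

context kdv
begin

abbreviation "v0 \<equiv> \<lambda>x. complex_of_real (u0 x)"

text \<open>The statement about coefficients is what the induction carries. Equality with the series
  starts at \<open>n = 1\<close>, since the initial value is known only up to a null set.\<close>

lemma lri_coefficients:
  assumes reg: "\<And>k. k \<le> n \<Longrightarrow> reg ((lri_seq h ^^ k) (c 0))"
  shows "fourier_coeff (lri h v0 n) = (lri_seq h ^^ n) (c 0)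
       \<and> fourier_coeff (\<lambda>x. (lri h v0 n x)\<^sup>2)
           = conv ((lri_seq h ^^ n) (c 0)) ((lri_seq h ^^ n) (c 0))
       \<and> (0 < n \<longrightarrow> lri h v0 n = trig ((lri_seq h ^^ n) (c 0)))"
  using reg
proof (induction n)
  case 0
  have u0: "u 0 = u0" using sol unfolding kdv_solution_def by blast
  have "v0 \<in> sobolev s" using u_sobolev[of 0] T u0 by simp
  from fourier_coeff_square[OF this] show ?case using s u0 by (simp add: c_def)
next
  case (Suc n)
  have eq: "lri h v0 (Suc n) = trig ((lri_seq h ^^ Suc n) (c 0))"
    using Suc.IH Suc.prems lri_step_eq_trig[of "lri h v0 n" "(lri_seq h ^^ n) (c 0)" h]
    by simp
  have "l1 ((lri_seq h ^^ Suc n) (c 0))" by (intro reg_l1 Suc.prems) simp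
  then show ?case
    unfolding eq using fourier_coeff_trig fourier_coeff_trig_square by blast
qed

end

theorem theorem2p1:
  fixes \<gamma> T M :: real
  assumes "\<gamma> \<ge> 0" and "T > 0"
  shows "\<exists>\<tau>0>0. \<exists>C>0. \<forall>(u0 :: real \<Rightarrow> real) (u :: real \<Rightarrow> real \<Rightarrow> real).
           (\<lambda>x. complex_of_real (u0 x)) \<in> sobolev (\<gamma> + 4) \<longrightarrow>
           fourier_coeff (\<lambda>x. complex_of_real (u0 x)) 0 = 0 \<longrightarrow>
           kdv_solution (\<gamma> + 4) T u0 u \<longrightarrow>
           Linf_sobolev_norm T (\<gamma> + 4) u = ereal M \<longrightarrow>
           (\<forall>\<tau> (n :: nat). 0 < \<tau> \<longrightarrow> \<tau> \<le> \<tau>0 \<longrightarrow> real n \<le> T / \<tau> \<longrightarrow>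
              (let e = (\<lambda>x. complex_of_real (u (real n * \<tau>) x)
                              - lri \<tau> (\<lambda>x. complex_of_real (u0 x)) n x)
               in e \<in> sobolev \<gamma> \<and> sobolev_norm \<gamma> e \<le> C * \<tau>\<^sup>2))"
proof -
  \<comment> \<open>The constants have to be chosen before any solution is given, when the sign of
    \<open>M\<close> is still unknown; a solution forces \<open>0 \<le> M\<close>.\<close>
  obtain \<tau>0 C where \<tau>0: "0 < \<tau>0" and C: "0 < C"
    and conv: "\<And>c \<tau> n. fourier_kdv (\<gamma> + 4) T \<bar>M\<bar> c \<Longrightarrow> 0 < \<tau> \<Longrightarrow> \<tau> \<le> \<tau>0 \<Longrightarrow> real n * \<tau> \<le> T \<Longrightarrow>
        Hs_le \<gamma> (C * \<tau>\<^sup>2) (\<lambda>l. c (real n * \<tau>) l - (lri_seq \<tau> ^^ n) (c 0) l)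
      \<and> Hs_le (\<gamma> + 1) 1 (\<lambda>l. c (real n * \<tau>) l - (lri_seq \<tau> ^^ n) (c 0) l)"
    using sequence_convergence[OF assms abs_ge_zero[of M]] by blast
  have "(let e = (\<lambda>x. complex_of_real (u (real n * \<tau>) x) - lri \<tau> (\<lambda>x. complex_of_real (u0 x)) n x)
         in e \<in> sobolev \<gamma> \<and> sobolev_norm \<gamma> e \<le> C * \<tau>\<^sup>2)"
    if hyps: "fourier_coeff (\<lambda>x. complex_of_real (u0 x)) 0 = 0" "kdv_solution (\<gamma> + 4) T u0 u"
      "Linf_sobolev_norm T (\<gamma> + 4) u = ereal M" and \<tau>: "0 < \<tau>" "\<tau> \<le> \<tau>0" and n: "real n \<le> T / \<tau>"
    for u0 u \<tau> n
  proof -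
    interpret kdv "\<gamma> + 4" T M u0 u
      by standard (use assms hyps in auto)
    have M: "0 \<le> M" using Hs_le_nonneg[OF c_bound_M[of 0]] T by simp
    have fk: "fourier_kdv (\<gamma> + 4) T \<bar>M\<bar> c" using fourier_kdv M by simp
    have nT: "real n * \<tau> \<le> T" using n \<tau> by (simp add: pos_le_divide_eq)
    have kT: "real k * \<tau> \<in> {0..T}" if "k \<le> n" for k
    proof -
      have "real k * \<tau> \<le> real n * \<tau>" using that \<tau> by (intro mult_right_mono) auto
      then have "real k * \<tau> \<le> T" using nT by linarith
      then show ?thesis using \<tau> by simp
    qed
    \<comment> \<open>The iterate is the exact solution minus the error, and the error is bounded in
      \<open>H^(\<gamma>+1)\<close> by the second half of the convergence result.\<close>
    have reg: "reg ((lri_seq \<tau> ^^ k) (c 0))" if k: "k \<le> n" for k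
    proof -
      have "reg (c (real k * \<tau>))" using regI[OF c_bound_M[OF kT[OF k]]] assms by simp
      moreover have "reg (\<lambda>l. c (real k * \<tau>) l - (lri_seq \<tau> ^^ k) (c 0) l)"
        using conv[OF fk \<tau>, of k] kT[OF k] regI assms by force
      ultimately show ?thesis using reg_diff by fastforce
    qed
    note L = lri_coefficients[OF reg]
    show ?thesis
    \<comment> \<open>At the start the numerical solution is the given representative itself,
      possibly different from its series, and the error is identically zero.\<close>
    proof (cases "n = 0")
      case True
      have "u 0 = u0" using sol unfolding kdv_solution_def by blast
      then show ?thesis using True sobolev_zero[of \<gamma>] C by (simp add: Let_def)
    next
      case False
      then have eq: "lri \<tau> (\<lambda>x. complex_of_real (u0 x)) n = trig ((lri_seq \<tau> ^^ n) (c 0))" using L by blast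
      have "Hs_le \<gamma> (C * \<tau>\<^sup>2) (\<lambda>l. fourier_coeff (\<lambda>x. complex_of_real (u (real n * \<tau>) x)) l - (lri_seq \<tau> ^^ n) (c 0) l)"
        using conv[OF fk \<tau> nT] unfolding c_def by blast
      from sobolev_diff_trig[OF u_sobolev[OF kT[OF order_refl]] reg[OF order_refl] this]
      show ?thesis unfolding eq Let_def by blast
    qed
  qed
  then show ?thesis using \<tau>0 C by blast
qed

end
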